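(* Let $k\ge 1$ be an integer. Every orbifold solution for the cells of $\mathcal{D}^{(3k+3)}$ is, up to equivalence, either $W$ or its complex conjugate $\overline{W}$; these two cell systems are inequivalent. Here $W$ is given, for $i=1,2,3$, by $$W^{(\gamma)}_{(k-1,k),(k,k)_i,(k,k-1)}=\epsilon_i\frac{[k]\sqrt{[k+1]^3[k+2]}}{\sqrt{3}\,[2]},\qquad W^{(\gamma')}_{(k-1,k),(k,k)_i,(k,k-1)}=\overline{\epsilon_i}\,\frac{[k+2]\sqrt{[k][k+1]^3}}{\sqrt{3}\,[2]},$$ $$W^{(\gamma)}_{(k-1,k-1),(k,k-1),(k-1,k)}=\frac{[k][k+1]\sqrt{[k+2][k+3]}}{[2]},\qquad W^{(\gamma')}_{(k+1,k-2),(k,k-1),(k-1,k)}=\frac{[k+1][k+2]\sqrt{[k-1][k]}}{[2]},$$ $$W^{(\gamma')}_{(k-1,k-1),(k,k-1),(k-1,k)}=W^{(\gamma)}_{(k+1,k-2),(k,k-1),(k-1,k)}=0,$$ where $\epsilon_1=1$, $\epsilon_2=e^{2\pi i/3}=\overline{\epsilon_3}$, and all other cells are equal to the corresponding cells in $\mathcal{A}^{(3k+3)}$, given by $$W_{\triangle(a,b)}=\frac{\sqrt{[a+1][a+2][b+1][b+2][a+b+2][a+b+3]}}{[2]},\qquad W_{\nabla(a,b)}=\frac{\sqrt{[a+1][a+2][b+1][b+2][a+b+3][a+b+4]}}{[2]}.$$ (For $k=1$ the vertex $(k+1,k-2)$ does not exist and the formulas involving it are omitted.)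
   Context: Let $n=3k+3$, $q=e^{\pi i/n}$ and $[m]=(q^m-q^{-m})/(q-q^{-1})$. The graph $\mathcal{A}^{(n)}$ has vertices $(\lambda_1,\lambda_2)$, $\lambda_1,\lambda_2\ge 0$ integers with $\lambda_1+\lambda_2\le n-3$, and directed edges $(\lambda_1,\lambda_2)\to(\lambda_1+1,\lambda_2)$, $(\lambda_1-1,\lambda_2+1)$, $(\lambda_1,\lambda_2-1)$ whenever the target is a vertex. Its Perron-Frobenius eigenvector (eigenvalue $[3]$) is $\phi_{(\lambda_1,\lambda_2)}=[\lambda_1+1][\lambda_2+1][\lambda_1+\lambda_2+2]/[2]$. $\triangle(a,b)$ is the triangle $(a,b)\to(a+1,b)\to(a,b+1)\to(a,b)$ and $\nabla(a,b)$ is the triangle $(a+1,b)\to(a,b+1)\to(a+1,b+1)\to(a+1,b)$. The rotation $\rho(\lambda_1,\lambda_2)=(3k-\lambda_1-\lambda_2,\lambda_1)$ generates a $\mathbb{Z}_3$-action on $\mathcal{A}^{(3k+3)}$ with unique fixed vertex $(k,k)$. The orbifold graph $\mathcal{D}^{(3k+3)}$ has as vertices the orbits of the vertices other than $(k,k)$ (each denoted by any representative) and three further vertices $(k,k)_1,(k,k)_2,(k,k)_3$. Its edges are the orbits of the edges of $\mathcal{A}^{(3k+3)}$ not involving $(k,k)$, together with one edge $(k-1,k)\to(k,k)_i$ and one edge $(k,k)_i\to(k,k-1)$ for each $i=1,2,3$. There is exactly one double edge, from $(k,k-1)$ to $(k-1,k)$: $\gamma$ is the orbit of the edge $(k,k-1)\to(k-1,k)$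 and $\gamma'$ is the orbit of $(k,k-1)\to(k+1,k-1)$ (note $(k+1,k-1)=\rho(k-1,k)$). The Perron-Frobenius weights are those of $\mathcal{A}^{(3k+3)}$ on orbits, and $\phi_{(k,k)_i}=\phi_{(k,k)}/3=[k+1]^3/(3[2])$. For $\xi\in\{\gamma,\gamma'\}$, $W^{(\xi)}_{\ldots}$ denotes the cell of the triangle on the indicated vertices which uses the edge $\xi$ from $(k,k-1)$ to $(k-1,k)$: i.e. $v\to(k,k-1)\xrightarrow{\xi}(k-1,k)\to v$ for $v=(k-1,k-1)$, $(k+1,k-2)$ or $(k,k)_i$. All other triangles of $\mathcal{D}^{(3k+3)}$ are images of a $\mathbb{Z}_3$-orbit of triangles of $\mathcal{A}^{(3k+3)}$ (the corresponding triangles). An orbifold solution is a cell system on $\mathcal{D}^{(3k+3)}$ whose cells have absolute values determined by the orbifold procedure: $|W^{(\gamma)}_{(k-1,k),(k,k)_i,(k,k-1)}|^2=[k]^2[k+1]^3[k+2]/(3[2]^2)$ and $|W^{(\gamma')}_{(k-1,k),(k,k)_i,(k,k-1)}|^2=[k][k+1]^3[k+2]^2/(3[2]^2)$ (one third of the corresponding squared values for $\mathcal{A}^{(3k+3)}$), $W^{(\gamma')}_{(k-1,k-1),(k,k-1),(k-1,k)}=W^{(\gamma)}_{(k+1,k-2),(k,k-1),(k-1,k)}=0$, and for every other triangle the absolute value equals that of the corresponding cell of $\mathcal{A}^{(3k+3)}$ (in particular $|W^{(\gamma)}_{(k-1,k-1),(k,k-1),(k-1,k)}|^2=[k]^2[k+1]^2[k+2][k+3]/[2]^2$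 and $|W^{(\gamma')}_{(k+1,k-2),(k,k-1),(k-1,k)}|^2=[k-1][k][k+1]^2[k+2]^2/[2]^2$). Cell systems: let $\mathcal{G}$ be a directed graph (loops and multiple edges allowed), with source and range maps $s,r$, Perron-Frobenius eigenvalue $[3]$ and positive Perron-Frobenius eigenvector $(\phi_i)$. A triangle $\triangle_{ijk}^{(\alpha\beta\gamma)}$ is a closed path $i\xrightarrow{\alpha}j\xrightarrow{\beta}k\xrightarrow{\gamma}i$, considered up to cyclic rotation. A cell system $W$ assigns to each triangle a complex number $W(\triangle_{ijk}^{(\alpha\beta\gamma)})$ such that: (I) for all edges $\alpha,\alpha'$ from $i$ to $j$, $\sum_{k,\beta,\gamma}W(\triangle_{ijk}^{(\alpha\beta\gamma)})\overline{W(\triangle_{ijk}^{(\alpha'\beta\gamma)})}=\delta_{\alpha,\alpha'}[2]\phi_i\phi_j$, the sum being over vertices $k$ and edges $\beta:j\to k$, $\gamma:k\to i$; (II) for all edges $\alpha_1,\dots,\alpha_4$ with $s(\alpha_1)=s(\alpha_4)=i_1$, $r(\alpha_1)=r(\alpha_2)=i_2$, $s(\alpha_2)=s(\alpha_3)=i_3$, $r(\alpha_3)=r(\alpha_4)=i_4$, $$\sum\phi_k^{-1}W(\triangle_{i_1i_2k}^{(\alpha_1\beta_1\beta_2)})\overline{W(\triangle_{i_3i_2k}^{(\alpha_2\beta_1\beta_3)})}W(\triangle_{i_3i_4k}^{(\alpha_3\beta_4\beta_3)})\overline{W(\triangle_{i_1i_4k}^{(\alpha_4\beta_4\beta_2)})}=\delta_{\alpha_1,\alpha_4}\delta_{\alpha_2,\alpha_3}\phi_{i_1}\phi_{i_2}\phi_{i_3}+\delta_{\alpha_1,\alpha_2}\delta_{\alpha_3,\alpha_4}\phi_{i_1}\phi_{i_2}\phi_{i_4},$$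 the sum being over vertices $k$ and edges $\beta_1:i_2\to k$, $\beta_2:k\to i_1$, $\beta_3:k\to i_3$, $\beta_4:i_4\to k$. Two cell systems $W_1,W_2$ on $\mathcal{G}$ are equivalent if for each pair of adjacent vertices $i,j$ there is a unitary matrix $(u(\sigma,\sigma'))$ indexed by the edges from $i$ to $j$ such that for every triangle $W_1(\triangle_{ijk}^{(\sigma\rho\gamma)})=\sum_{\sigma',\rho',\gamma'}u(\sigma,\sigma')u(\rho,\rho')u(\gamma,\gamma')W_2(\triangle_{ijk}^{(\sigma'\rho'\gamma')})$, summing over edges $\sigma':i\to j$, $\rho':j\to k$, $\gamma':k\to i$. *)

theory Defs
  imports Complex_Main "Graph_Theory.Digraph"
begin

section \<open>Quantum integers\<close>

definition q_root :: "int \<Rightarrow> complex" where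
  "q_root n = exp (complex_of_real pi * \<i> / of_int n)"

text \<open>The defining quotient is a real number (see \<open>of_real_qint\<close>), so that
  taking the real part only changes the type.\<close>

definition qint :: "int \<Rightarrow> int \<Rightarrow> real" where
  "qint n m = Re ((q_root n powi m - q_root n powi (- m)) / (q_root n - inverse (q_root n)))"

lemma q_root_powi_diff:
  "q_root n powi m - q_root n powi (- m) = 2 * \<i> * of_real (sin (pi * of_int m / of_int n))"
proof -
  have e: "q_root n powi j = cis (pi * of_int j / of_int n)" for j
  proof -
    have "q_root n = cis (pi / of_int n)"
      by (simp add: q_root_def cis_conv_exp mult_ac)
    thus ?thesis
      by (simp add: cis_power_int mult.commute)
  qed
  show ?thesis
    unfolding e by (simp add: complex_eq_iff)
qed

lemma qint_quotient:
  "(q_root n powi m - q_root n powi (- m)) / (q_root n - inverse (q_root n))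
     = of_real (sin (pi * of_int m / of_int n) / sin (pi / of_int n))"
proof -
  have "q_root n - inverse (q_root n) = 2 * \<i> * of_real (sin (pi / of_int n))"
    using q_root_powi_diff [of n 1] by (simp add: power_int_minus)
  then show ?thesis
    unfolding q_root_powi_diff by simp
qed

lemma qint_eq_sin: "qint n m = sin (pi * of_int m / of_int n) / sin (pi / of_int n)"
  unfolding qint_def qint_quotient by simp

lemma of_real_qint:
  "complex_of_real (qint n m)
     = (q_root n powi m - q_root n powi (- m)) / (q_root n - inverse (q_root n))"
  unfolding qint_eq_sin qint_quotient ..


section \<open>Cell systems on directed multigraphs\<close>

definition arcs_between :: "('v, 'e) pre_digraph \<Rightarrow> 'v \<Rightarrow> 'v \<Rightarrow> 'e set" where
  "arcs_between G i j = {e \<in> arcs G. tail G e = i \<and> head G e = j}"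

definition is_triangle :: "('v, 'e) pre_digraph \<Rightarrow> 'e \<Rightarrow> 'e \<Rightarrow> 'e \<Rightarrow> bool" where
  "is_triangle G \<alpha> \<beta> \<gamma> \<longleftrightarrow>
     \<alpha> \<in> arcs G \<and> \<beta> \<in> arcs G \<and> \<gamma> \<in> arcs G \<and>
     head G \<alpha> = tail G \<beta> \<and> head G \<beta> = tail G \<gamma> \<and> head G \<gamma> = tail G \<alpha>"

text \<open>A strictly positive eigenvector of a nonnegative matrix necessarily belongs to the
  spectral radius, so \<open>\<mu>\<close> is the Perron-Frobenius eigenvalue of the adjacency matrix.\<close>

definition perron_frobenius :: "('v, 'e) pre_digraph \<Rightarrow> real \<Rightarrow> ('v \<Rightarrow> real) \<Rightarrow> bool" where
  "perron_frobenius G \<mu> \<phi> \<longleftrightarrow>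
     (\<forall>v \<in> verts G. \<phi> v > 0) \<and>
     (\<forall>v \<in> verts G. (\<Sum>e \<in> out_arcs G v. \<phi> (head G e)) = \<mu> * \<phi> v)"

definition cell_type_I ::
  "int \<Rightarrow> ('v, 'e) pre_digraph \<Rightarrow> ('v \<Rightarrow> real) \<Rightarrow> ('e \<Rightarrow> 'e \<Rightarrow> 'e \<Rightarrow> complex) \<Rightarrow> bool" where
  "cell_type_I n G \<phi> W \<longleftrightarrow>
     (\<forall>i \<in> verts G. \<forall>j \<in> verts G. \<forall>\<alpha> \<in> arcs_between G i j. \<forall>\<alpha>' \<in> arcs_between G i j.
        (\<Sum>k \<in> verts G. \<Sum>\<beta> \<in> arcs_between G j k. \<Sum>\<gamma> \<in> arcs_between G k i.
            W \<alpha> \<beta> \<gamma> * cnj (W \<alpha>' \<beta> \<gamma>))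
        = (if \<alpha> = \<alpha>' then of_real (qint n 2 * \<phi> i * \<phi> j) else 0))"

definition cell_type_II ::
  "('v, 'e) pre_digraph \<Rightarrow> ('v \<Rightarrow> real) \<Rightarrow> ('e \<Rightarrow> 'e \<Rightarrow> 'e \<Rightarrow> complex) \<Rightarrow> bool" where
  "cell_type_II G \<phi> W \<longleftrightarrow>
     (\<forall>i1 \<in> verts G. \<forall>i2 \<in> verts G. \<forall>i3 \<in> verts G. \<forall>i4 \<in> verts G.
      \<forall>\<alpha>1 \<in> arcs_between G i1 i2. \<forall>\<alpha>2 \<in> arcs_between G i3 i2.
      \<forall>\<alpha>3 \<in> arcs_between G i3 i4. \<forall>\<alpha>4 \<in> arcs_between G i1 i4.
        (\<Sum>k \<in> verts G. \<Sum>\<beta>1 \<in> arcs_between G i2 k. \<Sum>\<beta>2 \<in> arcs_between G k i1.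
         \<Sum>\<beta>3 \<in> arcs_between G k i3. \<Sum>\<beta>4 \<in> arcs_between G i4 k.
            of_real (inverse (\<phi> k)) * W \<alpha>1 \<beta>1 \<beta>2 * cnj (W \<alpha>2 \<beta>1 \<beta>3)
              * W \<alpha>3 \<beta>4 \<beta>3 * cnj (W \<alpha>4 \<beta>4 \<beta>2))
        = (if \<alpha>1 = \<alpha>4 \<and> \<alpha>2 = \<alpha>3 then of_real (\<phi> i1 * \<phi> i2 * \<phi> i3) else 0)
        + (if \<alpha>1 = \<alpha>2 \<and> \<alpha>3 = \<alpha>4 then of_real (\<phi> i1 * \<phi> i2 * \<phi> i4) else 0))"

text \<open>A cell system is a function on closed paths of length three which is invariant
  under cyclic rotation; its values on other triples of arcs are irrelevant.\<close>

definition cell_system ::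
  "int \<Rightarrow> ('v, 'e) pre_digraph \<Rightarrow> ('v \<Rightarrow> real) \<Rightarrow> ('e \<Rightarrow> 'e \<Rightarrow> 'e \<Rightarrow> complex) \<Rightarrow> bool" where
  "cell_system n G \<phi> W \<longleftrightarrow>
     fin_digraph G \<and> perron_frobenius G (qint n 3) \<phi> \<and>
     (\<forall>\<alpha> \<beta> \<gamma>. is_triangle G \<alpha> \<beta> \<gamma> \<longrightarrow> W \<alpha> \<beta> \<gamma> = W \<beta> \<gamma> \<alpha>) \<and>
     cell_type_I n G \<phi> W \<and> cell_type_II G \<phi> W"

definition unitary_on :: "'e set \<Rightarrow> ('e \<Rightarrow> 'e \<Rightarrow> complex) \<Rightarrow> bool" where
  "unitary_on E u \<longleftrightarrow>
     (\<forall>\<sigma> \<in> E. \<forall>\<tau> \<in> E. (\<Sum>\<rho> \<in> E. u \<sigma> \<rho> * cnj (u \<tau> \<rho>)) = (if \<sigma> = \<tau> then 1 else 0)) \<and>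
     (\<forall>\<sigma> \<in> E. \<forall>\<tau> \<in> E. (\<Sum>\<rho> \<in> E. cnj (u \<rho> \<sigma>) * u \<rho> \<tau>) = (if \<sigma> = \<tau> then 1 else 0))"

text \<open>An arc determines its end points, so one function \<open>u\<close> of two arcs collects the
  unitary matrices of all ordered pairs \<open>(i, j)\<close>.\<close>

definition cells_equivalent ::
  "('v, 'e) pre_digraph \<Rightarrow> ('e \<Rightarrow> 'e \<Rightarrow> 'e \<Rightarrow> complex) \<Rightarrow> ('e \<Rightarrow> 'e \<Rightarrow> 'e \<Rightarrow> complex) \<Rightarrow> bool" where
  "cells_equivalent G W1 W2 \<longleftrightarrow>
     (\<exists>u. (\<forall>i \<in> verts G. \<forall>j \<in> verts G. unitary_on (arcs_between G i j) u) \<and>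
       (\<forall>i \<in> verts G. \<forall>j \<in> verts G. \<forall>k \<in> verts G.
        \<forall>\<sigma> \<in> arcs_between G i j. \<forall>\<rho> \<in> arcs_between G j k. \<forall>\<gamma> \<in> arcs_between G k i.
          W1 \<sigma> \<rho> \<gamma> =
            (\<Sum>\<sigma>' \<in> arcs_between G i j. \<Sum>\<rho>' \<in> arcs_between G j k. \<Sum>\<gamma>' \<in> arcs_between G k i.
               u \<sigma> \<sigma>' * u \<rho> \<rho>' * u \<gamma> \<gamma>' * W2 \<sigma>' \<rho>' \<gamma>')))"

definition conj_cells :: "('e \<Rightarrow> 'e \<Rightarrow> 'e \<Rightarrow> complex) \<Rightarrow> 'e \<Rightarrow> 'e \<Rightarrow> 'e \<Rightarrow> complex" where
  "conj_cells W \<alpha> \<beta> \<gamma> = cnj (W \<alpha> \<beta> \<gamma>)"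


section \<open>The graph \<open>\<A>\<^sup>(\<^sup>n\<^sup>)\<close>\<close>

type_synonym avert = "int \<times> int"

type_synonym aarc = "avert \<times> avert"

definition A_verts :: "int \<Rightarrow> avert set" where
  "A_verts n = {(a, b). a \<ge> 0 \<and> b \<ge> 0 \<and> a + b \<le> n - 3}"

definition A_graph :: "int \<Rightarrow> (avert, aarc) pre_digraph" where
  "A_graph n =
     \<lparr>verts = A_verts n,
      arcs = {((a, b), v) | a b v. (a, b) \<in> A_verts n \<and> v \<in> A_verts n \<and>
                v \<in> {(a + 1, b), (a - 1, b + 1), (a, b - 1)}},
      tail = fst, head = snd\<rparr>"

definition A_weight :: "int \<Rightarrow> avert \<Rightarrow> real" where
  "A_weight n = (\<lambda>(a, b). qint n (a + 1) * qint n (b + 1) * qint n (a + b + 2) / qint n 2)"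

text \<open>The cells of the triangles
  \<open>(a, b) \<rightarrow> (a + 1, b) \<rightarrow> (a, b + 1) \<rightarrow> (a, b)\<close> and
  \<open>(a + 1, b) \<rightarrow> (a, b + 1) \<rightarrow> (a + 1, b + 1) \<rightarrow> (a + 1, b)\<close>; up to rotation
  these are all the triangles of the graph.\<close>

definition A_cell_up :: "int \<Rightarrow> int \<Rightarrow> int \<Rightarrow> real" where
  "A_cell_up n a b =
     sqrt (qint n (a + 1) * qint n (a + 2) * qint n (b + 1) * qint n (b + 2)
           * qint n (a + b + 2) * qint n (a + b + 3)) / qint n 2"

definition A_cell_down :: "int \<Rightarrow> int \<Rightarrow> int \<Rightarrow> real" where
  "A_cell_down n a b =
     sqrt (qint n (a + 1) * qint n (a + 2) * qint n (b + 1) * qint n (b + 2)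
           * qint n (a + b + 3) * qint n (a + b + 4)) / qint n 2"


section \<open>The orbifold graph \<open>\<D>\<^sup>(\<^sup>3\<^sup>k\<^sup>+\<^sup>3\<^sup>)\<close>\<close>

definition rot :: "int \<Rightarrow> avert \<Rightarrow> avert" where
  "rot k = (\<lambda>(a, b). (3 * k - a - b, a))"

definition vert_orbit :: "int \<Rightarrow> avert \<Rightarrow> avert set" where
  "vert_orbit k v = {v, rot k v, rot k (rot k v)}"

definition arc_orbit :: "int \<Rightarrow> aarc \<Rightarrow> aarc set" where
  "arc_orbit k e =
     {e, map_prod (rot k) (rot k) e, map_prod (rot k) (rot k) (map_prod (rot k) (rot k) e)}"

text \<open>\<open>Split i\<close> is the vertex \<open>(k, k)\<^sub>i\<close>; \<open>Into i\<close> and \<open>Outof i\<close> are the arcs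
  \<open>(k - 1, k) \<rightarrow> (k, k)\<^sub>i\<close> and \<open>(k, k)\<^sub>i \<rightarrow> (k, k - 1)\<close>.\<close>

datatype dvert = Orbit_vert "avert set" | Split nat

datatype darc = Orbit_arc "aarc set" | Into nat | Outof nat

text \<open>The projection of an orbit of arcs onto its first (second) components is
  the orbit of the source (target).\<close>

fun D_tail :: "int \<Rightarrow> darc \<Rightarrow> dvert" where
  "D_tail k (Orbit_arc E) = Orbit_vert (fst ` E)"
| "D_tail k (Into i) = Orbit_vert (vert_orbit k (k - 1, k))"
| "D_tail k (Outof i) = Split i"

fun D_head :: "int \<Rightarrow> darc \<Rightarrow> dvert" where
  "D_head k (Orbit_arc E) = Orbit_vert (snd ` E)"
| "D_head k (Into i) = Split i"
| "D_head k (Outof i) = Orbit_vert (vert_orbit k (k, k - 1))"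

definition D_graph :: "int \<Rightarrow> (dvert, darc) pre_digraph" where
  "D_graph k =
     \<lparr>verts = {Orbit_vert (vert_orbit k v) | v. v \<in> verts (A_graph (3 * k + 3)) \<and> v \<noteq> (k, k)}
                \<union> Split ` {1, 2, 3},
      arcs = {Orbit_arc (arc_orbit k e) | e. e \<in> arcs (A_graph (3 * k + 3)) \<and>
                fst e \<noteq> (k, k) \<and> snd e \<noteq> (k, k)}
                \<union> Into ` {1, 2, 3} \<union> Outof ` {1, 2, 3},
      tail = D_tail k, head = D_head k\<rparr>"

text \<open>The weight of \<open>\<A>\<^sup>(\<^sup>3\<^sup>k\<^sup>+\<^sup>3\<^sup>)\<close> is constant on orbits, so the image below is a singleton.\<close>

fun D_weight :: "int \<Rightarrow> dvert \<Rightarrow> real" where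
  "D_weight k (Orbit_vert S) = the_elem (A_weight (3 * k + 3) ` S)"
| "D_weight k (Split i) = A_weight (3 * k + 3) (k, k) / 3"

definition D_arc :: "int \<Rightarrow> avert \<Rightarrow> avert \<Rightarrow> darc" where
  "D_arc k v w = Orbit_arc (arc_orbit k (v, w))"

definition gamma_arc :: "int \<Rightarrow> darc" where
  "gamma_arc k = D_arc k (k, k - 1) (k - 1, k)"

definition gamma'_arc :: "int \<Rightarrow> darc" where
  "gamma'_arc k = D_arc k (k, k - 1) (k + 1, k - 1)"

text \<open>The cell of the image in the orbifold graph of the triangle
  \<open>u \<rightarrow> v \<rightarrow> w \<rightarrow> u\<close> of \<open>\<A>\<^sup>(\<^sup>3\<^sup>k\<^sup>+\<^sup>3\<^sup>)\<close>, and the set of vertex triples that avoid \<open>(k, k)\<close>.\<close>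

definition D_cell ::
  "int \<Rightarrow> (darc \<Rightarrow> darc \<Rightarrow> darc \<Rightarrow> complex) \<Rightarrow> avert \<Rightarrow> avert \<Rightarrow> avert \<Rightarrow> complex" where
  "D_cell k W u v w = W (D_arc k u v) (D_arc k v w) (D_arc k w u)"

definition off_centre :: "int \<Rightarrow> avert set \<Rightarrow> bool" where
  "off_centre k S \<longleftrightarrow> S \<subseteq> verts (A_graph (3 * k + 3)) \<and> (k, k) \<notin> S"

text \<open>The cells \<open>v \<rightarrow> (k, k - 1) \<rightarrow> (k - 1, k) \<rightarrow> v\<close> through \<open>\<xi> \<in> {\<gamma>, \<gamma>'}\<close>,
  for \<open>v\<close> equal to \<open>(k, k)\<^sub>i\<close>, \<open>(k - 1, k - 1)\<close> and \<open>(k + 1, k - 2)\<close>.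
  In the last case the returning arc is written with
  the representative \<open>(k + 1, k - 1)\<close> of \<open>(k - 1, k)\<close>,
  because \<open>(k - 1, k) \<rightarrow> (k + 1, k - 2)\<close> is not an arc of \<open>\<A>\<^sup>(\<^sup>3\<^sup>k\<^sup>+\<^sup>3\<^sup>)\<close>.\<close>

definition cell_split ::
  "int \<Rightarrow> (darc \<Rightarrow> darc \<Rightarrow> darc \<Rightarrow> complex) \<Rightarrow> darc \<Rightarrow> nat \<Rightarrow> complex" where
  "cell_split k W \<xi> i = W (Into i) (Outof i) \<xi>"

definition cell_low ::
  "int \<Rightarrow> (darc \<Rightarrow> darc \<Rightarrow> darc \<Rightarrow> complex) \<Rightarrow> darc \<Rightarrow> complex" where
  "cell_low k W \<xi> =
     W (D_arc k (k - 1, k - 1) (k, k - 1)) \<xi> (D_arc k (k - 1, k) (k - 1, k - 1))"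

definition cell_side ::
  "int \<Rightarrow> (darc \<Rightarrow> darc \<Rightarrow> darc \<Rightarrow> complex) \<Rightarrow> darc \<Rightarrow> complex" where
  "cell_side k W \<xi> =
     W (D_arc k (k + 1, k - 2) (k, k - 1)) \<xi> (D_arc k (k + 1, k - 1) (k + 1, k - 2))"


section \<open>Orbifold solutions\<close>

text \<open>For \<open>k = 1\<close> the vertex \<open>(k + 1, k - 2)\<close> does not exist. The last two clauses
  include the triangle \<open>(k - 1, k - 1), (k, k - 1), (k - 1, k)\<close> through \<open>\<gamma>\<close> and
  the triangle \<open>(k + 1, k - 2), (k, k - 1), (k + 1, k - 1)\<close> through \<open>\<gamma>'\<close>.\<close>

definition orbifold_solution :: "int \<Rightarrow> (darc \<Rightarrow> darc \<Rightarrow> darc \<Rightarrow> complex) \<Rightarrow> bool" where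
  "orbifold_solution k W \<longleftrightarrow>
     (let n = 3 * k + 3; qi = qint n; \<gamma> = gamma_arc k; \<gamma>' = gamma'_arc k in
       cell_system n (D_graph k) (D_weight k) W \<and>
       (\<forall>i \<in> {1, 2, 3}.
          (cmod (cell_split k W \<gamma> i))\<^sup>2
            = (qi k)\<^sup>2 * qi (k + 1) ^ 3 * qi (k + 2) / (3 * (qi 2)\<^sup>2) \<and>
          (cmod (cell_split k W \<gamma>' i))\<^sup>2
            = qi k * qi (k + 1) ^ 3 * (qi (k + 2))\<^sup>2 / (3 * (qi 2)\<^sup>2)) \<and>
       cell_low k W \<gamma>' = 0 \<and>
       (k \<noteq> 1 \<longrightarrow> cell_side k W \<gamma> = 0) \<and>
       (\<forall>a b. off_centre k {(a, b), (a + 1, b), (a, b + 1)} \<longrightarrow>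
          cmod (D_cell k W (a, b) (a + 1, b) (a, b + 1)) = \<bar>A_cell_up n a b\<bar>) \<and>
       (\<forall>a b. off_centre k {(a + 1, b), (a, b + 1), (a + 1, b + 1)} \<longrightarrow>
          cmod (D_cell k W (a + 1, b) (a, b + 1) (a + 1, b + 1)) = \<bar>A_cell_down n a b\<bar>))"

definition eps :: "nat \<Rightarrow> complex" where
  "eps i = (if i = 1 then 1
            else if i = 2 then exp (2 * complex_of_real pi * \<i> / 3)
            else cnj (exp (2 * complex_of_real pi * \<i> / 3)))"

text \<open>Together with invariance under rotation, the following prescribes the value of
  \<open>W\<close> on every triangle of the orbifold graph. The values on \<open>cell_low\<close> through \<open>\<gamma>\<close> and
  \<open>cell_side\<close> through \<open>\<gamma>'\<close> agree with those of the last two clauses since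
  \<open>[2k] = [k + 3]\<close>, \<open>[2k + 1] = [k + 2]\<close> and \<open>[2k + 2] = [k + 1]\<close>.\<close>

definition standard_cells :: "int \<Rightarrow> (darc \<Rightarrow> darc \<Rightarrow> darc \<Rightarrow> complex) \<Rightarrow> bool" where
  "standard_cells k W \<longleftrightarrow>
     (let n = 3 * k + 3; qi = qint n; \<gamma> = gamma_arc k; \<gamma>' = gamma'_arc k in
       (\<forall>i \<in> {1, 2, 3}.
          cell_split k W \<gamma> i
            = eps i * of_real (qi k * sqrt (qi (k + 1) ^ 3 * qi (k + 2)) / (sqrt 3 * qi 2)) \<and>
          cell_split k W \<gamma>' i
            = cnj (eps i) * of_real (qi (k + 2) * sqrt (qi k * qi (k + 1) ^ 3) / (sqrt 3 * qi 2))) \<and>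
       cell_low k W \<gamma> = of_real (qi k * qi (k + 1) * sqrt (qi (k + 2) * qi (k + 3)) / qi 2) \<and>
       cell_low k W \<gamma>' = 0 \<and>
       (k \<noteq> 1 \<longrightarrow>
          cell_side k W \<gamma>' = of_real (qi (k + 1) * qi (k + 2) * sqrt (qi (k - 1) * qi k) / qi 2) \<and>
          cell_side k W \<gamma> = 0) \<and>
       (\<forall>a b. off_centre k {(a, b), (a + 1, b), (a, b + 1)} \<longrightarrow>
          D_cell k W (a, b) (a + 1, b) (a, b + 1) = of_real (A_cell_up n a b)) \<and>
       (\<forall>a b. off_centre k {(a + 1, b), (a, b + 1), (a + 1, b + 1)} \<longrightarrow>
          D_cell k W (a + 1, b) (a, b + 1) (a + 1, b + 1) = of_real (A_cell_down n a b)))"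

end

theory Submission
  imports Defs
begin

text \<open>
  A vertex \<open>(a, b)\<close> of \<open>\<A>\<^sup>(\<^sup>3\<^sup>k\<^sup>+\<^sup>3\<^sup>)\<close> is written as a triple \<open>(a, b, c)\<close> with \<open>a + b + c = 3k\<close>, so that
  the rotation is the cyclic shift of coordinates. Each orbit of arcs contains exactly one arc
  \<open>(a, b) \<rightarrow> (a + 1, b)\<close>; the arcs of the orbifold graph away from the centre are therefore the triples
  with sum \<open>3k - 1\<close> (\<open>edge\<close>), weights and squared cells are symmetric products over the coordinates,
  and incidence is linear arithmetic.

  That \<open>W\<close> is a cell system is a matter of identities between quantum integers. Type I follows from
  \<open>[m + 1] + [m - 1] = [2][m]\<close>, and for the pair \<open>\<gamma>, \<gamma>'\<close> from the vanishing of the sum of the squares of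
  the cube roots of unity. In a type II relation, four triangles around a vertex that is not
  split form a square of the triangular lattice that is folded onto itself (\<open>regular_square\<close>), which
  leaves the identities \<open>cell_fourth_identity\<close> and \<open>cell_pair_identity\<close> of \<open>\<A>\<^sup>(\<^sup>3\<^sup>k\<^sup>+\<^sup>3\<^sup>)\<close>. Squares of arcs
  \<open>\<gamma>, \<gamma>'\<close> also see the three split vertices; their contributions add up to that of the centre
  if the square is folded, and otherwise cancel (\<open>eps_alternating_sum\<close>). The squares with a split
  corner rest on \<open>[k]\<^sup>2 + [k + 2]\<^sup>2 - [k][k + 2] = [k + 1]\<^sup>2\<close> (\<open>spoke_gram\<close>).

  Conversely, let \<open>X\<close> be an orbifold solution. The absolute values of its cells are prescribed, and the type I relation
  for \<open>\<gamma>, \<gamma>'\<close> says that three numbers of equal absolute value have sum zero. So they are the cube roots of unity up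
  to a common factor, in one of two orders (\<open>split_phases\<close>), and this selects \<open>W\<close> or its conjugate. All
  other phases can be removed by an equivalence: once the phases at the split vertices and on \<open>\<gamma>, \<gamma>'\<close> are
  chosen, the remaining triangles form an annulus, and each has a side towards the outside whose phase is still free
  (\<open>phase_extension\<close>, \<open>index_rank_increases\<close>).

  Finally, an equivalence between \<open>W\<close> and its conjugate has to be diagonal on \<open>\<gamma>, \<gamma>'\<close>, because exactly one of
  them has a nonzero cell at \<open>(k - 1, k - 1)\<close>. It would then identify the squares of the cube roots of unity with
  their conjugates up to one common factor, which is impossible (\<open>not_equivalent_conj\<close>).
\<close>

section \<open>Quantum integers\<close>

lemma sin_pi_over_pos: "n \<ge> 2 \<Longrightarrow> sin (pi / real_of_int n) > 0"
  by (intro sin_gt_zero) (auto simp: field_simps)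

lemma qint_0 [simp]: "qint n 0 = 0"
  by (simp add: qint_eq_sin)

lemma qint_1: "n \<ge> 2 \<Longrightarrow> qint n 1 = 1"
  using sin_pi_over_pos [of n] by (simp add: qint_eq_sin)

lemma qint_pos:
  assumes "0 < m" "m < n"
  shows "qint n m > 0"
proof -
  have "sin (pi * real_of_int m / real_of_int n) > 0"
    using assms by (intro sin_gt_zero) (auto simp: field_simps)
  with sin_pi_over_pos [of n] assms show ?thesis
    by (simp add: qint_eq_sin)
qed

lemma qint_reflect:
  assumes "n \<ge> 1"
  shows "qint n (n - m) = qint n m"
proof -
  have "pi * real_of_int (n - m) / real_of_int n = pi - pi * real_of_int m / real_of_int n"
    using assms by (simp add: field_simps)
  then show ?thesis
    by (simp only: qint_eq_sin sin_pi_minus)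
qed

text \<open>The sine addition theorem. It expresses every quantum integer of a sum through
  \<open>[x - 1], [x], [y], [y + 1]\<close>, which turns the identities below into polynomial identities.\<close>

lemma qint_add:
  assumes "n \<ge> 2"
  shows "qint n (x + y) = qint n x * qint n (y + 1) - qint n (x - 1) * qint n y"
proof -
  define t where "t = pi / real_of_int n"
  have s: "qint n m = sin (real_of_int m * t) / sin t" for m
    by (simp add: qint_eq_sin t_def mult.commute)
  have st: "sin t \<noteq> 0"
    using sin_pi_over_pos [OF assms] by (simp add: t_def)
  have "sin t * sin (X + Y) = sin X * sin (Y + t) - sin (X - t) * sin Y" for X Y
    by (simp add: sin_add sin_diff cos_add algebra_simps)
  from this [of "real_of_int x * t" "real_of_int y * t"] show ?thesis
    using st by (simp add: s field_simps)
qed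

lemma qint_step:
  assumes "n \<ge> 2"
  shows "qint n (m + 1) + qint n (m - 1) = qint n 2 * qint n m"
  using qint_add [OF assms, of m 1] qint_1 [OF assms] by simp

lemma qint_square:
  assumes "n \<ge> 2"
  shows "qint n (m + 1) * qint n (m - 1) = (qint n m)\<^sup>2 - 1"
proof -
  define t where "t = pi / real_of_int n"
  have s: "qint n m = sin (real_of_int m * t) / sin t" for m
    by (simp add: qint_eq_sin t_def mult.commute)
  have st: "sin t \<noteq> 0"
    using sin_pi_over_pos [OF assms] by (simp add: t_def)
  have "sin (X + t) * sin (X - t) = (sin X)\<^sup>2 - (sin t)\<^sup>2" for X
    using sin_cos_squared_add [of X] sin_cos_squared_add [of t]
    unfolding sin_add sin_diff by algebra
  from this [of "real_of_int m * t"] show ?thesis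
    using st by (simp add: s field_simps power2_eq_square)
qed

text \<open>The weight of \<open>\<A>\<^sup>(\<^sup>n\<^sup>)\<close> as an eigenvector, in coordinates with \<open>x + y + z = n\<close>: the
  reflection \<open>[n - m] = [m]\<close> removes \<open>z\<close>, and addition formulas reduce both sides to the same
  polynomial in \<open>[2], [x - 1], [x], [y - 1], [y]\<close>.\<close>

lemma eigen_identity:
  assumes n: "n \<ge> 2" and xyz: "x + y + z = n"
  shows "qint n (x+1) * qint n y * qint n (z-1) + qint n (x-1) * qint n (y+1) * qint n z
           + qint n x * qint n (y-1) * qint n (z+1) = qint n 3 * qint n x * qint n y * qint n z"
proof -
  define t a a' b b' where "t = qint n 2" "a = qint n x" "a' = qint n (x-1)" "b = qint n y" "b' = qint n (y-1)"
  note d = this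
  have z: "qint n z = qint n (x + y)" "qint n (z-1) = qint n (x + (y + 1))" "qint n (z+1) = qint n (x + (y - 1))"
    using qint_reflect [of n "x+y"] qint_reflect [of n "x+y+1"] qint_reflect [of n "x+y-1"] n
    unfolding xyz [symmetric] by (simp_all add: algebra_simps)
  have x1: "qint n (x+1) = t * a - a'" and y1: "qint n (y+1) = t * b - b'"
    using qint_step [OF n, of x] qint_step [OF n, of y] by (simp_all add: d algebra_simps)
  have y2: "qint n (y+1+1) = t * (t * b - b') - b"
    using qint_step [OF n, of "y+1"] unfolding y1 by (simp add: d algebra_simps)
  note 1 = x1 y1 y2
  have 3: "qint n 3 = t*t - 1"
    using qint_step [OF n, of 2] qint_1 [OF n] by (simp add: d algebra_simps)
  have "(t * a - a') * b * (a * (t * (t * b - b') - b) - a' * (t * b - b')) + a' * (t * b - b') * (a * (t * b - b') - a' * b)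
      + a * b' * (a * b - a' * b') = (t*t-1) * a * b * (a * (t * b - b') - a' * b)"
    by (simp add: algebra_simps)
  then show ?thesis
    unfolding z qint_add [OF n, of x y] qint_add [OF n, of x "y+1"] qint_add [OF n, of x "y-1"] 3
      diff_add_cancel 1 d(2-) [symmetric] .
qed

text \<open>What the type II relation amounts to when all four arcs coincide, after the common factors
  are cancelled.\<close>

lemma diamond_identity:
  assumes n: "n \<ge> 2" and xyz: "x + y + z + 1 = n"
  shows "qint n (x+1) * qint n (y+1) * qint n (z+1) + qint n x * qint n y * qint n (z-1)
           = qint n z * (qint n x * qint n (y+1) + qint n (x+1) * qint n y)"
proof -
  define t a a' b b' where "t = qint n 2" "a = qint n x" "a' = qint n (x-1)" "b = qint n y" "b' = qint n (y-1)"
  note d = this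
  have z: "qint n z = qint n (x + (y + 1))" "qint n (z+1) = qint n (x + y)" "qint n (z-1) = qint n (x + (y + 1 + 1))"
    using qint_reflect [of n "x+y"] qint_reflect [of n "x+y+1"] qint_reflect [of n "x+y+2"] n
    unfolding xyz [symmetric] by (simp_all add: algebra_simps)
  have x1: "qint n (x+1) = t * a - a'" and y1: "qint n (y+1) = t * b - b'"
    using qint_step [OF n, of x] qint_step [OF n, of y] by (simp_all add: d algebra_simps)
  have y2: "qint n (y+1+1) = t * (t * b - b') - b"
    using qint_step [OF n, of "y+1"] unfolding y1 by (simp add: d algebra_simps)
  have y3: "qint n (y+1+1+1) = t * (t * (t * b - b') - b) - (t * b - b')"
    using qint_step [OF n, of "y+1+1"] unfolding add_diff_cancel_right' y2 y1 d(1) [symmetric] by (simp add: algebra_simps)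
  note 1 = x1 y1 y2 y3
  show ?thesis
    unfolding z qint_add [OF n, of x y] qint_add [OF n, of x "y+1"] qint_add [OF n, of x "y+1+1"]
      1 d(2-) [symmetric]
    by (simp add: algebra_simps)
qed

section \<open>Coordinates on the orbifold graph\<close>

text \<open>The vertex \<open>(a, b)\<close> is written as \<open>(a, b, c)\<close> with \<open>a + b + c = 3k\<close>. The rotation is then
  the cyclic shift, and \<open>orb a b c\<close> is the orbit.\<close>

definition orb :: "int \<Rightarrow> int \<Rightarrow> int \<Rightarrow> dvert" where
  "orb a b c = Orbit_vert {(a, b), (c, a), (b, c)}"

text \<open>The rotation permutes the three directions of arcs cyclically, so that every orbit of arcs
  contains exactly one arc \<open>(a, b) \<rightarrow> (a + 1, b)\<close>. Its orbit is \<open>edge a b c\<close>, where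
  \<open>a + b + c = 3k - 1\<close>: it goes from \<open>(a, b, c + 1)\<close> to \<open>(a + 1, b, c)\<close>. In these coordinates an
  arc has a unique name, and questions about incidence become linear arithmetic.\<close>

definition edge :: "int \<Rightarrow> int \<Rightarrow> int \<Rightarrow> darc" where
  "edge a b c = Orbit_arc {((a, b), (a + 1, b)), ((c + 1, a), (c, a + 1)), ((b, c + 1), (b, c))}"

text \<open>The last two conditions say that neither end point is the centre.\<close>

definition edge_ok :: "int \<Rightarrow> int \<Rightarrow> int \<Rightarrow> int \<Rightarrow> bool" where
  "edge_ok k a b c \<longleftrightarrow> a \<ge> 0 \<and> b \<ge> 0 \<and> c \<ge> 0 \<and> a + b + c = 3 * k - 1
     \<and> \<not> (a = k \<and> b = k) \<and> \<not> (a = k - 1 \<and> b = k)"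

lemma orb_rotate: "orb b c a = orb a b c"
  unfolding orb_def by auto

lemma orb_eq_iff:
  assumes "a + b + c = a' + b' + c'"
  shows "orb a b c = orb a' b' c' \<longleftrightarrow>
    (a' = a \<and> b' = b \<and> c' = c) \<or> (a' = b \<and> b' = c \<and> c' = a) \<or> (a' = c \<and> b' = a \<and> c' = b)"
    (is "_ \<longleftrightarrow> ?R")
proof
  assume "orb a b c = orb a' b' c'"
  then have "(a', b') \<in> {(a, b), (c, a), (b, c)}"
    by (simp add: orb_def)
  then show ?R
    using assms by auto
qed (auto simp: orb_def)

lemma orb_neq_Split [simp]: "orb a b c \<noteq> Split i" "Split i \<noteq> orb a b c"
  by (simp_all add: orb_def)

text \<open>The representative \<open>(a, b) \<rightarrow> (a + 1, b)\<close> is the only member of the orbit of its direction.\<close>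

lemma edge_eq_iff [simp]: "edge a b c = edge a' b' c' \<longleftrightarrow> a = a' \<and> b = b' \<and> c = c'"
proof
  assume "edge a b c = edge a' b' c'"
  then have *: "{((a, b), (a + 1, b)), ((c + 1, a), (c, a + 1)), ((b, c + 1), (b, c))}
    = {((a', b'), (a' + 1, b')), ((c' + 1, a'), (c', a' + 1)), ((b', c' + 1), (b', c'))}"
    by (simp only: edge_def darc.inject)
  have "((a, b), (a + 1, b)) \<in> {((a', b'), (a' + 1, b')), ((c' + 1, a'), (c', a' + 1)), ((b', c' + 1), (b', c'))}"
    unfolding * [symmetric] by simp
  moreover have "((c + 1, a), (c, a + 1)) \<in> {((a', b'), (a' + 1, b')), ((c' + 1, a'), (c', a' + 1)), ((b', c' + 1), (b', c'))}"
    unfolding * [symmetric] by simp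
  ultimately show "a = a' \<and> b = b' \<and> c = c'"
    unfolding insert_iff empty_iff prod.inject by presburger
qed simp

lemma edge_neq [simp]:
  "edge a b c \<noteq> Into i" "Into i \<noteq> edge a b c" "edge a b c \<noteq> Outof i" "Outof i \<noteq> edge a b c"
  by (simp_all add: edge_def)

lemma D_tail_edge [simp]: "D_tail k (edge a b c) = orb a b (c + 1)"
  by (simp add: edge_def orb_def)

lemma D_head_edge [simp]: "D_head k (edge a b c) = orb (a + 1) b c"
  by (auto simp: edge_def orb_def)

lemma vert_orbit_eq_orb: "a + b + c = 3 * k \<Longrightarrow> Orbit_vert (vert_orbit k (a, b)) = orb a b c"
proof -
  assume "a + b + c = 3 * k"
  then have c: "c = 3 * k - a - b" by simp
  show ?thesis
    unfolding c by (auto simp: vert_orbit_def orb_def rot_def)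
qed

lemma D_arc_east: "a + b + c = 3 * k \<Longrightarrow> D_arc k (a, b) (a + 1, b) = edge a b (c - 1)"
proof -
  assume "a + b + c = 3 * k"
  then have c: "c = 3 * k - a - b" by simp
  show ?thesis
    unfolding c D_arc_def arc_orbit_def rot_def edge_def by (simp add: algebra_simps)
qed

lemma D_arc_northwest: "a + b + c = 3 * k \<Longrightarrow> D_arc k (a, b) (a - 1, b + 1) = edge b c (a - 1)"
proof -
  assume "a + b + c = 3 * k"
  then have c: "c = 3 * k - a - b" by simp
  show ?thesis
    unfolding c D_arc_def arc_orbit_def rot_def edge_def by (auto simp: algebra_simps)
qed

lemma D_arc_south: "a + b + c = 3 * k \<Longrightarrow> D_arc k (a, b) (a, b - 1) = edge c a (b - 1)"
proof -
  assume "a + b + c = 3 * k"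
  then have c: "c = 3 * k - a - b" by simp
  show ?thesis
    unfolding c D_arc_def arc_orbit_def rot_def edge_def by (auto simp: algebra_simps)
qed

lemma D_tail_Into [simp]: "D_tail k (Into i) = orb (k - 1) k (k + 1)"
  by (simp add: vert_orbit_eq_orb)

lemma D_head_Outof [simp]: "D_head k (Outof i) = orb k (k - 1) (k + 1)"
  by (simp add: vert_orbit_eq_orb)

declare D_tail.simps(2) [simp del] D_head.simps(3) [simp del]

lemma tail_D [simp]: "tail (D_graph k) = D_tail k" and head_D [simp]: "head (D_graph k) = D_head k"
  by (simp_all add: D_graph_def)

lemma verts_D:
  "verts (D_graph k) =
     {orb a b c | a b c. a \<ge> 0 \<and> b \<ge> 0 \<and> c \<ge> 0 \<and> a + b + c = 3 * k \<and> (a, b) \<noteq> (k, k)}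
     \<union> Split ` {1, 2, 3}" (is "_ = ?O \<union> _")
proof -
  have "{Orbit_vert (vert_orbit k v) | v. v \<in> verts (A_graph (3 * k + 3)) \<and> v \<noteq> (k, k)} = ?O"
    (is "?L = _")
  proof (intro equalityI subsetI)
    fix x assume "x \<in> ?L"
    then obtain a b where "x = Orbit_vert (vert_orbit k (a, b))" "a \<ge> 0" "b \<ge> 0" "a + b \<le> 3 * k"
      "(a, b) \<noteq> (k, k)"
      by (auto simp: A_graph_def A_verts_def)
    then show "x \<in> ?O"
      using vert_orbit_eq_orb [of a b "3 * k - a - b" k] by force
  next
    fix x assume "x \<in> ?O"
    then obtain a b c where "x = orb a b c" "a \<ge> 0" "b \<ge> 0" "c \<ge> 0" "a + b + c = 3 * k"
      "(a, b) \<noteq> (k, k)"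
      by auto
    then show "x \<in> ?L"
      using vert_orbit_eq_orb [of a b c k] by (force simp: A_graph_def A_verts_def)
  qed
  then show ?thesis
    by (simp add: D_graph_def)
qed

lemma arcs_D:
  "arcs (D_graph k) =
     {edge a b c | a b c. edge_ok k a b c} \<union> Into ` {1, 2, 3} \<union> Outof ` {1, 2, 3}"
proof -
  have "{Orbit_arc (arc_orbit k e) | e. e \<in> arcs (A_graph (3 * k + 3)) \<and>
                fst e \<noteq> (k, k) \<and> snd e \<noteq> (k, k)} = {edge a b c | a b c. edge_ok k a b c}"
    (is "?L = ?R")
  proof (intro equalityI subsetI)
    fix x assume "x \<in> ?L"
    then obtain a b v where x: "x = D_arc k (a, b) v" and v: "(a, b) \<in> A_verts (3 * k + 3)"
      "v \<in> A_verts (3 * k + 3)" "v \<in> {(a + 1, b), (a - 1, b + 1), (a, b - 1)}"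
      "(a, b) \<noteq> (k, k)" "v \<noteq> (k, k)"
      unfolding D_arc_def A_graph_def by auto
    define c where "c = 3 * k - a - b"
    then have abc: "a + b + c = 3 * k" by simp
    from v(3) consider "v = (a + 1, b)" | "v = (a - 1, b + 1)" | "v = (a, b - 1)"
      by blast
    then show "x \<in> ?R"
    proof cases
      case 1
      then have "edge_ok k a b (c - 1)"
        using v abc by (auto simp: edge_ok_def A_verts_def)
      then show ?thesis
        using x D_arc_east [OF abc] 1 by auto
    next
      case 2
      then have "edge_ok k b c (a - 1)"
        using v abc by (auto simp: edge_ok_def A_verts_def)
      then show ?thesis
        using x D_arc_northwest [OF abc] 2 by auto
    next
      case 3
      then have "edge_ok k c a (b - 1)"
        using v abc by (auto simp: edge_ok_def A_verts_def)
      then show ?thesis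
        using x D_arc_south [OF abc] 3 by auto
    qed
  next
    fix x assume "x \<in> ?R"
    then obtain a b c where x: "x = edge a b c" and ok: "edge_ok k a b c"
      by auto
    have "x = Orbit_arc (arc_orbit k ((a, b), (a + 1, b)))"
      using D_arc_east [of a b "c + 1" k] ok x by (simp add: D_arc_def edge_ok_def)
    moreover have "((a, b), (a + 1, b)) \<in> arcs (A_graph (3 * k + 3))"
      using ok by (auto simp: A_graph_def A_verts_def edge_ok_def)
    moreover have "(a, b) \<noteq> (k, k)" "(a + 1, b) \<noteq> (k, k)"
      using ok by (auto simp: edge_ok_def)
    ultimately show "x \<in> ?L"
      by force
  qed
  then show ?thesis
    by (simp add: D_graph_def)
qed

lemma edge_in_arcs [simp]: "edge a b c \<in> arcs (D_graph k) \<longleftrightarrow> edge_ok k a b c"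
  by (auto simp: arcs_D)

lemma Into_in_arcs [simp]: "Into i \<in> arcs (D_graph k) \<longleftrightarrow> i \<in> {1, 2, 3}"
  and Outof_in_arcs [simp]: "Outof i \<in> arcs (D_graph k) \<longleftrightarrow> i \<in> {1, 2, 3}"
  by (auto simp: arcs_D)

lemma arcs_D_cases:
  assumes "\<alpha> \<in> arcs (D_graph k)"
  obtains (edge) a b c where "\<alpha> = edge a b c" "edge_ok k a b c"
    | (Into) i where "\<alpha> = Into i" "i \<in> {1, 2, 3}"
    | (Outof) i where "\<alpha> = Outof i" "i \<in> {1, 2, 3}"
  using assms unfolding arcs_D by blast

lemma gamma_arc_edge: "gamma_arc k = edge (k - 1) (k + 1) (k - 1)"
  unfolding gamma_arc_def using D_arc_northwest [of k "k - 1" "k + 1" k] by simp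

lemma gamma'_arc_edge: "gamma'_arc k = edge k (k - 1) k"
  unfolding gamma'_arc_def using D_arc_east [of k "k - 1" "k + 1" k] by simp

lemma finite_verts_D: "finite (verts (D_graph k))"
proof -
  have "{orb a b c | a b c. a \<ge> 0 \<and> b \<ge> 0 \<and> c \<ge> 0 \<and> a + b + c = 3 * k \<and> (a, b) \<noteq> (k, k)}
    \<subseteq> (\<lambda>(a, b). orb a b (3 * k - a - b)) ` ({0..3 * k} \<times> {0..3 * k})"
  proof
    fix x assume "x \<in> {orb a b c | a b c. a \<ge> 0 \<and> b \<ge> 0 \<and> c \<ge> 0 \<and> a + b + c = 3 * k \<and> (a, b) \<noteq> (k, k)}"
    then obtain a b c where x: "x = orb a b c" "a \<ge> 0" "b \<ge> 0" "c \<ge> 0" "a + b + c = 3 * k"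
      by auto
    then have "c = 3 * k - a - b"
      by simp
    with x show "x \<in> (\<lambda>(a, b). orb a b (3 * k - a - b)) ` ({0..3 * k} \<times> {0..3 * k})"
      by (intro image_eqI [of _ _ "(a, b)"]) auto
  qed
  from finite_subset [OF this] show ?thesis
    unfolding verts_D by simp
qed

lemma finite_arcs_D: "finite (arcs (D_graph k))"
proof -
  have "{edge a b c | a b c. edge_ok k a b c}
    \<subseteq> (\<lambda>(a, b). edge a b (3 * k - 1 - a - b)) ` ({0..3 * k} \<times> {0..3 * k})"
  proof
    fix x assume "x \<in> {edge a b c | a b c. edge_ok k a b c}"
    then obtain a b c where "x = edge a b c" "edge_ok k a b c"
      by auto
    then show "x \<in> (\<lambda>(a, b). edge a b (3 * k - 1 - a - b)) ` ({0..3 * k} \<times> {0..3 * k})"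
      by (intro image_eqI [of _ _ "(a, b)"]) (auto simp: edge_ok_def)
  qed
  from finite_subset [OF this] show ?thesis
    unfolding arcs_D by simp
qed

lemma orb_in_verts:
  assumes "a \<ge> 0" "b \<ge> 0" "c \<ge> 0" "a + b + c = 3 * k" "\<not> (a = k \<and> b = k)"
  shows "orb a b c \<in> verts (D_graph k)"
  using assms unfolding verts_D by blast

lemma fin_digraph_D:
  assumes "k \<ge> 1"
  shows "fin_digraph (D_graph k)"
proof
  fix e assume "e \<in> arcs (D_graph k)"
  then show "tail (D_graph k) e \<in> verts (D_graph k)"
    by (cases rule: arcs_D_cases) (use assms in \<open>auto intro!: orb_in_verts simp: edge_ok_def\<close>, auto simp: verts_D)
  from \<open>e \<in> arcs (D_graph k)\<close> show "head (D_graph k) e \<in> verts (D_graph k)"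
    by (cases rule: arcs_D_cases) (use assms in \<open>auto intro!: orb_in_verts simp: edge_ok_def\<close>, auto simp: verts_D)
qed (rule finite_verts_D finite_arcs_D)+

subsection \<open>Weights\<close>

text \<open>Since \<open>[a + b + 2] = [c + 1]\<close>, the weight is a product over the three coordinates.\<close>

definition orb_weight :: "int \<Rightarrow> int \<Rightarrow> int \<Rightarrow> int \<Rightarrow> real" where
  "orb_weight k a b c
     = qint (3 * k + 3) (a + 1) * qint (3 * k + 3) (b + 1) * qint (3 * k + 3) (c + 1) / qint (3 * k + 3) 2"

lemma A_weight_eq:
  assumes "k \<ge> 0" "a + b + c = 3 * k"
  shows "A_weight (3 * k + 3) (a, b) = orb_weight k a b c"
proof -
  have "qint (3 * k + 3) ((3 * k + 3) - (c + 1)) = qint (3 * k + 3) (c + 1)"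
    using assms(1) by (intro qint_reflect) simp
  moreover have "(3 * k + 3) - (c + 1) = a + b + 2"
    using assms by simp
  ultimately have "qint (3 * k + 3) (a + b + 2) = qint (3 * k + 3) (c + 1)"
    by simp
  then show ?thesis
    by (simp add: A_weight_def orb_weight_def)
qed

lemma D_weight_orb:
  assumes "k \<ge> 0" "a + b + c = 3 * k"
  shows "D_weight k (orb a b c) = orb_weight k a b c"
proof -
  have "A_weight (3 * k + 3) (a, b) = orb_weight k a b c"
       "A_weight (3 * k + 3) (c, a) = orb_weight k a b c"
       "A_weight (3 * k + 3) (b, c) = orb_weight k a b c"
    using A_weight_eq [of k a b c] A_weight_eq [of k c a b] A_weight_eq [of k b c a] assms
    by (simp_all add: orb_weight_def mult_ac)
  then show ?thesis
    by (simp add: orb_def)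
qed

lemma D_weight_Split:
  assumes "k \<ge> 0"
  shows "D_weight k (Split i) = orb_weight k k k k / 3"
  using A_weight_eq [of k k k k] assms by simp

declare D_weight.simps [simp del]

lemma orb_weight_pos:
  assumes "a \<ge> 0" "b \<ge> 0" "c \<ge> 0" "a + b + c = 3 * k"
  shows "orb_weight k a b c > 0"
  using assms unfolding orb_weight_def
  by (auto intro!: divide_pos_pos mult_pos_pos qint_pos)

lemma orb_weight_rotate: "orb_weight k b c a = orb_weight k a b c"
  by (simp add: orb_weight_def mult_ac)

text \<open>Both kinds of cells of \<open>\<A>\<^sup>(\<^sup>3\<^sup>k\<^sup>+\<^sup>3\<^sup>)\<close> have this form: \<open>\<triangle>(a, b)\<close> with
  \<open>a + b + c = 3k - 1\<close> and \<open>\<nabla>(a, b)\<close> with \<open>a + b + c = 3k - 2\<close>. In the first case the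
  corners are \<open>(a, b, c)\<close> plus a unit vector, in the second \<open>(a + 1, b + 1, c + 1)\<close> minus one.\<close>

definition tri_cell :: "int \<Rightarrow> int \<Rightarrow> int \<Rightarrow> int \<Rightarrow> real" where
  "tri_cell k a b c =
     sqrt (qint (3 * k + 3) (a + 1) * qint (3 * k + 3) (a + 2)
         * qint (3 * k + 3) (b + 1) * qint (3 * k + 3) (b + 2)
         * qint (3 * k + 3) (c + 1) * qint (3 * k + 3) (c + 2)) / qint (3 * k + 3) 2"

lemma tri_cell_rotate: "tri_cell k b c a = tri_cell k a b c"
  by (simp add: tri_cell_def mult_ac)

context
  fixes k :: int
  assumes k: "k \<ge> 1"
begin

abbreviation (input) q :: "int \<Rightarrow> real" where
  "q \<equiv> qint (3 * k + 3)"

lemma q_pos: "0 < m \<Longrightarrow> m < 3 * k + 3 \<Longrightarrow> q m > 0"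
  by (rule qint_pos)

lemma q_nonneg: "0 \<le> m \<Longrightarrow> m < 3 * k + 3 \<Longrightarrow> q m \<ge> 0"
  using qint_pos [of m "3 * k + 3"] by (cases "m = 0") auto

lemma q2_pos: "q 2 > 0"
  using k by (intro q_pos) auto

lemma q_step: "q (m + 1) + q (m - 1) = q 2 * q m"
  using k by (intro qint_step) simp

lemma tri_cell_pos:
  assumes "a \<ge> 0" "b \<ge> 0" "c \<ge> 0" "a \<le> 3 * k" "b \<le> 3 * k" "c \<le> 3 * k"
  shows "tri_cell k a b c > 0"
  unfolding tri_cell_def using q2_pos assms by (intro divide_pos_pos real_sqrt_gt_zero mult_pos_pos q_pos) auto

lemma tri_cell_square:
  assumes "a \<ge> -1" "b \<ge> -1" "c \<ge> -1" "a \<le> 3 * k" "b \<le> 3 * k" "c \<le> 3 * k"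
  shows "(tri_cell k a b c)\<^sup>2
    = q (a + 1) * q (a + 2) * q (b + 1) * q (b + 2) * q (c + 1) * q (c + 2) / (q 2)\<^sup>2"
proof -
  have "q (a + 1) * q (a + 2) * q (b + 1) * q (b + 2) * q (c + 1) * q (c + 2) \<ge> 0"
    using assms by (intro mult_nonneg_nonneg q_nonneg) auto
  then show ?thesis
    by (simp add: tri_cell_def power_divide)
qed

text \<open>Type I for the arc \<open>(a, b, c)\<close>: it lies in one upward and one downward triangle, whose
  squared cells differ only in the factor \<open>[b + 2]\<close> against \<open>[b]\<close>, and \<open>[b + 2] + [b] = [2][b + 1]\<close>.
  For \<open>b = 0\<close> the downward triangle does not exist and its term vanishes.\<close>

lemma cell_sum_identity:
  assumes "a \<ge> 0" "b \<ge> 0" "c \<ge> 0" "a + b + c = 3 * k - 1"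
  shows "(tri_cell k a b c)\<^sup>2 + (tri_cell k a (b - 1) c)\<^sup>2
    = q 2 * orb_weight k a b (c + 1) * orb_weight k (a + 1) b c"
proof -
  define A A' B C C' where "A = q (a + 1)" "A' = q (a + 2)" "B = q (b + 1)" "C = q (c + 1)" "C' = q (c + 2)"
  note d = this
  have T: "(tri_cell k a b c)\<^sup>2 = A * A' * B * q (b + 2) * C * C' / (q 2)\<^sup>2"
       "(tri_cell k a (b - 1) c)\<^sup>2 = A * A' * q b * B * C * C' / (q 2)\<^sup>2"
    using tri_cell_square [of a b c] tri_cell_square [of a "b - 1" c] assms by (simp_all add: d add.commute)
  have "q (b + 2) + q b = q 2 * B"
    using q_step [of "b + 1"] by (simp add: d add.commute)
  then have "A * A' * B * q (b + 2) * C * C' + A * A' * q b * B * C * C' = q 2 * (A * B * C') * (A' * B * C)"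
    by algebra
  then show ?thesis
    unfolding T orb_weight_def using q2_pos
    by (simp add: d field_simps power2_eq_square)
qed

text \<open>Type II for four equal arcs; this is \<open>diamond_identity\<close> multiplied by the factors common to
  both sides.\<close>

lemma cell_fourth_identity:
  assumes "a \<ge> 0" "b \<ge> 0" "c \<ge> 0" "a + b + c = 3 * k - 1"
  shows "inverse (orb_weight k a (b + 1) c) * (tri_cell k a b c) ^ 4
      + inverse (orb_weight k (a + 1) (b - 1) (c + 1)) * (tri_cell k a (b - 1) c) ^ 4
    = orb_weight k a b (c + 1) * orb_weight k (a + 1) b c * (orb_weight k a b (c + 1) + orb_weight k (a + 1) b c)"
proof -
  define A A' B C C' B' B0 t where "A = q (a + 1)" "A' = q (a + 2)" "B = q (b + 1)" "C = q (c + 1)" "C' = q (c + 2)"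
    "B' = q (b + 2)" "B0 = q b" "t = q 2"
  note d = this
  have pos: "A > 0" "A' > 0" "B > 0" "C > 0" "C' > 0" "B' > 0" "t > 0"
    unfolding d using assms k by (auto intro!: q_pos)
  have T: "(tri_cell k a b c)\<^sup>2 = A * A' * B * B' * C * C' / t\<^sup>2"
       "(tri_cell k a (b - 1) c)\<^sup>2 = A * A' * B0 * B * C * C' / t\<^sup>2"
    using tri_cell_square [of a b c] tri_cell_square [of a "b - 1" c] assms by (simp_all add: d add.commute)
  have e: "A' * C' * B' + A * C * B0 = B * (A * C' + A' * C)"
    using diamond_identity [of "3 * k + 3" "a + 1" "c + 1" "b + 1"] assms k by (simp add: d algebra_simps)
  have w: "orb_weight k a (b + 1) c = A * B' * C / t" "orb_weight k (a + 1) (b - 1) (c + 1) = A' * B0 * C' / t"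
       "orb_weight k a b (c + 1) = A * B * C' / t" "orb_weight k (a + 1) b c = A' * B * C / t"
    by (simp_all add: orb_weight_def d add.assoc)
  have 1: "inverse (orb_weight k a (b + 1) c) * (tri_cell k a b c) ^ 4 = A * C * A'\<^sup>2 * C'\<^sup>2 * B\<^sup>2 * B' / t ^ 3"
  proof -
    have "(tri_cell k a b c) ^ 4 = (A * A' * B * B' * C * C' / t\<^sup>2)\<^sup>2"
      unfolding T [symmetric] by simp
    then show ?thesis
      unfolding w using pos by (simp add: field_simps power2_eq_square power3_eq_cube)
  qed
  have 2: "inverse (orb_weight k (a + 1) (b - 1) (c + 1)) * (tri_cell k a (b - 1) c) ^ 4
      = A\<^sup>2 * C\<^sup>2 * A' * C' * B\<^sup>2 * B0 / t ^ 3"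
  proof -
    have "(tri_cell k a (b - 1) c) ^ 4 = (A * A' * B0 * B * C * C' / t\<^sup>2)\<^sup>2"
      unfolding T [symmetric] by simp
    then show ?thesis
      unfolding w using pos by (cases "B0 = 0") (simp_all add: field_simps power2_eq_square power3_eq_cube)
  qed
  have "A * C * A'\<^sup>2 * C'\<^sup>2 * B\<^sup>2 * B' + A\<^sup>2 * C\<^sup>2 * A' * C' * B\<^sup>2 * B0
     = A * A' * B\<^sup>2 * C * C' * (A * B * C' + A' * B * C)"
    using e by algebra
  then show ?thesis
    unfolding 1 2 unfolding w using pos
    by (simp add: field_simps power2_eq_square power3_eq_cube)
qed

text \<open>Type II for two different arcs with a common end: only the upward triangle \<open>(a, b, c)\<close> and
  the downward triangle \<open>(a - 1, b, c)\<close> contribute, and the product of their squared cells is the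
  product of the weights of the four corners of the rhombus that they form.\<close>

lemma cell_pair_identity:
  assumes "a \<ge> 1" "b \<ge> 0" "c \<ge> 0" "a + b + c = 3 * k - 1"
  shows "(tri_cell k a b c)\<^sup>2 * (tri_cell k (a - 1) b c)\<^sup>2
    = orb_weight k c a (b + 1) * orb_weight k (c + 1) a b * orb_weight k (a + 1) b c
      * orb_weight k (b + 1) (c + 1) (a - 1)"
proof -
  have T: "(tri_cell k a b c)\<^sup>2 = q (a + 1) * q (a + 2) * q (b + 1) * q (b + 2) * q (c + 1) * q (c + 2) / (q 2)\<^sup>2"
       "(tri_cell k (a - 1) b c)\<^sup>2 = q a * q (a + 1) * q (b + 1) * q (b + 2) * q (c + 1) * q (c + 2) / (q 2)\<^sup>2"
    using tri_cell_square [of a b c] tri_cell_square [of "a - 1" b c] assms by (simp_all add: add.commute)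
  show ?thesis
    unfolding T orb_weight_def by (simp add: add.assoc power2_eq_square mult_ac)
qed

lemma weight_eigen:
  assumes "a + b + c = 3 * k"
  shows "orb_weight k (a + 1) b (c - 1) + orb_weight k (b + 1) c (a - 1) + orb_weight k (c + 1) a (b - 1)
    = q 3 * orb_weight k a b c"
  using eigen_identity [of "3 * k + 3" "a + 1" "b + 1" "c + 1"] k assms q2_pos
  unfolding orb_weight_def by (simp add: add.assoc field_simps)

text \<open>The first two equations hold for every argument. The third one is special to the fixed vertex:
  the eigenvector equation there reads \<open>3[k][k + 2] = [3][k + 1]\<^sup>2\<close>, and with \<open>[3] = [2]\<^sup>2 - 1\<close> the first two
  eliminate \<open>[2]\<close>.\<close>

lemma centre_identities:
  shows "q k * q (k + 2) = (q (k + 1))\<^sup>2 - 1"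
    and "q k + q (k + 2) = q 2 * q (k + 1)"
    and "(q k)\<^sup>2 + (q (k + 2))\<^sup>2 - q k * q (k + 2) = (q (k + 1))\<^sup>2"
proof -
  show 1: "q k * q (k + 2) = (q (k + 1))\<^sup>2 - 1"
    using qint_square [of "3 * k + 3" "k + 1"] k by (simp add: mult.commute add.commute)
  show 2: "q k + q (k + 2) = q 2 * q (k + 1)"
    using q_step [of "k + 1"] by (simp add: add.commute)
  have 3: "q 3 = (q 2)\<^sup>2 - 1"
    using q_step [of 2] qint_1 [of "3 * k + 3"] k by (simp add: power2_eq_square)
  have "q (k + 1) > 0"
    using k by (intro q_pos) auto
  moreover have "3 * (q (k + 2) * q (k + 1) * q k) = q 3 * q (k + 1) * q (k + 1) * q (k + 1)"
    using eigen_identity [of "3 * k + 3" "k + 1" "k + 1" "k + 1"] k by (simp add: add.commute mult_ac)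
  ultimately have 4: "3 * (q k * q (k + 2)) = q 3 * (q (k + 1))\<^sup>2"
    by (simp add: power2_eq_square mult.commute)
  show "(q k)\<^sup>2 + (q (k + 2))\<^sup>2 - q k * q (k + 2) = (q (k + 1))\<^sup>2"
    using 1 2 4 unfolding 3 by algebra
qed

end

section \<open>Sums over closed paths\<close>

text \<open>A closed path determines its vertices, so a sum over vertices and arcs is a sum over pairs
  of arcs, which may be restricted to any set that carries the nonzero terms.\<close>

lemma sum_closed_pairs:
  fixes F :: "'v \<Rightarrow> 'e \<Rightarrow> 'e \<Rightarrow> 'a :: comm_monoid_add"
  assumes G: "fin_digraph G"
    and S: "\<And>\<beta> \<gamma>. (\<beta>, \<gamma>) \<in> S \<Longrightarrow> \<beta> \<in> arcs G \<and> \<gamma> \<in> arcs G \<and> tail G \<beta> = j \<and> head G \<beta> = tail G \<gamma> \<and> head G \<gamma> = i"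
    and zero: "\<And>\<beta> \<gamma>. \<beta> \<in> arcs G \<Longrightarrow> \<gamma> \<in> arcs G \<Longrightarrow> tail G \<beta> = j \<Longrightarrow> head G \<beta> = tail G \<gamma> \<Longrightarrow> head G \<gamma> = i
      \<Longrightarrow> (\<beta>, \<gamma>) \<notin> S \<Longrightarrow> F (head G \<beta>) \<beta> \<gamma> = 0"
  shows "(\<Sum>k \<in> verts G. \<Sum>\<beta> \<in> arcs_between G j k. \<Sum>\<gamma> \<in> arcs_between G k i. F k \<beta> \<gamma>)
    = (\<Sum>(\<beta>, \<gamma>) \<in> S. F (head G \<beta>) \<beta> \<gamma>)"
proof -
  interpret fin_digraph G by (rule G)
  have fin: "finite (arcs_between G x y)" for x y
    by (simp add: arcs_between_def)
  define P where "P = {(\<beta>, \<gamma>). \<beta> \<in> arcs G \<and> \<gamma> \<in> arcs G \<and> tail G \<beta> = j \<and> head G \<beta> = tail G \<gamma> \<and> head G \<gamma> = i}"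
  have "finite P"
    by (rule finite_subset [of _ "arcs G \<times> arcs G"]) (auto simp: P_def)
  have "(\<Sum>k \<in> verts G. \<Sum>\<beta> \<in> arcs_between G j k. \<Sum>\<gamma> \<in> arcs_between G k i. F k \<beta> \<gamma>)
    = (\<Sum>(k, \<beta>, \<gamma>) \<in> (SIGMA k : verts G. arcs_between G j k \<times> arcs_between G k i). F k \<beta> \<gamma>)"
    by (simp add: sum.cartesian_product sum.Sigma fin)
  also have "\<dots> = (\<Sum>(\<beta>, \<gamma>) \<in> P. F (head G \<beta>) \<beta> \<gamma>)"
    by (rule sum.reindex_bij_witness [where i = "\<lambda>(\<beta>, \<gamma>). (head G \<beta>, \<beta>, \<gamma>)" and j = snd])
       (auto simp: P_def arcs_between_def)
  also have "\<dots> = (\<Sum>(\<beta>, \<gamma>) \<in> S. F (head G \<beta>) \<beta> \<gamma>)"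
    using S zero \<open>finite P\<close> by (intro sum.mono_neutral_right) (auto simp: P_def)
  finally show ?thesis .
qed

lemma sum_closed_quadruples:
  fixes F :: "'v \<Rightarrow> 'e \<Rightarrow> 'e \<Rightarrow> 'e \<Rightarrow> 'e \<Rightarrow> 'a :: comm_monoid_add"
  assumes G: "fin_digraph G"
    and S: "\<And>\<beta>1 \<beta>2 \<beta>3 \<beta>4. (\<beta>1, \<beta>2, \<beta>3, \<beta>4) \<in> S \<Longrightarrow>
      {\<beta>1, \<beta>2, \<beta>3, \<beta>4} \<subseteq> arcs G \<and> tail G \<beta>1 = i2 \<and> tail G \<beta>2 = head G \<beta>1 \<and> head G \<beta>2 = i1
      \<and> tail G \<beta>3 = head G \<beta>1 \<and> head G \<beta>3 = i3 \<and> tail G \<beta>4 = i4 \<and> head G \<beta>4 = head G \<beta>1"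
    and zero: "\<And>\<beta>1 \<beta>2 \<beta>3 \<beta>4. {\<beta>1, \<beta>2, \<beta>3, \<beta>4} \<subseteq> arcs G \<Longrightarrow> tail G \<beta>1 = i2 \<Longrightarrow> tail G \<beta>2 = head G \<beta>1
      \<Longrightarrow> head G \<beta>2 = i1 \<Longrightarrow> tail G \<beta>3 = head G \<beta>1 \<Longrightarrow> head G \<beta>3 = i3 \<Longrightarrow> tail G \<beta>4 = i4
      \<Longrightarrow> head G \<beta>4 = head G \<beta>1 \<Longrightarrow> (\<beta>1, \<beta>2, \<beta>3, \<beta>4) \<notin> S \<Longrightarrow> F (head G \<beta>1) \<beta>1 \<beta>2 \<beta>3 \<beta>4 = 0"
  shows "(\<Sum>k \<in> verts G. \<Sum>\<beta>1 \<in> arcs_between G i2 k. \<Sum>\<beta>2 \<in> arcs_between G k i1.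
         \<Sum>\<beta>3 \<in> arcs_between G k i3. \<Sum>\<beta>4 \<in> arcs_between G i4 k. F k \<beta>1 \<beta>2 \<beta>3 \<beta>4)
    = (\<Sum>(\<beta>1, \<beta>2, \<beta>3, \<beta>4) \<in> S. F (head G \<beta>1) \<beta>1 \<beta>2 \<beta>3 \<beta>4)"
proof -
  interpret fin_digraph G by (rule G)
  have fin: "finite (arcs_between G x y)" for x y
    by (simp add: arcs_between_def)
  define P where "P = {(\<beta>1, \<beta>2, \<beta>3, \<beta>4). {\<beta>1, \<beta>2, \<beta>3, \<beta>4} \<subseteq> arcs G \<and> tail G \<beta>1 = i2
    \<and> tail G \<beta>2 = head G \<beta>1 \<and> head G \<beta>2 = i1
    \<and> tail G \<beta>3 = head G \<beta>1 \<and> head G \<beta>3 = i3 \<and> tail G \<beta>4 = i4 \<and> head G \<beta>4 = head G \<beta>1}"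
  have "finite P"
    by (rule finite_subset [of _ "arcs G \<times> arcs G \<times> arcs G \<times> arcs G"]) (auto simp: P_def)
  have "(\<Sum>k \<in> verts G. \<Sum>\<beta>1 \<in> arcs_between G i2 k. \<Sum>\<beta>2 \<in> arcs_between G k i1.
         \<Sum>\<beta>3 \<in> arcs_between G k i3. \<Sum>\<beta>4 \<in> arcs_between G i4 k. F k \<beta>1 \<beta>2 \<beta>3 \<beta>4)
    = (\<Sum>(k, \<beta>1, \<beta>2, \<beta>3, \<beta>4) \<in> (SIGMA k : verts G. arcs_between G i2 k \<times> arcs_between G k i1
         \<times> arcs_between G k i3 \<times> arcs_between G i4 k). F k \<beta>1 \<beta>2 \<beta>3 \<beta>4)"
    by (simp add: sum.cartesian_product sum.Sigma fin split_def)
  also have "\<dots> = (\<Sum>(\<beta>1, \<beta>2, \<beta>3, \<beta>4) \<in> P. F (head G \<beta>1) \<beta>1 \<beta>2 \<beta>3 \<beta>4)"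
    by (rule sum.reindex_bij_witness [where i = "\<lambda>(\<beta>1, \<beta>2, \<beta>3, \<beta>4). (head G \<beta>1, \<beta>1, \<beta>2, \<beta>3, \<beta>4)" and j = snd])
       (auto simp: P_def arcs_between_def)
  also have "\<dots> = (\<Sum>(\<beta>1, \<beta>2, \<beta>3, \<beta>4) \<in> S. F (head G \<beta>1) \<beta>1 \<beta>2 \<beta>3 \<beta>4)"
    using S zero \<open>finite P\<close> by (intro sum.mono_neutral_right) (auto simp: P_def)
  finally show ?thesis .
qed

section \<open>Perron-Frobenius weights of the orbifold graph\<close>

text \<open>A vertex \<open>(a, b, c)\<close> has the three names \<open>(a, b, c), (b, c, a), (c, a, b)\<close>; each name gives
  one outgoing arc.\<close>

lemma orb_eq_target:
  assumes "a + b + c = 3 * k" "a' + b' + c' = 3 * k - 1"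
  shows "orb a' b' (c' + 1) = orb a b c \<longleftrightarrow>
    edge a' b' c' \<in> {edge a b (c - 1), edge b c (a - 1), edge c a (b - 1)}"
proof -
  have "orb a' b' (c' + 1) = orb a b c \<longleftrightarrow>
    (a = a' \<and> b = b' \<and> c = c' + 1) \<or> (a = b' \<and> b = c' + 1 \<and> c = a') \<or> (a = c' + 1 \<and> b = a' \<and> c = b')"
    using assms by (intro orb_eq_iff) simp
  also have "\<dots> \<longleftrightarrow> (a' = a \<and> b' = b \<and> c' = c - 1) \<or> (a' = b \<and> b' = c \<and> c' = a - 1) \<or> (a' = c \<and> b' = a \<and> c' = b - 1)"
    by linarith
  finally show ?thesis
    by simp
qed

lemma out_arcs_orb:
  assumes "a + b + c = 3 * k" "\<not> (a = k - 1 \<and> b = k)" "\<not> (b = k - 1 \<and> c = k)" "\<not> (c = k - 1 \<and> a = k)"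
  shows "out_arcs (D_graph k) (orb a b c)
    = {e \<in> {edge a b (c - 1), edge b c (a - 1), edge c a (b - 1)}. e \<in> arcs (D_graph k)}"
    (is "?L = ?R")
proof (intro equalityI subsetI)
  fix x assume "x \<in> ?L"
  then have x: "x \<in> arcs (D_graph k)" "D_tail k x = orb a b c"
    by (auto simp: out_arcs_def)
  from x(1) show "x \<in> ?R"
  proof (cases rule: arcs_D_cases)
    case (edge a' b' c')
    then have "a' + b' + c' = 3 * k - 1"
      by (simp add: edge_ok_def)
    with edge x show ?thesis
      using orb_eq_target [OF assms(1), of a' b' c'] by auto
  next
    case (Into i)
    then show ?thesis
      using x assms orb_eq_iff [of "k - 1" k "k + 1" a b c] by auto
  next
    case (Outof i)
    then show ?thesis
      using x by auto
  qed
next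
  fix x assume "x \<in> ?R"
  then show "x \<in> ?L"
    using orb_rotate [of a b c] orb_rotate [of b c a] by (auto simp: out_arcs_def)
qed

lemma sum_three:
  fixes f :: "'a \<Rightarrow> real"
  shows "x \<noteq> y \<Longrightarrow> y \<noteq> z \<Longrightarrow> x \<noteq> z \<Longrightarrow> (\<Sum>e \<in> {x, y, z}. f e) = f x + f y + f z"
  by simp

text \<open>Away from the centre the equation is that of \<open>\<A>\<^sup>(\<^sup>3\<^sup>k\<^sup>+\<^sup>3\<^sup>)\<close>. At \<open>(k - 1, k)\<close> the three vertices
  \<open>(k, k)\<^sub>i\<close> together have the weight of \<open>(k, k)\<close>, and at \<open>(k, k)\<^sub>i\<close> one third of the equation at
  \<open>(k, k)\<close> remains.\<close>

lemma perron_frobenius_D: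
  assumes k: "k \<ge> 1"
  shows "perron_frobenius (D_graph k) (qint (3 * k + 3) 3) (D_weight k)"
proof -
  let ?\<mu> = "qint (3 * k + 3) 3"
  have pos: "D_weight k v > 0" if "v \<in> verts (D_graph k)" for v
  proof -
    from that consider i where "v = Split i"
      | a b c where "v = orb a b c" "a \<ge> 0" "b \<ge> 0" "c \<ge> 0" "a + b + c = 3 * k"
      unfolding verts_D by blast
    then show ?thesis
    proof cases
      case (1 i)
      then show ?thesis
        using k D_weight_Split [of k i] orb_weight_pos [of k k k k] by simp
    next
      case (2 a b c)
      then show ?thesis
        using k D_weight_orb [of k a b c] orb_weight_pos [of a b c k] by simp
    qed
  qed
  have weight: "D_weight k (orb (a + 1) b (c - 1)) = orb_weight k (a + 1) b (c - 1)"
    if "a + b + c = 3 * k" for a b c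
    using that k by (intro D_weight_orb) auto
  have outer: "D_weight k (orb (a + 1) b (c - 1)) = 0"
    if "a \<ge> 0" "b \<ge> 0" "c \<ge> 0" "a + b + c = 3 * k" "\<not> (a = k \<and> b = k)" "\<not> (a = k - 1 \<and> b = k)"
      "\<not> edge_ok k a b (c - 1)" for a b c
  proof -
    have "c = 0"
      using that unfolding edge_ok_def by linarith
    then show ?thesis
      using weight [OF that(4)] by (simp add: orb_weight_def)
  qed
  have regular: "(\<Sum>e \<in> out_arcs (D_graph k) (orb a b c). D_weight k (D_head k e)) = ?\<mu> * D_weight k (orb a b c)"
    if abc: "a \<ge> 0" "b \<ge> 0" "c \<ge> 0" "a + b + c = 3 * k" "\<not> (a = k \<and> b = k)"
      "\<not> (a = k - 1 \<and> b = k)" "\<not> (b = k - 1 \<and> c = k)" "\<not> (c = k - 1 \<and> a = k)" for a b c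
  proof -
    have centre: "\<not> (b = k \<and> c = k)" "\<not> (c = k \<and> a = k)"
      using abc(4,5) by linarith+
    have *: "D_weight k (D_head k e) = 0"
      if "e \<in> {edge a b (c - 1), edge b c (a - 1), edge c a (b - 1)}" "e \<notin> arcs (D_graph k)" for e
    proof -
      from that(1) consider "e = edge a b (c - 1)" | "e = edge b c (a - 1)" | "e = edge c a (b - 1)"
        by blast
      then show ?thesis
      proof cases
        case 1
        then show ?thesis
          using outer [OF abc(1-6)] that(2) by simp
      next
        case 2
        have "b + c + a = 3 * k"
          using abc(4) by simp
        from outer [OF abc(2,3,1) this centre(1) abc(7)] show ?thesis
          using 2 that(2) by simp
      next
        case 3
        have "c + a + b = 3 * k"
          using abc(4) by simp
        from outer [OF abc(3,1,2) this centre(2) abc(8)] show ?thesis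
          using 3 that(2) by simp
      qed
    qed
    have "(\<Sum>e \<in> out_arcs (D_graph k) (orb a b c). D_weight k (D_head k e))
      = (\<Sum>e \<in> {edge a b (c - 1), edge b c (a - 1), edge c a (b - 1)}. D_weight k (D_head k e))"
      unfolding out_arcs_orb [OF abc(4,6-8)]
    proof (rule sum.mono_neutral_left)
      show "\<forall>e \<in> {edge a b (c - 1), edge b c (a - 1), edge c a (b - 1)}
          - {e \<in> {edge a b (c - 1), edge b c (a - 1), edge c a (b - 1)}. e \<in> arcs (D_graph k)}.
          D_weight k (D_head k e) = 0"
        using * by blast
    qed auto
    also have "\<dots> = orb_weight k (a + 1) b (c - 1) + orb_weight k (b + 1) c (a - 1) + orb_weight k (c + 1) a (b - 1)"
    proof -
      have "edge a b (c - 1) \<noteq> edge b c (a - 1)" "edge b c (a - 1) \<noteq> edge c a (b - 1)" "edge a b (c - 1) \<noteq> edge c a (b - 1)"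
        unfolding edge_eq_iff using abc(4,5) by linarith+
      then have "(\<Sum>e \<in> {edge a b (c - 1), edge b c (a - 1), edge c a (b - 1)}. D_weight k (D_head k e))
        = D_weight k (orb (a + 1) b (c - 1)) + D_weight k (orb (b + 1) c (a - 1)) + D_weight k (orb (c + 1) a (b - 1))"
        by (simp only: sum_three D_head_edge not_False_eq_True)
      moreover have "b + c + a = 3 * k" "c + a + b = 3 * k"
        using abc(4) by linarith+
      ultimately show ?thesis
        using weight abc(4) by presburger
    qed
    also have "\<dots> = ?\<mu> * orb_weight k a b c"
      by (rule weight_eigen [OF k abc(4)])
    also have "orb_weight k a b c = D_weight k (orb a b c)"
      using D_weight_orb [OF _ abc(4)] k by linarith
    finally show ?thesis .
  qed
  have inner: "(\<Sum>e \<in> out_arcs (D_graph k) (orb (k - 1) k (k + 1)). D_weight k (D_head k e))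
      = ?\<mu> * D_weight k (orb (k - 1) k (k + 1))"
  proof -
    let ?E = "{edge k (k + 1) (k - 2), edge (k + 1) (k - 1) (k - 1)}"
    have "out_arcs (D_graph k) (orb (k - 1) k (k + 1)) = (?E \<inter> arcs (D_graph k)) \<union> Into ` {1, 2, 3}"
      (is "?L = ?R")
    proof (intro equalityI subsetI)
      fix x assume "x \<in> ?L"
      then have x: "x \<in> arcs (D_graph k)" "D_tail k x = orb (k - 1) k (k + 1)"
        by (auto simp: out_arcs_def)
      from x(1) show "x \<in> ?R"
      proof (cases rule: arcs_D_cases)
        case (edge a' b' c')
        then have "a' + b' + c' = 3 * k - 1"
          by (simp add: edge_ok_def)
        with edge x show ?thesis
          using orb_eq_target [of "k - 1" k "k + 1" k a' b' c'] by (auto simp: edge_ok_def algebra_simps)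
      qed (use x in auto)
    next
      fix x assume "x \<in> ?R"
      then show "x \<in> ?L"
        using orb_rotate [of "k - 1" k "k + 1"] orb_rotate [of "k" "k + 1" "k - 1"] by (auto simp: out_arcs_def)
    qed
    moreover have "(\<Sum>e \<in> (?E \<inter> arcs (D_graph k)) \<union> Into ` {1, 2, 3}. D_weight k (D_head k e))
      = (\<Sum>e \<in> ?E \<inter> arcs (D_graph k). D_weight k (D_head k e)) + orb_weight k k k k"
      using k by (subst sum.union_disjoint) (auto simp: sum.reindex D_weight_Split)
    moreover have "(\<Sum>e \<in> ?E \<inter> arcs (D_graph k). D_weight k (D_head k e)) = (\<Sum>e \<in> ?E. D_weight k (D_head k e))"
      using k weight [of k "k + 1" "k - 1"]
      by (cases "k = 1"; intro sum.mono_neutral_left) (auto simp: edge_ok_def orb_weight_def)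
    moreover have "(\<Sum>e \<in> ?E. D_weight k (D_head k e)) = orb_weight k (k + 1) (k + 1) (k - 2) + orb_weight k (k + 2) (k - 1) (k - 1)"
      using weight [of k "k + 1" "k - 1"] weight [of "k + 1" "k - 1" k] by (auto simp: add.commute)
    ultimately show ?thesis
      using weight_eigen [OF k, of "k - 1" k "k + 1"] D_weight_orb [of k "k - 1" k "k + 1"] k
      by (simp add: add.commute)
  qed
  have split: "(\<Sum>e \<in> out_arcs (D_graph k) (Split i). D_weight k (D_head k e)) = ?\<mu> * D_weight k (Split i)"
    if "i \<in> {1, 2, 3}" for i
  proof -
    have "out_arcs (D_graph k) (Split i) = {Outof i}"
      using that by (auto simp: out_arcs_def elim!: arcs_D_cases)
    then have "(\<Sum>e \<in> out_arcs (D_graph k) (Split i). D_weight k (D_head k e)) = orb_weight k k (k - 1) (k + 1)"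
      using D_weight_orb [of k k "k - 1" "k + 1"] k by simp
    moreover have "3 * D_weight k (Split i) = orb_weight k k k k"
      using D_weight_Split [of k i] k by simp
    then have "3 * (?\<mu> * D_weight k (Split i)) = ?\<mu> * orb_weight k k k k"
      by (metis mult.left_commute)
    moreover have "3 * orb_weight k k (k - 1) (k + 1) = ?\<mu> * orb_weight k k k k"
      using weight_eigen [OF k, of k k k] orb_weight_rotate [of k k "k - 1" "k + 1"] by simp
    ultimately show ?thesis
      by linarith
  qed
  have "(\<Sum>e \<in> out_arcs (D_graph k) v. D_weight k (D_head k e)) = ?\<mu> * D_weight k v"
    if "v \<in> verts (D_graph k)" for v
  proof -
    from that consider i where "v = Split i" "i \<in> {1, 2, 3}"
      | a b c where "v = orb a b c" "a \<ge> 0" "b \<ge> 0" "c \<ge> 0" "a + b + c = 3 * k" "(a, b) \<noteq> (k, k)"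
      unfolding verts_D by blast
    then show ?thesis
    proof cases
      case 2
      show ?thesis
      proof (cases "orb a b c = orb (k - 1) k (k + 1)")
        case True
        then show ?thesis
          using inner 2 by simp
      next
        case False
        moreover have iff: "orb a b c = orb (k - 1) k (k + 1) \<longleftrightarrow> (k - 1 = a \<and> k = b \<and> k + 1 = c)
            \<or> (k - 1 = b \<and> k = c \<and> k + 1 = a) \<or> (k - 1 = c \<and> k = a \<and> k + 1 = b)"
          using 2 by (intro orb_eq_iff) simp
        ultimately have "\<not> (k - 1 = a \<and> k = b \<and> k + 1 = c)" "\<not> (k - 1 = b \<and> k = c \<and> k + 1 = a)"
            "\<not> (k - 1 = c \<and> k = a \<and> k + 1 = b)"
          by blast+
        then have "\<not> (a = k - 1 \<and> b = k)" "\<not> (b = k - 1 \<and> c = k)" "\<not> (c = k - 1 \<and> a = k)"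
          using 2(5) by auto
        moreover have "\<not> (a = k \<and> b = k)"
          using 2(6) by blast
        ultimately show ?thesis
          unfolding 2(1) using regular 2(2-5) by blast
      qed
    qed (simp add: split)
  qed
  then show ?thesis
    using pos unfolding perron_frobenius_def by simp
qed

section \<open>The standard cells\<close>

text \<open>The coordinates of an orbit of arcs; meaningful by \<open>edge_eq_iff\<close>.\<close>

definition edge_coords :: "aarc set \<Rightarrow> int \<times> int \<times> int" where
  "edge_coords E = (THE (a, b, c). Orbit_arc E = edge a b c)"

text \<open>The triple \<open>(a, b, c)\<close> is followed by \<open>(b, c, a), (c, a, b)\<close> in its upward triangle and by
  \<open>(c, a + 1, b - 1), (b - 1, c + 1, a)\<close> in its downward triangle.\<close>

fun regular_cell :: "int \<Rightarrow> int \<times> int \<times> int \<Rightarrow> int \<times> int \<times> int \<Rightarrow> int \<times> int \<times> int \<Rightarrow> real" where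
  "regular_cell k (a, b, c) s t =
     (if s = (b, c, a) \<and> t = (c, a, b) then tri_cell k a b c
      else if s = (c, a + 1, b - 1) \<and> t = (b - 1, c + 1, a) then tri_cell k a (b - 1) c
      else 0)"

text \<open>The cells through \<open>(k, k)\<^sub>i\<close> are those of the two triangles of \<open>\<A>\<^sup>(\<^sup>3\<^sup>k\<^sup>+\<^sup>3\<^sup>)\<close> at the centre,
  divided by \<open>\<surd>3\<close> and multiplied by a phase \<open>e i\<close> or its conjugate. Keeping \<open>e\<close> as a parameter treats \<open>W\<close>
  and its complex conjugate together.\<close>

definition split_cell :: "int \<Rightarrow> (nat \<Rightarrow> complex) \<Rightarrow> nat \<Rightarrow> darc \<Rightarrow> complex" where
  "split_cell k e i \<xi> =
     (if \<xi> = gamma_arc k then e i * of_real (tri_cell k (k - 1) k (k - 1) / sqrt 3)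
      else if \<xi> = gamma'_arc k then cnj (e i) * of_real (tri_cell k k (k - 1) k / sqrt 3)
      else 0)"

fun orbifold_cells :: "int \<Rightarrow> (nat \<Rightarrow> complex) \<Rightarrow> darc \<Rightarrow> darc \<Rightarrow> darc \<Rightarrow> complex" where
  "orbifold_cells k e (Orbit_arc A) (Orbit_arc B) (Orbit_arc C)
     = of_real (regular_cell k (edge_coords A) (edge_coords B) (edge_coords C))"
| "orbifold_cells k e (Into i) (Outof j) \<xi> = (if i = j then split_cell k e i \<xi> else 0)"
| "orbifold_cells k e (Outof j) \<xi> (Into i) = (if i = j then split_cell k e i \<xi> else 0)"
| "orbifold_cells k e \<xi> (Into i) (Outof j) = (if i = j then split_cell k e i \<xi> else 0)"
| "orbifold_cells k e _ _ _ = 0"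

lemma edge_coords_edge: "Orbit_arc E = edge a b c \<Longrightarrow> edge_coords E = (a, b, c)"
  unfolding edge_coords_def by (rule the_equality) auto

lemma orbifold_cells_edges:
  "orbifold_cells k e (edge a b c) (edge a' b' c') (edge a'' b'' c'')
     = of_real (regular_cell k (a, b, c) (a', b', c') (a'', b'', c''))"
proof -
  obtain A A' A'' where "edge a b c = Orbit_arc A" "edge a' b' c' = Orbit_arc A'" "edge a'' b'' c'' = Orbit_arc A''"
    by (simp add: edge_def)
  then show ?thesis
    by (metis edge_coords_edge orbifold_cells.simps(1))
qed

lemma gamma_neq [simp]: "gamma_arc k \<noteq> gamma'_arc k" "gamma'_arc k \<noteq> gamma_arc k"
  by (simp_all add: gamma_arc_edge gamma'_arc_edge)

lemma split_cell_gamma [simp]: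
  "split_cell k e i (gamma_arc k) = e i * of_real (tri_cell k (k - 1) k (k - 1) / sqrt 3)"
  "split_cell k e i (gamma'_arc k) = cnj (e i) * of_real (tri_cell k k (k - 1) k / sqrt 3)"
  by (simp_all add: split_cell_def)

lemma split_cell_other [simp]: "split_cell k e i (Into j) = 0" "split_cell k e i (Outof j) = 0"
  by (simp_all add: split_cell_def gamma_arc_edge gamma'_arc_edge)

lemma split_cell_nonzero: "split_cell k e i \<xi> \<noteq> 0 \<Longrightarrow> \<xi> \<in> {gamma_arc k, gamma'_arc k}"
  by (auto simp: split_cell_def split: if_splits)

lemma orbifold_cells_split [simp]:
  "orbifold_cells k e (Outof i) (edge a b c) (Into j) = (if i = j then split_cell k e i (edge a b c) else 0)"
  "orbifold_cells k e (edge a b c) (Into j) (Outof i) = (if i = j then split_cell k e i (edge a b c) else 0)"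
  by (simp_all add: edge_def)

lemma orbifold_cells_from_edge:
  assumes "\<beta> \<in> arcs (D_graph k)" "\<delta> \<in> arcs (D_graph k)" "orbifold_cells k e (edge a b c) \<beta> \<delta> \<noteq> 0"
  shows "\<beta> = edge b c a \<and> \<delta> = edge c a b
       \<or> \<beta> = edge c (a + 1) (b - 1) \<and> \<delta> = edge (b - 1) (c + 1) a
       \<or> edge a b c \<in> {gamma_arc k, gamma'_arc k} \<and> (\<exists>i \<in> {1, 2, 3}. \<beta> = Into i \<and> \<delta> = Outof i)"
  using assms(1)
proof (cases rule: arcs_D_cases)
  case \<beta>: (edge a' b' c')
  from assms(2) show ?thesis
  proof (cases rule: arcs_D_cases)
    case (edge a'' b'' c'')
    then show ?thesis
      using assms(3) \<beta> by (auto simp: orbifold_cells_edges split: if_splits)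
  qed (use assms(3) \<beta> in \<open>auto simp: edge_def\<close>)
next
  case \<beta>: (Into i)
  from assms(2) show ?thesis
  proof (cases rule: arcs_D_cases)
    case (Outof j)
    then show ?thesis
      using assms(3) \<beta> split_cell_nonzero [of k e i "edge a b c"] by (auto split: if_splits)
  qed (use assms(3) \<beta> in \<open>auto simp: edge_def\<close>)
next
  case \<beta>: (Outof i)
  from assms(2) show ?thesis
    by (cases rule: arcs_D_cases) (use assms(3) \<beta> in \<open>auto simp: edge_def\<close>)
qed

lemma orbifold_cells_from_Into:
  assumes "orbifold_cells k e (Into i) \<beta> \<delta> \<noteq> 0"
  shows "\<beta> = Outof i \<and> \<delta> \<in> {gamma_arc k, gamma'_arc k}"
  using assms split_cell_nonzero [of k e i \<delta>] by (cases \<beta>; cases \<delta>) (auto split: if_splits)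

lemma orbifold_cells_from_Outof:
  assumes "orbifold_cells k e (Outof i) \<beta> \<delta> \<noteq> 0"
  shows "\<delta> = Into i \<and> \<beta> \<in> {gamma_arc k, gamma'_arc k}"
  using assms split_cell_nonzero [of k e i \<beta>] by (cases \<beta>; cases \<delta>) (auto split: if_splits)

lemma regular_cell_rotate: "regular_cell k r s t = regular_cell k s t r"
proof -
  obtain a b c where r: "r = (a, b, c)" by (cases r)
  obtain a' b' c' where s: "s = (a', b', c')" by (cases s)
  obtain a'' b'' c'' where t: "t = (a'', b'', c'')" by (cases t)
  have up: "a' = b \<and> b' = c \<and> c' = a \<and> a'' = c \<and> b'' = a \<and> c'' = b
    \<longleftrightarrow> a'' = b' \<and> b'' = c' \<and> c'' = a' \<and> a = c' \<and> b = a' \<and> c = b'"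
    by blast
  have down: "a' = c \<and> b' = a + 1 \<and> c' = b - 1 \<and> a'' = b - 1 \<and> b'' = c + 1 \<and> c'' = a
    \<longleftrightarrow> a'' = c' \<and> b'' = a' + 1 \<and> c'' = b' - 1 \<and> a = b' - 1 \<and> b = c' + 1 \<and> c = a'"
    by linarith
  have "tri_cell k a b c = tri_cell k a' b' c'" if "a' = b" "b' = c" "c' = a"
    using that by (simp add: tri_cell_rotate)
  moreover have "tri_cell k a (b - 1) c = tri_cell k a' (b' - 1) c'" if "a' = c" "b' = a + 1" "c' = b - 1"
    using that tri_cell_rotate [of k a "b - 1" c] by simp
  ultimately show ?thesis
    unfolding r s t regular_cell.simps prod.inject conj_assoc up [symmetric] down [symmetric] by simp
qed

lemma orbifold_cells_rotate: "orbifold_cells k e \<alpha> \<beta> \<delta> = orbifold_cells k e \<beta> \<delta> \<alpha>"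
  by (cases \<alpha>; cases \<beta>; cases \<delta>) (simp_all, rule regular_cell_rotate)

lemma conj_orbifold_cells: "conj_cells (orbifold_cells k e) = orbifold_cells k (cnj \<circ> e)"
proof (intro ext)
  fix \<alpha> \<beta> \<delta>
  show "conj_cells (orbifold_cells k e) \<alpha> \<beta> \<delta> = orbifold_cells k (cnj \<circ> e) \<alpha> \<beta> \<delta>"
    by (cases \<alpha>; cases \<beta>; cases \<delta>) (simp_all add: conj_cells_def split_cell_def)
qed

section \<open>Cube roots of unity\<close>

lemma eps_values: "eps 1 = 1" "eps 2 = Complex (-1/2) (sqrt 3 / 2)" "eps 3 = Complex (-1/2) (- sqrt 3 / 2)"
proof -
  have "exp (2 * complex_of_real pi * \<i> / 3) = cis (2 * pi / 3)"
    by (simp add: cis_conv_exp mult_ac)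
  also have "\<dots> = Complex (-1/2) (sqrt 3 / 2)"
    by (simp add: complex_eq_iff cos_120 sin_120)
  finally show "eps 2 = Complex (-1/2) (sqrt 3 / 2)" "eps 3 = Complex (-1/2) (- sqrt 3 / 2)"
    by (simp_all add: eps_def complex_eq_iff)
qed (simp add: eps_def)

lemma eps_unimodular: "i \<in> {1, 2, 3} \<Longrightarrow> eps i * cnj (eps i) = 1"
  by (auto simp: eps_values complex_eq_iff simp del: One_nat_def)

text \<open>This relation makes every sum of products of the phases collapse to \<open>1 + \<omega> + \<omega>\<^sup>2 = 0\<close>.\<close>

lemma eps_square: "i \<in> {1, 2, 3} \<Longrightarrow> (eps i)\<^sup>2 = cnj (eps i)"
  by (auto simp: eps_values complex_eq_iff power2_eq_square simp del: One_nat_def)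

lemma eps_sum: "eps 1 + eps 2 + eps 3 = 0"
  by (simp add: eps_values complex_eq_iff del: One_nat_def)

lemma sum_one_two_three:
  fixes F :: "nat \<Rightarrow> 'a :: comm_monoid_add"
  shows "(\<Sum>i \<in> {1, 2, 3}. F i) = F 1 + F 2 + F 3"
  by (simp add: add.assoc)

section \<open>Triangles through an edge\<close>

lemma edge_ok_rotate:
  assumes "edge_ok k a b c" "edge a b c \<noteq> gamma'_arc k"
  shows "edge_ok k b c a" "edge_ok k c a b"
  using assms unfolding edge_ok_def gamma'_arc_edge edge_eq_iff by linarith+

lemma edge_ok_down:
  assumes "edge_ok k a b c" "edge a b c \<noteq> gamma_arc k" "b \<ge> 1"
  shows "edge_ok k c (a + 1) (b - 1)" "edge_ok k (b - 1) (c + 1) a"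
  using assms unfolding edge_ok_def gamma_arc_edge edge_eq_iff by linarith+

lemma edge_ok_gamma:
  assumes "k \<ge> 1"
  shows "edge_ok k (k - 1) (k + 1) (k - 1)" "edge_ok k k (k - 1) k"
  using assms by (simp_all add: edge_ok_def)

lemma gamma_in_arcs: "k \<ge> 1 \<Longrightarrow> gamma_arc k \<in> arcs (D_graph k)" "k \<ge> 1 \<Longrightarrow> gamma'_arc k \<in> arcs (D_graph k)"
  unfolding gamma_arc_edge gamma'_arc_edge edge_in_arcs by (rule edge_ok_gamma; assumption)+

lemma gamma_ends:
  "D_tail k (gamma_arc k) = orb k (k - 1) (k + 1)" "D_tail k (gamma'_arc k) = orb k (k - 1) (k + 1)"
  "D_head k (gamma_arc k) = orb (k - 1) k (k + 1)" "D_head k (gamma'_arc k) = orb (k - 1) k (k + 1)"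
  using orb_rotate [of "k - 1" "k + 1" k] orb_rotate [of k "k + 1" "k - 1"] orb_rotate [of "k + 1" "k - 1" k]
  by (simp_all add: gamma_arc_edge gamma'_arc_edge)

lemma up_path:
  "D_tail k (edge b c a) = D_head k (edge a b c)" "D_head k (edge b c a) = D_tail k (edge c a b)"
  "D_head k (edge c a b) = D_tail k (edge a b c)"
  by (simp_all, (metis orb_rotate)+)

lemma down_path:
  "D_tail k (edge c (a + 1) (b - 1)) = D_head k (edge a b c)"
  "D_head k (edge c (a + 1) (b - 1)) = D_tail k (edge (b - 1) (c + 1) a)"
  "D_head k (edge (b - 1) (c + 1) a) = D_tail k (edge a b c)"
  by (simp_all, (metis orb_rotate)+)

text \<open>The pairs of arcs that complete \<open>edge a b c\<close> to a triangle with nonzero cell. One of the two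
  triangles of \<open>\<gamma>\<close> and of \<open>\<gamma>'\<close> contains the centre and is replaced by three.\<close>

definition completions :: "int \<Rightarrow> int \<Rightarrow> int \<Rightarrow> int \<Rightarrow> (darc \<times> darc) set" where
  "completions k a b c =
     (if edge a b c \<noteq> gamma'_arc k then {(edge b c a, edge c a b)} else {})
   \<union> (if edge a b c \<noteq> gamma_arc k \<and> b \<ge> 1 then {(edge c (a + 1) (b - 1), edge (b - 1) (c + 1) a)} else {})
   \<union> (if edge a b c \<in> {gamma_arc k, gamma'_arc k} then (\<lambda>i. (Into i, Outof i)) ` {1, 2, 3} else {})"

lemma completionsE:
  assumes "(\<beta>, \<delta>) \<in> completions k a b c"
  obtains (up) "\<beta> = edge b c a" "\<delta> = edge c a b" "edge a b c \<noteq> gamma'_arc k"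
    | (down) "\<beta> = edge c (a + 1) (b - 1)" "\<delta> = edge (b - 1) (c + 1) a" "edge a b c \<noteq> gamma_arc k" "b \<ge> 1"
    | (split) i where "\<beta> = Into i" "\<delta> = Outof i" "i \<in> {1, 2, 3}" "edge a b c \<in> {gamma_arc k, gamma'_arc k}"
  using assms unfolding completions_def by (auto split: if_splits)

lemma completions_closed:
  assumes "k \<ge> 1" "edge_ok k a b c" "(\<beta>, \<delta>) \<in> completions k a b c"
  shows "\<beta> \<in> arcs (D_graph k)" "\<delta> \<in> arcs (D_graph k)"
    "D_tail k \<beta> = D_head k (edge a b c)" "D_head k \<beta> = D_tail k \<delta>" "D_head k \<delta> = D_tail k (edge a b c)"
proof -
  from assms(3) have "\<beta> \<in> arcs (D_graph k) \<and> \<delta> \<in> arcs (D_graph k) \<and> D_tail k \<beta> = D_head k (edge a b c)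
    \<and> D_head k \<beta> = D_tail k \<delta> \<and> D_head k \<delta> = D_tail k (edge a b c)"
  proof (cases rule: completionsE)
    case up
    then show ?thesis
      using edge_ok_rotate [OF assms(2)] up_path [of k] by (simp del: D_tail_edge D_head_edge)
  next
    case down
    then show ?thesis
      using edge_ok_down [OF assms(2)] down_path [of k] by (simp del: D_tail_edge D_head_edge)
  next
    case (split i)
    then show ?thesis
      using gamma_ends [of k] by (auto simp del: D_tail_edge D_head_edge)
  qed
  then show "\<beta> \<in> arcs (D_graph k)" "\<delta> \<in> arcs (D_graph k)"
    "D_tail k \<beta> = D_head k (edge a b c)" "D_head k \<beta> = D_tail k \<delta>" "D_head k \<delta> = D_tail k (edge a b c)"
    by blast+
qed

lemma nonzero_completion:
  assumes "edge_ok k a b c" "\<beta> \<in> arcs (D_graph k)" "\<delta> \<in> arcs (D_graph k)"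
    "orbifold_cells k e (edge a b c) \<beta> \<delta> \<noteq> 0"
  shows "(\<beta>, \<delta>) \<in> completions k a b c"
proof -
  consider "\<beta> = edge b c a" "\<delta> = edge c a b" | "\<beta> = edge c (a + 1) (b - 1)" "\<delta> = edge (b - 1) (c + 1) a"
    | i where "edge a b c \<in> {gamma_arc k, gamma'_arc k}" "i \<in> {1, 2, 3}" "\<beta> = Into i" "\<delta> = Outof i"
    using orbifold_cells_from_edge [OF assms(2-4)] by blast
  then show ?thesis
  proof cases
    case 1
    then have "edge a b c \<noteq> gamma'_arc k"
      using assms(2) by (auto simp: edge_ok_def gamma'_arc_edge)
    then show ?thesis
      using 1 by (simp add: completions_def)
  next
    case 2
    then have "edge a b c \<noteq> gamma_arc k" "b \<ge> 1"
      using assms(2) by (auto simp: edge_ok_def gamma_arc_edge)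
    then show ?thesis
      using 2 by (simp add: completions_def)
  qed (auto simp: completions_def)
qed

text \<open>Two arcs of a triangle with nonzero cell determine the third, unless the first two pass
  through a vertex \<open>(k, k)\<^sub>i\<close>.\<close>

lemma completions_inj:
  assumes "edge_ok k a b c" "(\<beta>, \<delta>) \<in> completions k a b c" "(\<beta>', \<delta>') \<in> completions k a b c"
  shows "\<beta> = \<beta>' \<longleftrightarrow> \<delta> = \<delta>'"
proof -
  have "\<not> (b = c \<and> c = a + 1 \<and> a = b - 1)" "\<not> (c = b - 1 \<and> a = c + 1 \<and> b = a)"
    using assms(1) unfolding edge_ok_def by linarith+
  then show ?thesis
    using assms(2,3) by (elim completionsE) auto
qed

lemma sum_completions:
  fixes F :: "darc \<times> darc \<Rightarrow> 'a :: comm_monoid_add"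
  assumes "edge_ok k a b c"
  shows "sum F (completions k a b c)
    = (if edge a b c \<noteq> gamma'_arc k then F (edge b c a, edge c a b) else 0)
    + (if edge a b c \<noteq> gamma_arc k \<and> b \<ge> 1 then F (edge c (a + 1) (b - 1), edge (b - 1) (c + 1) a) else 0)
    + (if edge a b c \<in> {gamma_arc k, gamma'_arc k} then (\<Sum>i \<in> {1, 2, 3}. F (Into i, Outof i)) else 0)"
proof -
  have "\<not> (b = c \<and> c = a + 1 \<and> a = b - 1)"
    using assms unfolding edge_ok_def by linarith
  then have ne: "edge b c a \<noteq> edge c (a + 1) (b - 1)"
    by simp
  have "inj_on (\<lambda>i. (Into i, Outof i)) {1, 2, 3}"
    by (auto simp: inj_on_def)
  then have split_sum: "sum F ((\<lambda>i. (Into i, Outof i)) ` {1, 2, 3}) = (\<Sum>i \<in> {1, 2, 3}. F (Into i, Outof i))"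
    by (simp add: sum.reindex)
  show ?thesis
    unfolding completions_def
    apply (subst sum.union_disjoint)
       apply (auto) [3]
    apply (subst sum.union_disjoint)
       apply (auto simp: ne [symmetric] simp del: edge_eq_iff) [3]
    by (simp add: split_sum del: edge_eq_iff)
qed

lemma regular_cell_up: "regular_cell k (a, b, c) (b, c, a) (c, a, b) = tri_cell k a b c"
  by simp

lemma regular_cell_down:
  "regular_cell k (a, b, c) (c, a + 1, b - 1) (b - 1, c + 1, a) = tri_cell k a (b - 1) c"
  by auto

lemma tri_cell_boundary: "tri_cell k a (-1) c = 0"
  by (simp add: tri_cell_def)

section \<open>Multiple edges\<close>

text \<open>Equality of orbits leaves three possibilities for each end. Combined, they force the coordinates
  of the two arcs from \<open>(k, k - 1)\<close> to \<open>(k - 1, k)\<close>, or an arc at the centre.\<close>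

lemma parallel_edges:
  assumes ok: "edge_ok k a b c" "edge_ok k a' b' c'"
    and tail: "orb a b (c + 1) = orb a' b' (c' + 1)" and head: "orb (a + 1) b c = orb (a' + 1) b' c'"
  shows "edge a b c = edge a' b' c' \<or> edge a b c = gamma_arc k \<and> edge a' b' c' = gamma'_arc k
      \<or> edge a b c = gamma'_arc k \<and> edge a' b' c' = gamma_arc k"
proof -
  have s: "a + b + (c + 1) = a' + b' + (c' + 1)" "(a + 1) + b + c = (a' + 1) + b' + c'"
    using ok by (simp_all add: edge_ok_def)
  have sum: "a + b + c = 3 * k - 1" and ne: "\<not> (a = k \<and> b = k)"
    using ok(1) by (simp_all add: edge_ok_def)
  from tail consider
      (1) "a' = a" "b' = b" "c' + 1 = c + 1"
    | (2) "a' = b" "b' = c + 1" "c' + 1 = a"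
    | (3) "a' = c + 1" "b' = a" "c' + 1 = b"
    unfolding orb_eq_iff [OF s(1)] by blast
  then show ?thesis
  proof cases
    case 1
    then show ?thesis
      by simp
  next
    case 2
    from head have "a' + 1 = c \<and> b' = a + 1 \<and> c' = b"
      unfolding orb_eq_iff [OF s(2)] using 2 sum ne by linarith
    with 2 sum have "a = k" "b = k - 1" "c = k" "a' = k - 1" "b' = k + 1" "c' = k - 1"
      by linarith+
    then show ?thesis
      by (simp add: gamma_arc_edge gamma'_arc_edge)
  next
    case 3
    from head have "a' + 1 = b \<and> b' = c \<and> c' = a + 1"
      unfolding orb_eq_iff [OF s(2)] using 3 sum ne by linarith
    with 3 sum have "a = k - 1" "b = k + 1" "c = k - 1" "a' = k" "b' = k - 1" "c' = k"
      by linarith+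
    then show ?thesis
      by (simp add: gamma_arc_edge gamma'_arc_edge)
  qed
qed

lemma parallel_arcs:
  assumes "\<alpha> \<in> arcs (D_graph k)" "\<alpha>' \<in> arcs (D_graph k)" "D_tail k \<alpha> = D_tail k \<alpha>'" "D_head k \<alpha> = D_head k \<alpha>'"
  shows "\<alpha> = \<alpha>' \<or> \<alpha> = gamma_arc k \<and> \<alpha>' = gamma'_arc k \<or> \<alpha> = gamma'_arc k \<and> \<alpha>' = gamma_arc k"
  using assms(1)
proof (cases rule: arcs_D_cases)
  case (edge a b c)
  from assms(2) show ?thesis
  proof (cases rule: arcs_D_cases)
    case (edge a' b' c')
    have "orb a b (c + 1) = orb a' b' (c' + 1)" "orb (a + 1) b c = orb (a' + 1) b' c'"
      using assms(3,4) \<open>\<alpha> = edge a b c\<close> edge(1) by simp_all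
    from parallel_edges [OF \<open>edge_ok k a b c\<close> edge(2) this] show ?thesis
      using \<open>\<alpha> = edge a b c\<close> edge(1) by blast
  qed (use edge assms(3,4) in auto)
next
  case (Into i)
  from assms(2) show ?thesis
    by (cases rule: arcs_D_cases) (use Into assms(3,4) in auto)
next
  case (Outof i)
  from assms(2) show ?thesis
    by (cases rule: arcs_D_cases) (use Outof assms(3,4) in auto)
qed

lemma orbifold_cells_up: "orbifold_cells k e (edge a b c) (edge b c a) (edge c a b) = of_real (tri_cell k a b c)"
  unfolding orbifold_cells_edges regular_cell_up ..

lemma orbifold_cells_down:
  "orbifold_cells k e (edge a b c) (edge c (a + 1) (b - 1)) (edge (b - 1) (c + 1) a) = of_real (tri_cell k a (b - 1) c)"
  unfolding orbifold_cells_edges regular_cell_down ..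

lemma orbifold_cells_gamma_split:
  "orbifold_cells k e (gamma_arc k) (Into i) (Outof i) = e i * of_real (tri_cell k (k - 1) k (k - 1) / sqrt 3)"
  "orbifold_cells k e (gamma'_arc k) (Into i) (Outof i) = cnj (e i) * of_real (tri_cell k k (k - 1) k / sqrt 3)"
  using split_cell_gamma [of k e i] by (simp_all add: gamma_arc_edge gamma'_arc_edge)

text \<open>For \<open>\<gamma>\<close> and \<open>\<gamma>'\<close> the three triangles through the split vertices stand in for the missing
  triangle, so that a sum whose split terms add up to that of the missing triangle has the same
  shape for all arcs.\<close>

lemma sum_completions_fill:
  fixes F :: "darc \<times> darc \<Rightarrow> 'a :: comm_monoid_add"
  assumes k: "k \<ge> 1" and ok: "edge_ok k a b c"
    and up: "F (edge b c a, edge c a b) = U"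
    and down: "F (edge c (a + 1) (b - 1), edge (b - 1) (c + 1) a) = D"
    and boundary: "b = 0 \<Longrightarrow> D = 0"
    and split: "edge a b c = gamma'_arc k \<Longrightarrow> (\<Sum>i \<in> {1, 2, 3}. F (Into i, Outof i)) = U"
      "edge a b c = gamma_arc k \<Longrightarrow> (\<Sum>i \<in> {1, 2, 3}. F (Into i, Outof i)) = D"
  shows "sum F (completions k a b c) = U + D"
proof -
  have "edge a b c = gamma_arc k \<or> b = 0 \<or> b \<ge> 1"
    using ok unfolding edge_ok_def by linarith
  moreover have "b \<noteq> 0" if "edge a b c = gamma_arc k"
    using that k by (simp add: gamma_arc_edge)
  moreover have "\<not> b \<ge> 1 \<longleftrightarrow> b = 0"
    using ok unfolding edge_ok_def by linarith
  ultimately show ?thesis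
    unfolding sum_completions [OF ok] up down using boundary split
    by (cases "edge a b c = gamma_arc k"; cases "edge a b c = gamma'_arc k"; cases "b = 0")
       (simp_all del: edge_eq_iff add: add.commute)
qed

section \<open>Type I relations\<close>

lemma closed_pairs_edge:
  fixes F :: "darc \<Rightarrow> darc \<Rightarrow> complex"
  assumes k: "k \<ge> 1" and ok: "edge_ok k a b c"
    and i: "i = D_tail k (edge a b c)" and j: "j = D_head k (edge a b c)"
  shows "(\<Sum>v \<in> verts (D_graph k). \<Sum>\<beta> \<in> arcs_between (D_graph k) j v. \<Sum>\<delta> \<in> arcs_between (D_graph k) v i.
      orbifold_cells k e (edge a b c) \<beta> \<delta> * F \<beta> \<delta>)
    = (\<Sum>(\<beta>, \<delta>) \<in> completions k a b c. orbifold_cells k e (edge a b c) \<beta> \<delta> * F \<beta> \<delta>)"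
proof (rule sum_closed_pairs [OF fin_digraph_D [OF k], where F = "\<lambda>v \<beta> \<delta>. orbifold_cells k e (edge a b c) \<beta> \<delta> * F \<beta> \<delta>"])
  show "\<beta> \<in> arcs (D_graph k) \<and> \<delta> \<in> arcs (D_graph k) \<and> tail (D_graph k) \<beta> = j
      \<and> head (D_graph k) \<beta> = tail (D_graph k) \<delta> \<and> head (D_graph k) \<delta> = i"
    if "(\<beta>, \<delta>) \<in> completions k a b c" for \<beta> \<delta>
    using completions_closed [OF k ok that] i j by (simp del: D_tail_edge D_head_edge)
  show "orbifold_cells k e (edge a b c) \<beta> \<delta> * F \<beta> \<delta> = 0"
    if "\<beta> \<in> arcs (D_graph k)" "\<delta> \<in> arcs (D_graph k)" "(\<beta>, \<delta>) \<notin> completions k a b c" for \<beta> \<delta>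
    using nonzero_completion [OF ok that(1,2)] that(3) by (metis mult_zero_left)
qed

lemma eps_norms:
  assumes "i \<in> {1, 2, 3}"
  shows "eps i * of_real r * cnj (eps i * of_real r) = of_real (r\<^sup>2)"
    "cnj (eps i) * of_real r * cnj (cnj (eps i) * of_real r) = of_real (r\<^sup>2)"
  using eps_unimodular [OF assms] by (simp_all add: power2_eq_square algebra_simps)

lemma type_I_edge:
  assumes k: "k \<ge> 1" and ok: "edge_ok k a b c"
  defines "W \<equiv> orbifold_cells k eps"
  shows "(\<Sum>(\<beta>, \<delta>) \<in> completions k a b c. W (edge a b c) \<beta> \<delta> * cnj (W (edge a b c) \<beta> \<delta>))
    = of_real (qint (3 * k + 3) 2 * D_weight k (D_tail k (edge a b c)) * D_weight k (D_head k (edge a b c)))"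
proof -
  have s: "a \<ge> 0" "b \<ge> 0" "c \<ge> 0" "a + b + c = 3 * k - 1"
    using ok by (simp_all add: edge_ok_def)
  have w: "D_weight k (orb a b (c + 1)) = orb_weight k a b (c + 1)" "D_weight k (orb (a + 1) b c) = orb_weight k (a + 1) b c"
    using k s(4) by (simp_all add: D_weight_orb)
  have "(\<Sum>(\<beta>, \<delta>) \<in> completions k a b c. W (edge a b c) \<beta> \<delta> * cnj (W (edge a b c) \<beta> \<delta>))
    = of_real ((tri_cell k a b c)\<^sup>2) + of_real ((tri_cell k a (b - 1) c)\<^sup>2)"
  proof (rule sum_completions_fill [OF k ok])
    show "(\<Sum>i \<in> {1, 2, 3}. case (Into i, Outof i) of (\<beta>, \<delta>) \<Rightarrow> W (edge a b c) \<beta> \<delta> * cnj (W (edge a b c) \<beta> \<delta>))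
      = of_real ((tri_cell k a b c)\<^sup>2)" if g: "edge a b c = gamma'_arc k"
    proof -
      have "(\<Sum>i \<in> {1, 2, 3}. case (Into i, Outof i) of (\<beta>, \<delta>) \<Rightarrow> W (edge a b c) \<beta> \<delta> * cnj (W (edge a b c) \<beta> \<delta>))
        = (\<Sum>i \<in> {1, 2, 3 :: nat}. complex_of_real ((tri_cell k k (k - 1) k / sqrt 3)\<^sup>2))"
        unfolding g W_def prod.case orbifold_cells_gamma_split by (intro sum.cong refl eps_norms)
      also have "\<dots> = of_real ((tri_cell k a b c)\<^sup>2)"
        using g by (simp add: gamma'_arc_edge power_divide)
      finally show ?thesis .
    qed
    show "(\<Sum>i \<in> {1, 2, 3}. case (Into i, Outof i) of (\<beta>, \<delta>) \<Rightarrow> W (edge a b c) \<beta> \<delta> * cnj (W (edge a b c) \<beta> \<delta>))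
      = of_real ((tri_cell k a (b - 1) c)\<^sup>2)" if g: "edge a b c = gamma_arc k"
    proof -
      have "(\<Sum>i \<in> {1, 2, 3}. case (Into i, Outof i) of (\<beta>, \<delta>) \<Rightarrow> W (edge a b c) \<beta> \<delta> * cnj (W (edge a b c) \<beta> \<delta>))
        = (\<Sum>i \<in> {1, 2, 3 :: nat}. complex_of_real ((tri_cell k (k - 1) k (k - 1) / sqrt 3)\<^sup>2))"
        unfolding g W_def prod.case orbifold_cells_gamma_split by (intro sum.cong refl eps_norms)
      also have "\<dots> = of_real ((tri_cell k a (b - 1) c)\<^sup>2)"
        using g by (simp add: gamma_arc_edge power_divide)
      finally show ?thesis .
    qed
  qed (simp_all add: W_def orbifold_cells_up orbifold_cells_down tri_cell_boundary power2_eq_square)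
  also have "\<dots> = of_real (qint (3 * k + 3) 2 * orb_weight k a b (c + 1) * orb_weight k (a + 1) b c)"
    unfolding cell_sum_identity [OF k s, symmetric] by simp
  finally show ?thesis
    by (simp only: D_tail_edge D_head_edge w)
qed

lemma split_weights:
  assumes "k \<ge> 1"
  defines "Q \<equiv> qint (3 * k + 3)"
  shows "(tri_cell k (k - 1) k (k - 1))\<^sup>2 = (Q k)\<^sup>2 * Q (k + 1) ^ 3 * Q (k + 2) / (Q 2)\<^sup>2"
    "(tri_cell k k (k - 1) k)\<^sup>2 = Q k * Q (k + 1) ^ 3 * (Q (k + 2))\<^sup>2 / (Q 2)\<^sup>2"
    "orb_weight k k k k = Q (k + 1) ^ 3 / Q 2"
    "orb_weight k k (k - 1) (k + 1) = Q k * Q (k + 1) * Q (k + 2) / Q 2"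
    "orb_weight k (k - 1) k (k + 1) = Q k * Q (k + 1) * Q (k + 2) / Q 2"
  using tri_cell_square [of k "k - 1" k "k - 1"] tri_cell_square [of k k "k - 1" k] assms
  by (simp_all add: orb_weight_def power2_eq_square power3_eq_cube mult_ac add.commute)

text \<open>The identity behind it is \<open>[k] + [k + 2] = [2][k + 1]\<close>. It serves the arcs into and out of \<open>(k, k)\<^sub>i\<close>
  alike, because \<open>(k, k - 1)\<close> and \<open>(k - 1, k)\<close> have the same weight.\<close>

lemma type_I_Into:
  assumes k: "k \<ge> 1" and i: "i \<in> {1, 2, 3}"
  shows "split_cell k eps i (gamma_arc k) * cnj (split_cell k eps i (gamma_arc k))
      + split_cell k eps i (gamma'_arc k) * cnj (split_cell k eps i (gamma'_arc k))
    = of_real (qint (3 * k + 3) 2 * orb_weight k (k - 1) k (k + 1) * (orb_weight k k k k / 3))"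
proof -
  define Q where "Q = qint (3 * k + 3)"
  note sw = split_weights [OF k, folded Q_def]
  have c: "Q k + Q (k + 2) = Q 2 * Q (k + 1)" and q2: "Q 2 > 0"
    using centre_identities(2) [OF k] q2_pos [OF k] by (simp_all add: Q_def)
  have "(tri_cell k (k - 1) k (k - 1) / sqrt 3)\<^sup>2 + (tri_cell k k (k - 1) k / sqrt 3)\<^sup>2
    = Q k * Q (k + 1) ^ 3 * Q (k + 2) * (Q k + Q (k + 2)) / (3 * (Q 2)\<^sup>2)"
    unfolding power_divide sw using q2 by (simp add: field_simps power2_eq_square)
  also have "\<dots> = Q 2 * orb_weight k (k - 1) k (k + 1) * (orb_weight k k k k / 3)"
    unfolding c sw using q2 by (simp add: field_simps power2_eq_square power3_eq_cube)
  finally show ?thesis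
    unfolding split_cell_gamma eps_norms [OF i] Q_def by (metis of_real_add)
qed

text \<open>For equal arcs this is the corresponding relation of \<open>\<A>\<^sup>(\<^sup>3\<^sup>k\<^sup>+\<^sup>3\<^sup>)\<close>. The only different parallel arcs
  are \<open>\<gamma>\<close> and \<open>\<gamma>'\<close>; they have no regular triangle in common, and the three split terms are
  proportional to the squares of the cube roots of unity.\<close>

lemma cell_type_I_orbifold:
  assumes k: "k \<ge> 1"
  shows "cell_type_I (3 * k + 3) (D_graph k) (D_weight k) (orbifold_cells k eps)"
  unfolding cell_type_I_def
proof (intro ballI)
  let ?G = "D_graph k" and ?W = "orbifold_cells k eps"
  fix i j \<alpha> \<alpha>'
  assume "\<alpha> \<in> arcs_between ?G i j" "\<alpha>' \<in> arcs_between ?G i j"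
  then have \<alpha>: "\<alpha> \<in> arcs ?G" "i = D_tail k \<alpha>" "j = D_head k \<alpha>" and \<alpha>': "\<alpha>' \<in> arcs ?G" "D_tail k \<alpha> = D_tail k \<alpha>'" "D_head k \<alpha> = D_head k \<alpha>'"
    by (auto simp: arcs_between_def)
  let ?S = "\<Sum>v \<in> verts ?G. \<Sum>\<beta> \<in> arcs_between ?G j v. \<Sum>\<delta> \<in> arcs_between ?G v i. ?W \<alpha> \<beta> \<delta> * cnj (?W \<alpha>' \<beta> \<delta>)"
  let ?R = "if \<alpha> = \<alpha>' then of_real (qint (3 * k + 3) 2 * D_weight k i * D_weight k j) else 0"
  from \<alpha>(1) show "?S = ?R"
  proof (cases rule: arcs_D_cases)
    case (edge a b c)
    have S: "?S = (\<Sum>(\<beta>, \<delta>) \<in> completions k a b c. ?W \<alpha> \<beta> \<delta> * cnj (?W \<alpha>' \<beta> \<delta>))"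
      unfolding edge(1) by (rule closed_pairs_edge [OF k edge(2)]) (use \<alpha> edge in simp_all)
    show ?thesis
    proof (cases "\<alpha> = \<alpha>'")
      case True
      then show ?thesis
        unfolding S using type_I_edge [OF k edge(2)] \<alpha>(2,3) edge(1) True by simp
    next
      case False
      have regular: "?W (gamma_arc k) \<beta> \<delta> = 0 \<or> ?W (gamma'_arc k) \<beta> \<delta> = 0"
        if \<beta>: "\<beta> \<in> arcs ?G" "\<delta> \<in> arcs ?G" "\<beta> \<notin> Into ` {1, 2, 3}" for \<beta> \<delta>
      proof (rule ccontr)
        assume "\<not> ?thesis"
        then have "(\<beta>, \<delta>) \<in> completions k (k - 1) (k + 1) (k - 1)" "(\<beta>, \<delta>) \<in> completions k k (k - 1) k"
          using nonzero_completion [OF edge_ok_gamma(1) [OF k] \<beta>(1,2)] nonzero_completion [OF edge_ok_gamma(2) [OF k] \<beta>(1,2)]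
          by (auto simp: gamma_arc_edge gamma'_arc_edge)
        then show False
          using \<beta>(3) by (auto simp: completions_def gamma_arc_edge gamma'_arc_edge split: if_splits)
      qed
      define x y where "x = tri_cell k (k - 1) k (k - 1) / sqrt 3" and "y = tri_cell k k (k - 1) k / sqrt 3"
      have "eps i * eps i = cnj (eps i)" if "i \<in> {1, 2, 3}" for i
        using eps_square [OF that] by (simp add: power2_eq_square)
      then have square: "eps 1 * eps 1 + eps 2 * eps 2 + eps 3 * eps 3 = 0"
        using eps_sum by (simp flip: complex_cnj_add)
      have split: "?W \<alpha> (Into i) (Outof i) * cnj (?W \<alpha>' (Into i) (Outof i))
         = (if \<alpha> = gamma_arc k then eps i * eps i else cnj (eps i * eps i)) * of_real (x * y)" for i
        using parallel_arcs [OF \<alpha>(1) \<alpha>'] False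
        by (auto simp: orbifold_cells_gamma_split [of k eps, folded x_def y_def] mult_ac simp del: orbifold_cells.simps)
      have mem: "edge a b c \<in> {gamma_arc k, gamma'_arc k}"
        using parallel_arcs [OF \<alpha>(1) \<alpha>'] False unfolding edge(1) by blast
      have "?S = (\<Sum>(\<beta>, \<delta>) \<in> (\<lambda>i. (Into i, Outof i)) ` {1, 2, 3}. ?W \<alpha> \<beta> \<delta> * cnj (?W \<alpha>' \<beta> \<delta>))"
        unfolding S
      proof (rule sum.mono_neutral_right)
        show "finite (completions k a b c)"
          by (simp add: completions_def)
        show "(\<lambda>i. (Into i, Outof i)) ` {1, 2, 3} \<subseteq> completions k a b c"
          unfolding completions_def using mem by simp
        show "\<forall>t \<in> completions k a b c - (\<lambda>i. (Into i, Outof i)) ` {1, 2, 3}.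
          (case t of (\<beta>, \<delta>) \<Rightarrow> ?W \<alpha> \<beta> \<delta> * cnj (?W \<alpha>' \<beta> \<delta>)) = 0"
        proof (intro ballI, clarify)
          fix \<beta> \<delta>
          assume t: "(\<beta>, \<delta>) \<in> completions k a b c" "(\<beta>, \<delta>) \<notin> (\<lambda>i. (Into i, Outof i)) ` {1, 2, 3}"
          then have "\<beta> \<notin> Into ` {1, 2, 3}"
            by (auto elim!: completionsE)
          with regular completions_closed(1,2) [OF k edge(2) t(1)]
          show "?W \<alpha> \<beta> \<delta> * cnj (?W \<alpha>' \<beta> \<delta>) = 0"
            using parallel_arcs [OF \<alpha>(1) \<alpha>'] False by (metis complex_cnj_zero mult_zero_left mult_zero_right)
        qed
      qed
      also have "\<dots> = (\<Sum>i \<in> {1, 2, 3}. ?W \<alpha> (Into i) (Outof i) * cnj (?W \<alpha>' (Into i) (Outof i)))"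
        by (subst sum.reindex) (auto simp: inj_on_def)
      also have "\<dots> = (if \<alpha> = gamma_arc k then eps 1 * eps 1 + eps 2 * eps 2 + eps 3 * eps 3
           else cnj (eps 1 * eps 1 + eps 2 * eps 2 + eps 3 * eps 3)) * of_real (x * y)"
        unfolding split sum_one_two_three by (simp add: algebra_simps)
      also have "\<dots> = 0"
        unfolding square by simp
      finally show ?thesis
        using False by simp
    qed
  next
    case (Into l)
    then have eq: "\<alpha>' = \<alpha>"
      using parallel_arcs [OF \<alpha>(1) \<alpha>'] by (auto simp: gamma_arc_edge gamma'_arc_edge)
    have "?S = (\<Sum>(\<beta>, \<delta>) \<in> {(Outof l, gamma_arc k), (Outof l, gamma'_arc k)}. ?W \<alpha> \<beta> \<delta> * cnj (?W \<alpha>' \<beta> \<delta>))"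
    proof (rule sum_closed_pairs [OF fin_digraph_D [OF k], where F = "\<lambda>v \<beta> \<delta>. ?W \<alpha> \<beta> \<delta> * cnj (?W \<alpha>' \<beta> \<delta>)"])
      show "\<beta> \<in> arcs ?G \<and> \<delta> \<in> arcs ?G \<and> tail ?G \<beta> = j \<and> head ?G \<beta> = tail ?G \<delta> \<and> head ?G \<delta> = i"
        if "(\<beta>, \<delta>) \<in> {(Outof l, gamma_arc k), (Outof l, gamma'_arc k)}" for \<beta> \<delta>
        using that \<alpha> Into gamma_ends [of k] gamma_in_arcs [OF k] by auto
      show "?W \<alpha> \<beta> \<delta> * cnj (?W \<alpha>' \<beta> \<delta>) = 0"
        if "(\<beta>, \<delta>) \<notin> {(Outof l, gamma_arc k), (Outof l, gamma'_arc k)}" for \<beta> \<delta>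
        using that orbifold_cells_from_Into [of k eps l \<beta> \<delta>] Into by (auto simp del: orbifold_cells.simps)
    qed
    also have "\<dots> = split_cell k eps l (gamma_arc k) * cnj (split_cell k eps l (gamma_arc k))
        + split_cell k eps l (gamma'_arc k) * cnj (split_cell k eps l (gamma'_arc k))"
      by (simp add: eq Into(1) del: split_cell_gamma)
    also have "\<dots> = of_real (qint (3 * k + 3) 2 * orb_weight k (k - 1) k (k + 1) * (orb_weight k k k k / 3))"
      by (rule type_I_Into [OF k Into(2)])
    also have "orb_weight k (k - 1) k (k + 1) = D_weight k i"
      using D_weight_orb [of k "k - 1" k "k + 1"] \<alpha>(2) Into(1) k by simp
    also have "orb_weight k k k k / 3 = D_weight k j"
      using D_weight_Split [of k l] \<alpha>(3) Into(1) k by simp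
    finally show ?thesis
      using eq by simp
  next
    case (Outof l)
    then have eq: "\<alpha>' = \<alpha>"
      using parallel_arcs [OF \<alpha>(1) \<alpha>'] by (auto simp: gamma_arc_edge gamma'_arc_edge)
    have "?S = (\<Sum>(\<beta>, \<delta>) \<in> {(gamma_arc k, Into l), (gamma'_arc k, Into l)}. ?W \<alpha> \<beta> \<delta> * cnj (?W \<alpha>' \<beta> \<delta>))"
    proof (rule sum_closed_pairs [OF fin_digraph_D [OF k], where F = "\<lambda>v \<beta> \<delta>. ?W \<alpha> \<beta> \<delta> * cnj (?W \<alpha>' \<beta> \<delta>)"])
      show "\<beta> \<in> arcs ?G \<and> \<delta> \<in> arcs ?G \<and> tail ?G \<beta> = j \<and> head ?G \<beta> = tail ?G \<delta> \<and> head ?G \<delta> = i"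
        if "(\<beta>, \<delta>) \<in> {(gamma_arc k, Into l), (gamma'_arc k, Into l)}" for \<beta> \<delta>
        using that \<alpha> Outof gamma_ends [of k] gamma_in_arcs [OF k] by auto
      show "?W \<alpha> \<beta> \<delta> * cnj (?W \<alpha>' \<beta> \<delta>) = 0"
        if "(\<beta>, \<delta>) \<notin> {(gamma_arc k, Into l), (gamma'_arc k, Into l)}" for \<beta> \<delta>
        using that orbifold_cells_from_Outof [of k eps l \<beta> \<delta>] Outof by (auto simp del: orbifold_cells.simps)
    qed
    also have "\<dots> = split_cell k eps l (gamma_arc k) * cnj (split_cell k eps l (gamma_arc k))
        + split_cell k eps l (gamma'_arc k) * cnj (split_cell k eps l (gamma'_arc k))"
      by (simp add: eq Outof(1) orbifold_cells_rotate [of k eps "Outof l" _ "Into l"] orbifold_cells_rotate [of k eps _ "Into l" "Outof l"]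
          del: split_cell_gamma)
    also have "\<dots> = of_real (qint (3 * k + 3) 2 * orb_weight k (k - 1) k (k + 1) * (orb_weight k k k k / 3))"
      by (rule type_I_Into [OF k Outof(2)])
    also have "orb_weight k (k - 1) k (k + 1) = D_weight k j"
      using D_weight_orb [of k k "k - 1" "k + 1"] \<alpha>(3) Outof(1) k split_weights(4,5) [OF k] by simp
    also have "orb_weight k k k k / 3 = D_weight k i"
      using D_weight_Split [of k l] \<alpha>(2) Outof(1) k by simp
    finally show ?thesis
      using eq by (simp add: mult_ac)
  qed
qed

section \<open>Type II relations\<close>

text \<open>The arcs \<open>\<beta>1, \<beta>2, \<beta>3, \<beta>4\<close> that join the corners of a square \<open>\<alpha>1, \<alpha>2, \<alpha>3, \<alpha>4\<close> to a common
  vertex, which is the index of summation in the type II relation.\<close>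

definition closed_quads :: "('v, 'e) pre_digraph \<Rightarrow> 'e \<Rightarrow> 'e \<Rightarrow> 'e \<Rightarrow> 'e \<Rightarrow> ('e \<times> 'e \<times> 'e \<times> 'e) set" where
  "closed_quads G \<alpha>1 \<alpha>2 \<alpha>3 \<alpha>4 = {(\<beta>1, \<beta>2, \<beta>3, \<beta>4). {\<beta>1, \<beta>2, \<beta>3, \<beta>4} \<subseteq> arcs G \<and>
     tail G \<beta>1 = head G \<alpha>1 \<and> tail G \<beta>2 = head G \<beta>1 \<and> head G \<beta>2 = tail G \<alpha>1 \<and>
     tail G \<beta>3 = head G \<beta>1 \<and> head G \<beta>3 = tail G \<alpha>2 \<and> tail G \<beta>4 = head G \<alpha>3 \<and> head G \<beta>4 = head G \<beta>1}"

definition quad_term ::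
  "('v, 'e) pre_digraph \<Rightarrow> ('v \<Rightarrow> real) \<Rightarrow> ('e \<Rightarrow> 'e \<Rightarrow> 'e \<Rightarrow> complex) \<Rightarrow> 'e \<Rightarrow> 'e \<Rightarrow> 'e \<Rightarrow> 'e
    \<Rightarrow> 'e \<times> 'e \<times> 'e \<times> 'e \<Rightarrow> complex" where
  "quad_term G \<phi> W \<alpha>1 \<alpha>2 \<alpha>3 \<alpha>4 = (\<lambda>(\<beta>1, \<beta>2, \<beta>3, \<beta>4).
     of_real (inverse (\<phi> (head G \<beta>1))) * W \<alpha>1 \<beta>1 \<beta>2 * cnj (W \<alpha>2 \<beta>1 \<beta>3)
       * W \<alpha>3 \<beta>4 \<beta>3 * cnj (W \<alpha>4 \<beta>4 \<beta>2))"

definition square_relation ::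
  "('v, 'e) pre_digraph \<Rightarrow> ('v \<Rightarrow> real) \<Rightarrow> ('e \<Rightarrow> 'e \<Rightarrow> 'e \<Rightarrow> complex) \<Rightarrow> 'e \<Rightarrow> 'e \<Rightarrow> 'e \<Rightarrow> 'e \<Rightarrow> bool" where
  "square_relation G \<phi> W \<alpha>1 \<alpha>2 \<alpha>3 \<alpha>4 \<longleftrightarrow>
     sum (quad_term G \<phi> W \<alpha>1 \<alpha>2 \<alpha>3 \<alpha>4) (closed_quads G \<alpha>1 \<alpha>2 \<alpha>3 \<alpha>4)
     = (if \<alpha>1 = \<alpha>4 \<and> \<alpha>2 = \<alpha>3 then of_real (\<phi> (tail G \<alpha>1) * \<phi> (head G \<alpha>1) * \<phi> (tail G \<alpha>2)) else 0)
     + (if \<alpha>1 = \<alpha>2 \<and> \<alpha>3 = \<alpha>4 then of_real (\<phi> (tail G \<alpha>1) * \<phi> (head G \<alpha>1) * \<phi> (head G \<alpha>3)) else 0)"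

definition square_path :: "('v, 'e) pre_digraph \<Rightarrow> 'e \<Rightarrow> 'e \<Rightarrow> 'e \<Rightarrow> 'e \<Rightarrow> bool" where
  "square_path G \<alpha>1 \<alpha>2 \<alpha>3 \<alpha>4 \<longleftrightarrow> {\<alpha>1, \<alpha>2, \<alpha>3, \<alpha>4} \<subseteq> arcs G \<and>
     head G \<alpha>1 = head G \<alpha>2 \<and> tail G \<alpha>2 = tail G \<alpha>3 \<and> head G \<alpha>3 = head G \<alpha>4 \<and> tail G \<alpha>4 = tail G \<alpha>1"

lemma cell_type_II_intro:
  assumes G: "fin_digraph G"
    and sq: "\<And>\<alpha>1 \<alpha>2 \<alpha>3 \<alpha>4. square_path G \<alpha>1 \<alpha>2 \<alpha>3 \<alpha>4 \<Longrightarrow> square_relation G \<phi> W \<alpha>1 \<alpha>2 \<alpha>3 \<alpha>4"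
  shows "cell_type_II G \<phi> W"
  unfolding cell_type_II_def
proof (intro ballI)
  fix i1 i2 i3 i4 \<alpha>1 \<alpha>2 \<alpha>3 \<alpha>4
  assume a: "\<alpha>1 \<in> arcs_between G i1 i2" "\<alpha>2 \<in> arcs_between G i3 i2" "\<alpha>3 \<in> arcs_between G i3 i4" "\<alpha>4 \<in> arcs_between G i1 i4"
  then have ends: "tail G \<alpha>1 = i1" "head G \<alpha>1 = i2" "tail G \<alpha>2 = i3" "head G \<alpha>3 = i4"
    and "square_path G \<alpha>1 \<alpha>2 \<alpha>3 \<alpha>4"
    by (auto simp: arcs_between_def square_path_def)
  then have sq: "square_relation G \<phi> W \<alpha>1 \<alpha>2 \<alpha>3 \<alpha>4"
    by (intro sq)
  have "(\<Sum>k \<in> verts G. \<Sum>\<beta>1 \<in> arcs_between G i2 k. \<Sum>\<beta>2 \<in> arcs_between G k i1.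
         \<Sum>\<beta>3 \<in> arcs_between G k i3. \<Sum>\<beta>4 \<in> arcs_between G i4 k.
            of_real (inverse (\<phi> k)) * W \<alpha>1 \<beta>1 \<beta>2 * cnj (W \<alpha>2 \<beta>1 \<beta>3)
              * W \<alpha>3 \<beta>4 \<beta>3 * cnj (W \<alpha>4 \<beta>4 \<beta>2))
    = sum (quad_term G \<phi> W \<alpha>1 \<alpha>2 \<alpha>3 \<alpha>4) (closed_quads G \<alpha>1 \<alpha>2 \<alpha>3 \<alpha>4)"
    unfolding quad_term_def
    by (rule sum_closed_quadruples [OF G, where F = "\<lambda>k \<beta>1 \<beta>2 \<beta>3 \<beta>4. of_real (inverse (\<phi> k)) * W \<alpha>1 \<beta>1 \<beta>2
        * cnj (W \<alpha>2 \<beta>1 \<beta>3) * W \<alpha>3 \<beta>4 \<beta>3 * cnj (W \<alpha>4 \<beta>4 \<beta>2)"]) (auto simp: closed_quads_def ends)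
  also note sq [unfolded square_relation_def ends]
  finally show "(\<Sum>k \<in> verts G. \<Sum>\<beta>1 \<in> arcs_between G i2 k. \<Sum>\<beta>2 \<in> arcs_between G k i1.
         \<Sum>\<beta>3 \<in> arcs_between G k i3. \<Sum>\<beta>4 \<in> arcs_between G i4 k.
            of_real (inverse (\<phi> k)) * W \<alpha>1 \<beta>1 \<beta>2 * cnj (W \<alpha>2 \<beta>1 \<beta>3)
              * W \<alpha>3 \<beta>4 \<beta>3 * cnj (W \<alpha>4 \<beta>4 \<beta>2))
    = (if \<alpha>1 = \<alpha>4 \<and> \<alpha>2 = \<alpha>3 then of_real (\<phi> i1 * \<phi> i2 * \<phi> i3) else 0)
    + (if \<alpha>1 = \<alpha>2 \<and> \<alpha>3 = \<alpha>4 then of_real (\<phi> i1 * \<phi> i2 * \<phi> i4) else 0)" .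
qed

lemma closed_quads_flip_head:
  assumes "square_path G \<alpha>1 \<alpha>2 \<alpha>3 \<alpha>4" "(\<beta>1, \<beta>2, \<beta>3, \<beta>4) \<in> closed_quads G \<alpha>1 \<alpha>2 \<alpha>3 \<alpha>4"
  shows "(\<beta>4, \<beta>2, \<beta>3, \<beta>1) \<in> closed_quads G \<alpha>4 \<alpha>3 \<alpha>2 \<alpha>1"
  using assms unfolding closed_quads_def square_path_def mem_Collect_eq prod.case insert_subset by metis

lemma closed_quads_flip_tail:
  assumes "square_path G \<alpha>1 \<alpha>2 \<alpha>3 \<alpha>4" "(\<beta>1, \<beta>2, \<beta>3, \<beta>4) \<in> closed_quads G \<alpha>1 \<alpha>2 \<alpha>3 \<alpha>4"
  shows "(\<beta>1, \<beta>3, \<beta>2, \<beta>4) \<in> closed_quads G \<alpha>2 \<alpha>1 \<alpha>4 \<alpha>3"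
  using assms unfolding closed_quads_def square_path_def mem_Collect_eq prod.case insert_subset by metis

lemma square_path_flip:
  assumes "square_path G \<alpha>1 \<alpha>2 \<alpha>3 \<alpha>4"
  shows "square_path G \<alpha>4 \<alpha>3 \<alpha>2 \<alpha>1" "square_path G \<alpha>2 \<alpha>1 \<alpha>4 \<alpha>3"
  using assms unfolding square_path_def insert_subset by metis+

lemma quad_term_flip_head:
  assumes "(\<beta>1, \<beta>2, \<beta>3, \<beta>4) \<in> closed_quads G \<alpha>1 \<alpha>2 \<alpha>3 \<alpha>4"
  shows "cnj (quad_term G \<phi> W \<alpha>4 \<alpha>3 \<alpha>2 \<alpha>1 (\<beta>4, \<beta>2, \<beta>3, \<beta>1)) = quad_term G \<phi> W \<alpha>1 \<alpha>2 \<alpha>3 \<alpha>4 (\<beta>1, \<beta>2, \<beta>3, \<beta>4)"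
proof -
  have "head G \<beta>4 = head G \<beta>1"
    using assms by (simp add: closed_quads_def)
  then show ?thesis
    by (simp add: quad_term_def mult_ac)
qed

lemma quad_term_flip_tail:
  "cnj (quad_term G \<phi> W \<alpha>2 \<alpha>1 \<alpha>4 \<alpha>3 (\<beta>1, \<beta>3, \<beta>2, \<beta>4)) = quad_term G \<phi> W \<alpha>1 \<alpha>2 \<alpha>3 \<alpha>4 (\<beta>1, \<beta>2, \<beta>3, \<beta>4)"
  by (simp add: quad_term_def mult_ac)

text \<open>Complex conjugation exchanges the two targets of the square. Together with the exchange of
  the two sources below, any of the four arcs can be moved to the first place.\<close>

lemma square_relation_flip_head:
  assumes p: "square_path G \<alpha>1 \<alpha>2 \<alpha>3 \<alpha>4" and sq: "square_relation G \<phi> W \<alpha>4 \<alpha>3 \<alpha>2 \<alpha>1"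
  shows "square_relation G \<phi> W \<alpha>1 \<alpha>2 \<alpha>3 \<alpha>4"
proof -
  let ?f = "\<lambda>(\<beta>1, \<beta>2, \<beta>3, \<beta>4). (\<beta>4, \<beta>2, \<beta>3, \<beta>1)"
  have ends: "tail G \<alpha>4 = tail G \<alpha>1" "head G \<alpha>4 = head G \<alpha>3" "tail G \<alpha>3 = tail G \<alpha>2" "head G \<alpha>2 = head G \<alpha>1"
    using p by (simp_all only: square_path_def)
  have eqs: "(\<alpha>4 = \<alpha>1 \<and> \<alpha>3 = \<alpha>2) = (\<alpha>1 = \<alpha>4 \<and> \<alpha>2 = \<alpha>3)" "(\<alpha>4 = \<alpha>3 \<and> \<alpha>2 = \<alpha>1) = (\<alpha>1 = \<alpha>2 \<and> \<alpha>3 = \<alpha>4)"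
    "(\<alpha>2 = \<alpha>3 \<and> \<alpha>1 = \<alpha>4) = (\<alpha>1 = \<alpha>4 \<and> \<alpha>2 = \<alpha>3)" "(\<alpha>2 = \<alpha>1 \<and> \<alpha>4 = \<alpha>3) = (\<alpha>1 = \<alpha>2 \<and> \<alpha>3 = \<alpha>4)"
    by blast+
  have "sum (quad_term G \<phi> W \<alpha>1 \<alpha>2 \<alpha>3 \<alpha>4) (closed_quads G \<alpha>1 \<alpha>2 \<alpha>3 \<alpha>4)
    = (\<Sum>t \<in> closed_quads G \<alpha>4 \<alpha>3 \<alpha>2 \<alpha>1. cnj (quad_term G \<phi> W \<alpha>4 \<alpha>3 \<alpha>2 \<alpha>1 t))"
  proof (rule sum.reindex_bij_witness [where i = ?f and j = ?f])
    fix t assume t: "t \<in> closed_quads G \<alpha>1 \<alpha>2 \<alpha>3 \<alpha>4"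
    obtain \<beta>1 \<beta>2 \<beta>3 \<beta>4 where [simp]: "t = (\<beta>1, \<beta>2, \<beta>3, \<beta>4)"
      by (cases t)
    show "?f (?f t) = t"
      by simp
    show "?f t \<in> closed_quads G \<alpha>4 \<alpha>3 \<alpha>2 \<alpha>1"
      using closed_quads_flip_head [OF p] t by simp
    show "cnj (quad_term G \<phi> W \<alpha>4 \<alpha>3 \<alpha>2 \<alpha>1 (?f t)) = quad_term G \<phi> W \<alpha>1 \<alpha>2 \<alpha>3 \<alpha>4 t"
      using quad_term_flip_head [of \<beta>1 \<beta>2 \<beta>3 \<beta>4 G \<alpha>1 \<alpha>2 \<alpha>3 \<alpha>4 \<phi> W] t by (simp only: \<open>t = _\<close> prod.case)
  next
    fix t assume t: "t \<in> closed_quads G \<alpha>4 \<alpha>3 \<alpha>2 \<alpha>1"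
    obtain \<beta>1 \<beta>2 \<beta>3 \<beta>4 where [simp]: "t = (\<beta>1, \<beta>2, \<beta>3, \<beta>4)"
      by (cases t)
    show "?f (?f t) = t"
      by simp
    show "?f t \<in> closed_quads G \<alpha>1 \<alpha>2 \<alpha>3 \<alpha>4"
      using closed_quads_flip_head [OF square_path_flip(1) [OF p]] t by simp
  qed
  also have "\<dots> = cnj (sum (quad_term G \<phi> W \<alpha>4 \<alpha>3 \<alpha>2 \<alpha>1) (closed_quads G \<alpha>4 \<alpha>3 \<alpha>2 \<alpha>1))"
    by simp
  finally have *: "sum (quad_term G \<phi> W \<alpha>1 \<alpha>2 \<alpha>3 \<alpha>4) (closed_quads G \<alpha>1 \<alpha>2 \<alpha>3 \<alpha>4) = \<dots>" .
  define C1 where "C1 \<longleftrightarrow> \<alpha>1 = \<alpha>4 \<and> \<alpha>2 = \<alpha>3"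
  define C2 where "C2 \<longleftrightarrow> \<alpha>1 = \<alpha>2 \<and> \<alpha>3 = \<alpha>4"
  have "C1 \<Longrightarrow> head G \<alpha>3 = head G \<alpha>1"
    using ends(2) unfolding C1_def by metis
  moreover have "C2 \<Longrightarrow> tail G \<alpha>2 = tail G \<alpha>1"
    unfolding C2_def by metis
  ultimately show ?thesis
    unfolding square_relation_def * sq [unfolded square_relation_def] eqs ends C1_def [symmetric] C2_def [symmetric]
    by (cases C1; cases C2) (simp_all add: mult_ac)
qed

lemma square_relation_flip_tail:
  assumes p: "square_path G \<alpha>1 \<alpha>2 \<alpha>3 \<alpha>4" and sq: "square_relation G \<phi> W \<alpha>2 \<alpha>1 \<alpha>4 \<alpha>3"
  shows "square_relation G \<phi> W \<alpha>1 \<alpha>2 \<alpha>3 \<alpha>4"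
proof -
  let ?f = "\<lambda>(\<beta>1, \<beta>2, \<beta>3, \<beta>4). (\<beta>1, \<beta>3, \<beta>2, \<beta>4)"
  have ends: "tail G \<alpha>4 = tail G \<alpha>1" "head G \<alpha>4 = head G \<alpha>3" "tail G \<alpha>3 = tail G \<alpha>2" "head G \<alpha>2 = head G \<alpha>1"
    using p by (simp_all only: square_path_def)
  have eqs: "(\<alpha>4 = \<alpha>1 \<and> \<alpha>3 = \<alpha>2) = (\<alpha>1 = \<alpha>4 \<and> \<alpha>2 = \<alpha>3)" "(\<alpha>4 = \<alpha>3 \<and> \<alpha>2 = \<alpha>1) = (\<alpha>1 = \<alpha>2 \<and> \<alpha>3 = \<alpha>4)"
    "(\<alpha>2 = \<alpha>3 \<and> \<alpha>1 = \<alpha>4) = (\<alpha>1 = \<alpha>4 \<and> \<alpha>2 = \<alpha>3)" "(\<alpha>2 = \<alpha>1 \<and> \<alpha>4 = \<alpha>3) = (\<alpha>1 = \<alpha>2 \<and> \<alpha>3 = \<alpha>4)"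
    by blast+
  have "sum (quad_term G \<phi> W \<alpha>1 \<alpha>2 \<alpha>3 \<alpha>4) (closed_quads G \<alpha>1 \<alpha>2 \<alpha>3 \<alpha>4)
    = (\<Sum>t \<in> closed_quads G \<alpha>2 \<alpha>1 \<alpha>4 \<alpha>3. cnj (quad_term G \<phi> W \<alpha>2 \<alpha>1 \<alpha>4 \<alpha>3 t))"
  proof (rule sum.reindex_bij_witness [where i = ?f and j = ?f])
    fix t assume t: "t \<in> closed_quads G \<alpha>1 \<alpha>2 \<alpha>3 \<alpha>4"
    obtain \<beta>1 \<beta>2 \<beta>3 \<beta>4 where [simp]: "t = (\<beta>1, \<beta>2, \<beta>3, \<beta>4)"
      by (cases t)
    show "?f (?f t) = t"
      by simp
    show "?f t \<in> closed_quads G \<alpha>2 \<alpha>1 \<alpha>4 \<alpha>3"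
      using closed_quads_flip_tail [OF p] t by simp
    show "cnj (quad_term G \<phi> W \<alpha>2 \<alpha>1 \<alpha>4 \<alpha>3 (?f t)) = quad_term G \<phi> W \<alpha>1 \<alpha>2 \<alpha>3 \<alpha>4 t"
      using quad_term_flip_tail [of G \<phi> W \<alpha>2 \<alpha>1 \<alpha>4 \<alpha>3 \<beta>1 \<beta>3 \<beta>2 \<beta>4] t by (simp only: \<open>t = _\<close> prod.case)
  next
    fix t assume t: "t \<in> closed_quads G \<alpha>2 \<alpha>1 \<alpha>4 \<alpha>3"
    obtain \<beta>1 \<beta>2 \<beta>3 \<beta>4 where [simp]: "t = (\<beta>1, \<beta>2, \<beta>3, \<beta>4)"
      by (cases t)
    show "?f (?f t) = t"
      by simp
    show "?f t \<in> closed_quads G \<alpha>1 \<alpha>2 \<alpha>3 \<alpha>4"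
      using closed_quads_flip_tail [OF square_path_flip(2) [OF p]] t by simp
  qed
  also have "\<dots> = cnj (sum (quad_term G \<phi> W \<alpha>2 \<alpha>1 \<alpha>4 \<alpha>3) (closed_quads G \<alpha>2 \<alpha>1 \<alpha>4 \<alpha>3))"
    by simp
  finally have *: "sum (quad_term G \<phi> W \<alpha>1 \<alpha>2 \<alpha>3 \<alpha>4) (closed_quads G \<alpha>1 \<alpha>2 \<alpha>3 \<alpha>4) = \<dots>" .
  define C1 where "C1 \<longleftrightarrow> \<alpha>1 = \<alpha>4 \<and> \<alpha>2 = \<alpha>3"
  define C2 where "C2 \<longleftrightarrow> \<alpha>1 = \<alpha>2 \<and> \<alpha>3 = \<alpha>4"
  have "C1 \<Longrightarrow> head G \<alpha>3 = head G \<alpha>1"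
    using ends(2) unfolding C1_def by metis
  moreover have "C2 \<Longrightarrow> tail G \<alpha>2 = tail G \<alpha>1"
    unfolding C2_def by metis
  ultimately show ?thesis
    unfolding square_relation_def * sq [unfolded square_relation_def] eqs ends C1_def [symmetric] C2_def [symmetric]
    by (cases C1; cases C2) (simp_all add: mult_ac)
qed

lemma quad_sum_support:
  assumes "fin_digraph G" "S \<subseteq> closed_quads G \<alpha>1 \<alpha>2 \<alpha>3 \<alpha>4"
    and "\<And>\<beta>1 \<beta>2 \<beta>3 \<beta>4. (\<beta>1, \<beta>2, \<beta>3, \<beta>4) \<in> closed_quads G \<alpha>1 \<alpha>2 \<alpha>3 \<alpha>4 \<Longrightarrow> W \<alpha>1 \<beta>1 \<beta>2 \<noteq> 0 \<Longrightarrow> W \<alpha>2 \<beta>1 \<beta>3 \<noteq> 0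
      \<Longrightarrow> W \<alpha>3 \<beta>4 \<beta>3 \<noteq> 0 \<Longrightarrow> W \<alpha>4 \<beta>4 \<beta>2 \<noteq> 0 \<Longrightarrow> (\<beta>1, \<beta>2, \<beta>3, \<beta>4) \<in> S"
  shows "sum (quad_term G \<phi> W \<alpha>1 \<alpha>2 \<alpha>3 \<alpha>4) (closed_quads G \<alpha>1 \<alpha>2 \<alpha>3 \<alpha>4)
    = sum (quad_term G \<phi> W \<alpha>1 \<alpha>2 \<alpha>3 \<alpha>4) S"
proof (rule sum.mono_neutral_right)
  interpret fin_digraph G by (rule assms)
  show "finite (closed_quads G \<alpha>1 \<alpha>2 \<alpha>3 \<alpha>4)"
    by (rule finite_subset [of _ "arcs G \<times> arcs G \<times> arcs G \<times> arcs G"]) (auto simp: closed_quads_def)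
  show "S \<subseteq> closed_quads G \<alpha>1 \<alpha>2 \<alpha>3 \<alpha>4"
    by (rule assms)
  show "\<forall>t \<in> closed_quads G \<alpha>1 \<alpha>2 \<alpha>3 \<alpha>4 - S. quad_term G \<phi> W \<alpha>1 \<alpha>2 \<alpha>3 \<alpha>4 t = 0"
  proof
    fix t assume t: "t \<in> closed_quads G \<alpha>1 \<alpha>2 \<alpha>3 \<alpha>4 - S"
    obtain \<beta>1 \<beta>2 \<beta>3 \<beta>4 where eq: "t = (\<beta>1, \<beta>2, \<beta>3, \<beta>4)"
      by (cases t)
    with t assms(3) [of \<beta>1 \<beta>2 \<beta>3 \<beta>4] show "quad_term G \<phi> W \<alpha>1 \<alpha>2 \<alpha>3 \<alpha>4 t = 0"
      unfolding eq quad_term_def by auto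
  qed
qed

lemma closed_quadsD:
  assumes "(\<beta>1, \<beta>2, \<beta>3, \<beta>4) \<in> closed_quads G \<alpha>1 \<alpha>2 \<alpha>3 \<alpha>4"
  shows "\<beta>1 \<in> arcs G" "\<beta>2 \<in> arcs G" "\<beta>3 \<in> arcs G" "\<beta>4 \<in> arcs G"
  using assms by (auto simp: closed_quads_def)

lemma completions_quad:
  assumes k: "k \<ge> 1" and ok: "edge_ok k a b c" "edge_ok k a' b' c'"
    and "(\<beta>1, \<beta>2) \<in> completions k a b c" "(\<beta>4, \<beta>2) \<in> completions k a' b' c'"
  shows "(\<beta>1, \<beta>2, \<beta>2, \<beta>4) \<in> closed_quads (D_graph k) (edge a b c) (edge a b c) (edge a' b' c') (edge a' b' c')"
  using completions_closed [OF k ok(1) assms(4)] completions_closed [OF k ok(2) assms(5)]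
  unfolding closed_quads_def mem_Collect_eq prod.case tail_D head_D by simp

lemma completions_quad':
  assumes k: "k \<ge> 1" and ok: "edge_ok k a b c" "edge_ok k a' b' c'"
    and "(\<beta>1, \<beta>2) \<in> completions k a b c" "(\<beta>1, \<beta>3) \<in> completions k a' b' c'"
  shows "(\<beta>1, \<beta>2, \<beta>3, \<beta>1) \<in> closed_quads (D_graph k) (edge a b c) (edge a' b' c') (edge a' b' c') (edge a b c)"
  using completions_closed [OF k ok(1) assms(4)] completions_closed [OF k ok(2) assms(5)]
  unfolding closed_quads_def mem_Collect_eq prod.case tail_D head_D by simp

lemma inverse_Split_weight:
  assumes "k \<ge> 1"
  shows "inverse (D_weight k (Split i)) = 3 * inverse (orb_weight k k k k)"
proof -
  have "D_weight k (Split i) = orb_weight k k k k / 3"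
    using assms by (intro D_weight_Split) simp
  then show ?thesis
    by (simp only: inverse_divide) (simp only: divide_inverse)
qed

lemma quad_term_split:
  assumes "k \<ge> 1"
  shows "quad_term (D_graph k) (D_weight k) W \<alpha>1 \<alpha>2 \<alpha>3 \<alpha>4 (Into i, Outof i, Outof i, Into i)
    = of_real (3 * inverse (orb_weight k k k k)) * (W \<alpha>1 (Into i) (Outof i) * cnj (W \<alpha>2 (Into i) (Outof i))
        * W \<alpha>3 (Into i) (Outof i) * cnj (W \<alpha>4 (Into i) (Outof i)))"
  unfolding inverse_Split_weight [OF assms, of i, symmetric] by (simp add: quad_term_def mult.assoc)

lemma quad_sum_split:
  assumes "k \<ge> 1"
  shows "sum (quad_term (D_graph k) (D_weight k) W \<alpha>1 \<alpha>2 \<alpha>3 \<alpha>4) ((\<lambda>i. (Into i, Outof i, Outof i, Into i)) ` {1, 2, 3})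
    = of_real (3 * inverse (orb_weight k k k k)) * (\<Sum>i \<in> {1, 2, 3}. W \<alpha>1 (Into i) (Outof i) * cnj (W \<alpha>2 (Into i) (Outof i))
        * W \<alpha>3 (Into i) (Outof i) * cnj (W \<alpha>4 (Into i) (Outof i)))"
proof -
  have "sum (quad_term (D_graph k) (D_weight k) W \<alpha>1 \<alpha>2 \<alpha>3 \<alpha>4) ((\<lambda>i. (Into i, Outof i, Outof i, Into i)) ` {1, 2, 3})
    = (\<Sum>i \<in> {1, 2, 3}. quad_term (D_graph k) (D_weight k) W \<alpha>1 \<alpha>2 \<alpha>3 \<alpha>4 (Into i, Outof i, Outof i, Into i))"
    by (subst sum.reindex) (auto simp: inj_on_def)
  then show ?thesis
    unfolding quad_term_split [OF assms] sum_distrib_left .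
qed

lemma eps_fourth:
  assumes "i \<in> {1, 2, 3}"
  shows "eps i * of_real r * cnj (eps i * of_real r) * (eps i * of_real r) * cnj (eps i * of_real r) = of_real (r ^ 4)"
    "cnj (eps i) * of_real r * cnj (cnj (eps i) * of_real r) * (cnj (eps i) * of_real r) * cnj (cnj (eps i) * of_real r) = of_real (r ^ 4)"
proof -
  have "r ^ 4 = r\<^sup>2 * r\<^sup>2"
    by (simp add: power2_eq_square power4_eq_xxxx)
  then show "eps i * of_real r * cnj (eps i * of_real r) * (eps i * of_real r) * cnj (eps i * of_real r) = of_real (r ^ 4)"
    "cnj (eps i) * of_real r * cnj (cnj (eps i) * of_real r) * (cnj (eps i) * of_real r) * cnj (cnj (eps i) * of_real r) = of_real (r ^ 4)"
    unfolding eps_norms [OF assms] mult.assoc [of "of_real (r\<^sup>2)"] by simp_all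
qed

lemma third_fourth: "(x / sqrt 3) ^ 4 = x ^ 4 / (9 :: real)"
proof -
  have "(sqrt 3) ^ 4 = ((sqrt 3)\<^sup>2)\<^sup>2"
    by (simp add: power4_eq_xxxx power2_eq_square)
  then show ?thesis
    by (simp add: power_divide)
qed

text \<open>Two arcs of a triangle determine the third, so each completion of the arc contributes the fourth
  power of the absolute value of its cell.\<close>

lemma square_relation_equal:
  assumes k: "k \<ge> 1" and ok: "edge_ok k a b c"
  shows "square_relation (D_graph k) (D_weight k) (orbifold_cells k eps) (edge a b c) (edge a b c) (edge a b c) (edge a b c)"
proof -
  let ?G = "D_graph k" and ?W = "orbifold_cells k eps" and ?\<alpha> = "edge a b c"
  let ?Q = "quad_term ?G (D_weight k) ?W ?\<alpha> ?\<alpha> ?\<alpha> ?\<alpha>"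
  let ?f = "\<lambda>(\<beta>, \<delta>). (\<beta>, \<delta>, \<delta>, \<beta>)"
  have s: "a \<ge> 0" "b \<ge> 0" "c \<ge> 0" "a + b + c = 3 * k - 1"
    using ok by (simp_all add: edge_ok_def)
  have w: "D_weight k (orb a b (c + 1)) = orb_weight k a b (c + 1)" "D_weight k (orb (a + 1) b c) = orb_weight k (a + 1) b c"
    "D_weight k (orb (b + 1) c a) = orb_weight k a (b + 1) c"
    "D_weight k (orb (c + 1) (a + 1) (b - 1)) = orb_weight k (a + 1) (b - 1) (c + 1)"
    unfolding orb_weight_rotate [of k "b + 1" c a, symmetric] orb_weight_rotate [of k "a + 1" "b - 1" "c + 1"]
    using k s(4) by (intro D_weight_orb; linarith)+
  have "sum ?Q (closed_quads ?G ?\<alpha> ?\<alpha> ?\<alpha> ?\<alpha>) = sum ?Q (?f ` completions k a b c)"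
  proof (rule quad_sum_support [OF fin_digraph_D [OF k]])
    show "?f ` completions k a b c \<subseteq> closed_quads ?G ?\<alpha> ?\<alpha> ?\<alpha> ?\<alpha>"
      using completions_quad [OF k ok ok] by auto
    fix \<beta>1 \<beta>2 \<beta>3 \<beta>4
    assume q: "(\<beta>1, \<beta>2, \<beta>3, \<beta>4) \<in> closed_quads ?G ?\<alpha> ?\<alpha> ?\<alpha> ?\<alpha>"
      "?W ?\<alpha> \<beta>1 \<beta>2 \<noteq> 0" "?W ?\<alpha> \<beta>1 \<beta>3 \<noteq> 0" "?W ?\<alpha> \<beta>4 \<beta>3 \<noteq> 0" "?W ?\<alpha> \<beta>4 \<beta>2 \<noteq> 0"
    note c = closed_quadsD [OF q(1)]
    note n = nonzero_completion [OF ok c(1,2) q(2)] nonzero_completion [OF ok c(1,3) q(3)] nonzero_completion [OF ok c(4,2) q(5)]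
    have "\<beta>2 = \<beta>3" "\<beta>1 = \<beta>4"
      using completions_inj [OF ok n(1,2)] completions_inj [OF ok n(1,3)] by simp_all
    with n(1) show "(\<beta>1, \<beta>2, \<beta>3, \<beta>4) \<in> ?f ` completions k a b c"
      by force
  qed
  also have "\<dots> = sum (?Q \<circ> ?f) (completions k a b c)"
    by (rule sum.reindex) (auto simp: inj_on_def)
  also have "\<dots> = of_real (inverse (orb_weight k a (b + 1) c) * tri_cell k a b c ^ 4)
      + of_real (inverse (orb_weight k (a + 1) (b - 1) (c + 1)) * tri_cell k a (b - 1) c ^ 4)"
  proof (rule sum_completions_fill [OF k ok])
    show "(\<Sum>i \<in> {1, 2, 3}. (?Q \<circ> ?f) (Into i, Outof i)) = of_real (inverse (orb_weight k a (b + 1) c) * tri_cell k a b c ^ 4)"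
      if g: "edge a b c = gamma'_arc k"
    proof -
      have "(?Q \<circ> ?f) (Into i, Outof i) = of_real (3 * inverse (orb_weight k k k k) * ((tri_cell k k (k - 1) k / sqrt 3) ^ 4))"
        if "i \<in> {1, 2, 3}" for i
        unfolding g comp_def prod.case quad_term_split [OF k] orbifold_cells_gamma_split eps_fourth [OF that] of_real_mult ..
      then have "(\<Sum>i \<in> {1, 2, 3}. (?Q \<circ> ?f) (Into i, Outof i))
        = (\<Sum>i \<in> {1, 2, 3 :: nat}. complex_of_real (3 * inverse (orb_weight k k k k) * ((tri_cell k k (k - 1) k / sqrt 3) ^ 4)))"
        by (intro sum.cong refl)
      then show ?thesis
        using g unfolding third_fourth by (simp add: gamma'_arc_edge)
    qed
    show "(\<Sum>i \<in> {1, 2, 3}. (?Q \<circ> ?f) (Into i, Outof i)) = of_real (inverse (orb_weight k (a + 1) (b - 1) (c + 1)) * tri_cell k a (b - 1) c ^ 4)"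
      if g: "edge a b c = gamma_arc k"
    proof -
      have "(?Q \<circ> ?f) (Into i, Outof i) = of_real (3 * inverse (orb_weight k k k k) * ((tri_cell k (k - 1) k (k - 1) / sqrt 3) ^ 4))"
        if "i \<in> {1, 2, 3}" for i
        unfolding g comp_def prod.case quad_term_split [OF k] orbifold_cells_gamma_split eps_fourth [OF that] of_real_mult ..
      then have "(\<Sum>i \<in> {1, 2, 3}. (?Q \<circ> ?f) (Into i, Outof i))
        = (\<Sum>i \<in> {1, 2, 3 :: nat}. complex_of_real (3 * inverse (orb_weight k k k k) * ((tri_cell k (k - 1) k (k - 1) / sqrt 3) ^ 4)))"
        by (intro sum.cong refl)
      then show ?thesis
        using g unfolding third_fourth by (simp add: gamma_arc_edge)
    qed
  qed (simp_all add: quad_term_def orbifold_cells_up orbifold_cells_down tri_cell_boundary w power4_eq_xxxx)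
  also have "\<dots> = of_real (orb_weight k a b (c + 1) * orb_weight k (a + 1) b c * (orb_weight k a b (c + 1) + orb_weight k (a + 1) b c))"
    unfolding cell_fourth_identity [OF k s, symmetric] by simp
  finally show ?thesis
    unfolding square_relation_def tail_D head_D D_tail_edge D_head_edge w by (simp add: distrib_left mult_ac)
qed

lemma split_pair_value:
  assumes "k \<ge> 1" and i: "i \<in> {1, 2, 3}"
  shows "orbifold_cells k eps (gamma_arc k) (Into i) (Outof i) * cnj (orbifold_cells k eps (gamma_arc k) (Into i) (Outof i))
    = of_real ((tri_cell k (k - 1) k (k - 1))\<^sup>2 / 3)"
   "orbifold_cells k eps (gamma'_arc k) (Into i) (Outof i) * cnj (orbifold_cells k eps (gamma'_arc k) (Into i) (Outof i))
    = of_real ((tri_cell k k (k - 1) k)\<^sup>2 / 3)"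
  unfolding orbifold_cells_gamma_split eps_norms [OF i] by (simp_all add: power_divide)

text \<open>Two different arcs from the same vertex share exactly one incoming arc \<open>edge c a b\<close> with
  which both form a triangle: an upward one for the first arc and a downward one for the second. If
  that arc would start at the centre, the arcs are \<open>\<gamma>'\<close> and \<open>\<gamma>\<close>, and the three split vertices contribute one
  third of the same value each.\<close>

lemma square_relation_common_tail:
  assumes k: "k \<ge> 1" and ok: "edge_ok k a b c" "edge_ok k b (c + 1) (a - 1)"
  shows "square_relation (D_graph k) (D_weight k) (orbifold_cells k eps)
    (edge a b c) (edge a b c) (edge b (c + 1) (a - 1)) (edge b (c + 1) (a - 1))"
proof -
  let ?G = "D_graph k" and ?W = "orbifold_cells k eps" and ?\<alpha> = "edge a b c" and ?\<alpha>' = "edge b (c + 1) (a - 1)"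
  let ?Q = "quad_term ?G (D_weight k) ?W ?\<alpha> ?\<alpha> ?\<alpha>' ?\<alpha>'"
  have s: "a \<ge> 1" "b \<ge> 0" "c \<ge> 0" "a + b + c = 3 * k - 1"
    using ok by (simp_all add: edge_ok_def)
  have ne: "\<not> (a = b \<and> b = c + 1)"
    using ok(1) unfolding edge_ok_def by linarith
  have g: "?\<alpha>' = gamma_arc k \<longleftrightarrow> ?\<alpha> = gamma'_arc k"
    unfolding gamma_arc_edge gamma'_arc_edge edge_eq_iff using s(4) by linarith
  have w: "D_weight k (orb a b (c + 1)) = orb_weight k (c + 1) a b" "D_weight k (orb (a + 1) b c) = orb_weight k (a + 1) b c"
    "D_weight k (orb (b + 1) c a) = orb_weight k c a (b + 1)" "D_weight k (orb (b + 1) (c + 1) (a - 1)) = orb_weight k (b + 1) (c + 1) (a - 1)"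
    unfolding orb_weight_rotate [of k a b "c + 1", symmetric] orb_weight_rotate [of k "b + 1" c a, symmetric]
      orb_weight_rotate [of k c a "b + 1"]
    using k s(4) by (intro D_weight_orb; linarith)+
  have neq: "?\<alpha> \<noteq> ?\<alpha>'"
    using ne by auto
  have id: "inverse (orb_weight k c a (b + 1)) * (tri_cell k a b c)\<^sup>2 * (tri_cell k (a - 1) b c)\<^sup>2
    = orb_weight k (c + 1) a b * orb_weight k (a + 1) b c * orb_weight k (b + 1) (c + 1) (a - 1)"
    using cell_pair_identity [OF k s] orb_weight_pos [of c a "b + 1" k] s by (simp add: field_simps)
  have support: "(\<beta>1, \<beta>2) = (edge b c a, edge c a b) \<and> (\<beta>3, \<beta>4) = (edge c a b, edge (a - 1) (b + 1) c) \<and> ?\<alpha> \<noteq> gamma'_arc k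
      \<or> ?\<alpha> = gamma'_arc k \<and> (\<exists>i \<in> {1, 2, 3}. \<beta>1 = Into i \<and> \<beta>2 = Outof i \<and> \<beta>3 = Outof i \<and> \<beta>4 = Into i)"
    if q: "(\<beta>1, \<beta>2, \<beta>3, \<beta>4) \<in> closed_quads ?G ?\<alpha> ?\<alpha> ?\<alpha>' ?\<alpha>'"
      "?W ?\<alpha> \<beta>1 \<beta>2 \<noteq> 0" "?W ?\<alpha> \<beta>1 \<beta>3 \<noteq> 0" "?W ?\<alpha>' \<beta>4 \<beta>3 \<noteq> 0" "?W ?\<alpha>' \<beta>4 \<beta>2 \<noteq> 0" for \<beta>1 \<beta>2 \<beta>3 \<beta>4
  proof -
    note c = closed_quadsD [OF q(1)]
    note n = nonzero_completion [OF ok(1) c(1,2) q(2)] nonzero_completion [OF ok(1) c(1,3) q(3)]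
      nonzero_completion [OF ok(2) c(4,2) q(5)]
    have "\<beta>3 = \<beta>2"
      using completions_inj [OF ok(1) n(1,2)] by simp
    moreover have "(\<beta>1, \<beta>2) = (edge b c a, edge c a b) \<and> \<beta>4 = edge (a - 1) (b + 1) c \<and> ?\<alpha> \<noteq> gamma'_arc k
      \<or> ?\<alpha> = gamma'_arc k \<and> (\<exists>i \<in> {1, 2, 3}. \<beta>1 = Into i \<and> \<beta>2 = Outof i \<and> \<beta>4 = Into i)"
      using n(1)
    proof (cases rule: completionsE)
      case 1: up
      from n(3) show ?thesis
      proof (cases rule: completionsE)
        case 2: up
        have "edge c a b = edge (a - 1) b (c + 1)"
          using 1(2) 2(2) by (rule subst)
        then show ?thesis
          unfolding edge_eq_iff using ne by linarith
      next
        case 2: down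
        then show ?thesis
          using 1 by simp
      next
        case 2: (split i)
        then show ?thesis
          using 1(2) by simp
      qed
    next
      case 1: down
      from n(3) show ?thesis
      proof (cases rule: completionsE)
        case 2: up
        have "edge (b - 1) (c + 1) a = edge (a - 1) b (c + 1)"
          using 1(2) 2(2) by (rule subst)
        then show ?thesis
          unfolding edge_eq_iff using ne by linarith
      next
        case 2: down
        have "edge (b - 1) (c + 1) a = edge (c + 1 - 1) (a - 1 + 1) b"
          using 1(2) 2(2) by (rule subst)
        then show ?thesis
          unfolding edge_eq_iff using ne by linarith
      next
        case 2: (split i)
        then show ?thesis
          using 1(2) by simp
      qed
    next
      case 1: (split i)
      from n(3) show ?thesis
      proof (cases rule: completionsE)
        case 2: (split j)
        have "?\<alpha> \<noteq> gamma_arc k \<or> ?\<alpha>' \<noteq> gamma'_arc k"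
          unfolding gamma_arc_edge gamma'_arc_edge edge_eq_iff by linarith
        then show ?thesis
          using 1 2 g by auto
      qed (use 1(2) in simp_all)
    qed
    ultimately show ?thesis
      by blast
  qed
  have "sum ?Q (closed_quads ?G ?\<alpha> ?\<alpha> ?\<alpha>' ?\<alpha>')
    = of_real (inverse (orb_weight k c a (b + 1)) * (tri_cell k a b c)\<^sup>2 * (tri_cell k (a - 1) b c)\<^sup>2)"
  proof (cases "?\<alpha> = gamma'_arc k")
    case False
    then have n: "(edge b c a, edge c a b) \<in> completions k a b c" "(edge (a - 1) (b + 1) c, edge c a b) \<in> completions k b (c + 1) (a - 1)"
      using g s by (simp_all add: completions_def del: edge_eq_iff)
    have "sum ?Q (closed_quads ?G ?\<alpha> ?\<alpha> ?\<alpha>' ?\<alpha>') = sum ?Q {(edge b c a, edge c a b, edge c a b, edge (a - 1) (b + 1) c)}"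
    proof (rule quad_sum_support [OF fin_digraph_D [OF k]])
      show "{(edge b c a, edge c a b, edge c a b, edge (a - 1) (b + 1) c)} \<subseteq> closed_quads ?G ?\<alpha> ?\<alpha> ?\<alpha>' ?\<alpha>'"
        using completions_quad [OF k ok n] by simp
    qed (use support False in blast)
    then show ?thesis
      using orbifold_cells_down [of k eps b "c + 1" "a - 1"]
      by (simp add: quad_term_def orbifold_cells_up w tri_cell_rotate power2_eq_square mult_ac)
  next
    case True
    then have abc: "a = k" "b = k - 1" "c = k"
      by (simp_all add: gamma'_arc_edge)
    have "sum ?Q (closed_quads ?G ?\<alpha> ?\<alpha> ?\<alpha>' ?\<alpha>') = sum ?Q ((\<lambda>i. (Into i, Outof i, Outof i, Into i)) ` {1, 2, 3})"
    proof (rule quad_sum_support [OF fin_digraph_D [OF k]])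
      show "(\<lambda>i. (Into i, Outof i, Outof i, Into i)) ` {1, 2, 3} \<subseteq> closed_quads ?G ?\<alpha> ?\<alpha> ?\<alpha>' ?\<alpha>'"
      proof (rule image_subsetI)
        fix i :: nat assume i: "i \<in> {1, 2, 3}"
        have "(Into i, Outof i) \<in> completions k a b c" "(Into i, Outof i) \<in> completions k b (c + 1) (a - 1)"
          using i True g by (simp_all add: completions_def del: edge_eq_iff)
        then show "(Into i, Outof i, Outof i, Into i) \<in> closed_quads ?G ?\<alpha> ?\<alpha> ?\<alpha>' ?\<alpha>'"
          by (rule completions_quad [OF k ok])
      qed
    qed (use support True in blast)
    also have "\<dots> = of_real (3 * inverse (orb_weight k k k k)) * (\<Sum>i \<in> {1, 2, 3}. ?W ?\<alpha> (Into i) (Outof i) * cnj (?W ?\<alpha> (Into i) (Outof i))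
        * (?W ?\<alpha>' (Into i) (Outof i) * cnj (?W ?\<alpha>' (Into i) (Outof i))))"
      unfolding quad_sum_split [OF k] mult.assoc ..
    also have "\<dots> = of_real (3 * inverse (orb_weight k k k k))
        * (\<Sum>i \<in> {1, 2, 3 :: nat}. of_real ((tri_cell k k (k - 1) k)\<^sup>2 / 3) * of_real ((tri_cell k (k - 1) k (k - 1))\<^sup>2 / 3))"
      unfolding True g [THEN iffD2, OF True] using split_pair_value [OF k] by (intro arg_cong2 [of _ _ _ _ "(*)"] sum.cong refl) simp
    also have "\<dots> = of_real (inverse (orb_weight k c a (b + 1)) * (tri_cell k a b c)\<^sup>2 * (tri_cell k (a - 1) b c)\<^sup>2)"
      using tri_cell_rotate [of k "k - 1" k "k - 1"] tri_cell_rotate [of k "k - 1" "k - 1" k] by (simp add: abc)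
    finally show ?thesis .
  qed
  then show ?thesis
    unfolding square_relation_def tail_D head_D D_tail_edge D_head_edge w id using neq by (simp del: edge_eq_iff)
qed

text \<open>The mirror image of \<open>square_relation_common_tail\<close>: two different arcs into the same vertex share
  exactly one outgoing arc \<open>edge b c a\<close>.\<close>

lemma square_relation_common_head:
  assumes k: "k \<ge> 1" and ok: "edge_ok k a b c" "edge_ok k (c - 1) (a + 1) b"
  shows "square_relation (D_graph k) (D_weight k) (orbifold_cells k eps)
    (edge a b c) (edge (c - 1) (a + 1) b) (edge (c - 1) (a + 1) b) (edge a b c)"
proof -
  let ?G = "D_graph k" and ?W = "orbifold_cells k eps" and ?\<alpha> = "edge a b c" and ?\<alpha>' = "edge (c - 1) (a + 1) b"
  let ?Q = "quad_term ?G (D_weight k) ?W ?\<alpha> ?\<alpha>' ?\<alpha>' ?\<alpha>"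
  have s: "c \<ge> 1" "a \<ge> 0" "b \<ge> 0" "c + a + b = 3 * k - 1"
    using ok by (simp_all add: edge_ok_def)
  have ne: "\<not> (b = a + 1 \<and> c = b)"
    using ok(1) unfolding edge_ok_def by linarith
  have g: "?\<alpha>' = gamma_arc k \<longleftrightarrow> ?\<alpha> = gamma'_arc k"
    unfolding gamma_arc_edge gamma'_arc_edge edge_eq_iff using s(4) by linarith
  have w: "D_weight k (orb a b (c + 1)) = orb_weight k (c + 1) a b" "D_weight k (orb (a + 1) b c) = orb_weight k b c (a + 1)"
    "D_weight k (orb (b + 1) c a) = orb_weight k (b + 1) c a" "D_weight k (orb (c - 1) (a + 1) (b + 1)) = orb_weight k (a + 1) (b + 1) (c - 1)"
    unfolding orb_weight_rotate [of k a b "c + 1", symmetric] orb_weight_rotate [of k b c "a + 1"]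
      orb_weight_rotate [of k "a + 1" "b + 1" "c - 1"]
    using k s(4) by (intro D_weight_orb; linarith)+
  have neq: "?\<alpha> \<noteq> ?\<alpha>'"
    unfolding edge_eq_iff using ne by linarith
  have id: "inverse (orb_weight k (b + 1) c a) * (tri_cell k a b c)\<^sup>2 * (tri_cell k a b (c - 1))\<^sup>2
    = orb_weight k (c + 1) a b * orb_weight k b c (a + 1) * orb_weight k (a + 1) (b + 1) (c - 1)"
    using cell_pair_identity [OF k s] orb_weight_pos [of "b + 1" c a k] s tri_cell_rotate [of k a b c] tri_cell_rotate [of k a b "c - 1"]
    by (simp add: field_simps)
  have support: "(\<beta>1, \<beta>2) = (edge b c a, edge c a b) \<and> (\<beta>3, \<beta>4) = (edge a (b + 1) (c - 1), edge b c a) \<and> ?\<alpha> \<noteq> gamma'_arc k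
      \<or> ?\<alpha> = gamma'_arc k \<and> (\<exists>i \<in> {1, 2, 3}. \<beta>1 = Into i \<and> \<beta>2 = Outof i \<and> \<beta>3 = Outof i \<and> \<beta>4 = Into i)"
    if q: "(\<beta>1, \<beta>2, \<beta>3, \<beta>4) \<in> closed_quads ?G ?\<alpha> ?\<alpha>' ?\<alpha>' ?\<alpha>"
      "?W ?\<alpha> \<beta>1 \<beta>2 \<noteq> 0" "?W ?\<alpha>' \<beta>1 \<beta>3 \<noteq> 0" "?W ?\<alpha>' \<beta>4 \<beta>3 \<noteq> 0" "?W ?\<alpha> \<beta>4 \<beta>2 \<noteq> 0" for \<beta>1 \<beta>2 \<beta>3 \<beta>4
  proof -
    note c = closed_quadsD [OF q(1)]
    note n = nonzero_completion [OF ok(1) c(1,2) q(2)] nonzero_completion [OF ok(1) c(4,2) q(5)]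
      nonzero_completion [OF ok(2) c(1,3) q(3)]
    have "\<beta>4 = \<beta>1"
      using completions_inj [OF ok(1) n(1,2)] by simp
    moreover have "(\<beta>1, \<beta>2) = (edge b c a, edge c a b) \<and> \<beta>3 = edge a (b + 1) (c - 1) \<and> ?\<alpha> \<noteq> gamma'_arc k
      \<or> ?\<alpha> = gamma'_arc k \<and> (\<exists>i \<in> {1, 2, 3}. \<beta>1 = Into i \<and> \<beta>2 = Outof i \<and> \<beta>3 = Outof i)"
      using n(1)
    proof (cases rule: completionsE)
      case 1: up
      from n(3) show ?thesis
      proof (cases rule: completionsE)
        case 2: up
        have "edge b c a = edge (a + 1) b (c - 1)"
          using 1(1) 2(1) by (rule subst)
        then show ?thesis
          unfolding edge_eq_iff using ne by linarith
      next
        case 2: down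
        then show ?thesis
          using 1 by simp
      next
        case 2: (split i)
        then show ?thesis
          using 1(1) by simp
      qed
    next
      case 1: down
      from n(3) show ?thesis
      proof (cases rule: completionsE)
        case 2: up
        have "edge c (a + 1) (b - 1) = edge (a + 1) b (c - 1)"
          using 1(1) 2(1) by (rule subst)
        then show ?thesis
          unfolding edge_eq_iff using ne by linarith
      next
        case 2: down
        have "edge c (a + 1) (b - 1) = edge b (c - 1 + 1) (a + 1 - 1)"
          using 1(1) 2(1) by (rule subst)
        then show ?thesis
          unfolding edge_eq_iff using ne by linarith
      next
        case 2: (split i)
        then show ?thesis
          using 1(1) by simp
      qed
    next
      case 1: (split i)
      from n(3) show ?thesis
      proof (cases rule: completionsE)
        case 2: (split j)
        have "?\<alpha> \<noteq> gamma_arc k \<or> ?\<alpha>' \<noteq> gamma'_arc k"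
          unfolding gamma_arc_edge gamma'_arc_edge edge_eq_iff by linarith
        then show ?thesis
          using 1 2 g by auto
      qed (use 1(1) in simp_all)
    qed
    ultimately show ?thesis
      by blast
  qed
  have "sum ?Q (closed_quads ?G ?\<alpha> ?\<alpha>' ?\<alpha>' ?\<alpha>)
    = of_real (inverse (orb_weight k (b + 1) c a) * (tri_cell k a b c)\<^sup>2 * (tri_cell k a b (c - 1))\<^sup>2)"
  proof (cases "?\<alpha> = gamma'_arc k")
    case False
    then have n: "(edge b c a, edge c a b) \<in> completions k a b c" "(edge b c a, edge a (b + 1) (c - 1)) \<in> completions k (c - 1) (a + 1) b"
      using g s by (simp_all add: completions_def del: edge_eq_iff)
    have "sum ?Q (closed_quads ?G ?\<alpha> ?\<alpha>' ?\<alpha>' ?\<alpha>) = sum ?Q {(edge b c a, edge c a b, edge a (b + 1) (c - 1), edge b c a)}"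
    proof (rule quad_sum_support [OF fin_digraph_D [OF k]])
      show "{(edge b c a, edge c a b, edge a (b + 1) (c - 1), edge b c a)} \<subseteq> closed_quads ?G ?\<alpha> ?\<alpha>' ?\<alpha>' ?\<alpha>"
        using completions_quad' [OF k ok n] by simp
    qed (use support False in blast)
    then show ?thesis
      using orbifold_cells_down [of k eps "c - 1" "a + 1" b] tri_cell_rotate [of k "c - 1" a b] tri_cell_rotate [of k b "c - 1" a]
      by (simp add: quad_term_def orbifold_cells_up w power2_eq_square mult_ac)
  next
    case True
    then have abc: "a = k" "b = k - 1" "c = k"
      by (simp_all add: gamma'_arc_edge)
    have "sum ?Q (closed_quads ?G ?\<alpha> ?\<alpha>' ?\<alpha>' ?\<alpha>) = sum ?Q ((\<lambda>i. (Into i, Outof i, Outof i, Into i)) ` {1, 2, 3})"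
    proof (rule quad_sum_support [OF fin_digraph_D [OF k]])
      show "(\<lambda>i. (Into i, Outof i, Outof i, Into i)) ` {1, 2, 3} \<subseteq> closed_quads ?G ?\<alpha> ?\<alpha>' ?\<alpha>' ?\<alpha>"
      proof (rule image_subsetI)
        fix i :: nat assume i: "i \<in> {1, 2, 3}"
        have "(Into i, Outof i) \<in> completions k a b c" "(Into i, Outof i) \<in> completions k (c - 1) (a + 1) b"
          using i True g by (simp_all add: completions_def del: edge_eq_iff)
        then show "(Into i, Outof i, Outof i, Into i) \<in> closed_quads ?G ?\<alpha> ?\<alpha>' ?\<alpha>' ?\<alpha>"
          by (rule completions_quad' [OF k ok])
      qed
    qed (use support True in blast)
    also have "\<dots> = of_real (3 * inverse (orb_weight k k k k)) * (\<Sum>i \<in> {1, 2, 3}. (?W ?\<alpha> (Into i) (Outof i) * cnj (?W ?\<alpha> (Into i) (Outof i)))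
        * (?W ?\<alpha>' (Into i) (Outof i) * cnj (?W ?\<alpha>' (Into i) (Outof i))))"
      unfolding quad_sum_split [OF k] by (simp only: mult_ac)
    also have "\<dots> = of_real (3 * inverse (orb_weight k k k k))
        * (\<Sum>i \<in> {1, 2, 3 :: nat}. of_real ((tri_cell k k (k - 1) k)\<^sup>2 / 3) * of_real ((tri_cell k (k - 1) k (k - 1))\<^sup>2 / 3))"
      unfolding True g [THEN iffD2, OF True] using split_pair_value [OF k] by (intro arg_cong2 [of _ _ _ _ "(*)"] sum.cong refl) simp
    also have "\<dots> = of_real (inverse (orb_weight k (b + 1) c a) * (tri_cell k a b c)\<^sup>2 * (tri_cell k a b (c - 1))\<^sup>2)"
      using tri_cell_rotate [of k "k - 1" k "k - 1"] tri_cell_rotate [of k "k - 1" "k - 1" k] by (simp add: abc)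
    finally show ?thesis .
  qed
  then show ?thesis
    unfolding square_relation_def tail_D head_D D_tail_edge D_head_edge diff_add_cancel w id using neq by (simp add: mult_ac del: edge_eq_iff)
qed

text \<open>The completing arc and the kind of the triangle determine the arc that is completed.\<close>

lemma completion_from_first:
  assumes "(edge x y z, \<delta>) \<in> completions k a b c"
  shows "edge a b c = edge z x y \<and> \<delta> = edge y z x \<or> edge a b c = edge (y - 1) (z + 1) x \<and> \<delta> = edge z (x + 1) (y - 1)"
  using assms by (cases rule: completionsE) auto

text \<open>Here \<open>p, r\<close> are the two arcs that a first arc completes, with third arcs \<open>u, d\<close>, and \<open>p', r'\<close>,
  \<open>u', d'\<close> are the same for a second one. Of the sixteen choices of kinds, those outside the
  conclusion need an equality between third arcs that the hypotheses exclude.\<close>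

lemma crossing_choices:
  assumes "\<alpha>1 = p \<and> \<beta>2 = u \<or> \<alpha>1 = r \<and> \<beta>2 = d" "\<alpha>2 = p \<and> \<beta>3 = u \<or> \<alpha>2 = r \<and> \<beta>3 = d"
    "\<alpha>3 = p' \<and> \<beta>3 = u' \<or> \<alpha>3 = r' \<and> \<beta>3 = d'" "\<alpha>4 = p' \<and> \<beta>2 = u' \<or> \<alpha>4 = r' \<and> \<beta>2 = d'"
    and "u \<noteq> d" "u' \<noteq> d'" "u = u' \<Longrightarrow> p = p' \<and> r = r'" "\<not> (u = d' \<and> d = u')"
  shows "\<alpha>1 = \<alpha>2 \<and> \<alpha>3 = \<alpha>4 \<or> \<alpha>1 = \<alpha>4 \<and> \<alpha>2 = \<alpha>3"
  using assms(1-4) by (elim disjE conjE) (use assms(5-8) in simp_all)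

text \<open>Away from the split vertices a square around a vertex lifts to \<open>\<A>\<^sup>(\<^sup>3\<^sup>k\<^sup>+\<^sup>3\<^sup>)\<close>, and in the triangular
  lattice it has to be folded onto itself.\<close>

lemma regular_square:
  assumes ok: "edge_ok k x y z" "edge_ok k x' y' z'"
    and 1: "(edge x y z, \<beta>2) \<in> completions k a1 b1 c1" and 2: "(edge x y z, \<beta>3) \<in> completions k a2 b2 c2"
    and 3: "(edge x' y' z', \<beta>3) \<in> completions k a3 b3 c3" and 4: "(edge x' y' z', \<beta>2) \<in> completions k a4 b4 c4"
  shows "edge a1 b1 c1 = edge a2 b2 c2 \<and> edge a3 b3 c3 = edge a4 b4 c4
    \<or> edge a1 b1 c1 = edge a4 b4 c4 \<and> edge a2 b2 c2 = edge a3 b3 c3"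
proof -
  have ne: "\<not> (y = x + 1 \<and> z = x + 1)" "\<not> (y' = x' + 1 \<and> z' = x' + 1)"
    using ok unfolding edge_ok_def by linarith+
  have up_down: "edge y z x \<noteq> edge z (x + 1) (y - 1)" "edge y' z' x' \<noteq> edge z' (x' + 1) (y' - 1)"
    unfolding edge_eq_iff using ne by linarith+
  have crossed: "\<not> (edge y z x = edge z' (x' + 1) (y' - 1) \<and> edge z (x + 1) (y - 1) = edge y' z' x')"
    unfolding edge_eq_iff using ne by linarith
  show ?thesis
    by (rule crossing_choices [OF completion_from_first [OF 1] completion_from_first [OF 2] completion_from_first [OF 3]
          completion_from_first [OF 4] up_down _ crossed]) simp
qed

text \<open>Each \<open>\<gamma>\<close> contributes \<open>\<epsilon>\<^sub>i\<close> or its conjugate according to its position, each \<open>\<gamma>'\<close> the opposite.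
  Outside the two excluded patterns the total exponent is \<open>\<plusminus>2\<close> or \<open>\<plusminus>4\<close>, hence not divisible by
  three, and the sum over \<open>i\<close> vanishes.\<close>

lemma eps_alternating_sum:
  assumes m: "\<alpha>1 \<in> {gamma_arc k, gamma'_arc k}" "\<alpha>2 \<in> {gamma_arc k, gamma'_arc k}"
      "\<alpha>3 \<in> {gamma_arc k, gamma'_arc k}" "\<alpha>4 \<in> {gamma_arc k, gamma'_arc k}"
    and pat: "\<not> (\<alpha>1 = \<alpha>4 \<and> \<alpha>2 = \<alpha>3)" "\<not> (\<alpha>1 = \<alpha>2 \<and> \<alpha>3 = \<alpha>4)"
  shows "(\<Sum>i \<in> {1, 2, 3}. orbifold_cells k eps (\<alpha>1) (Into i) (Outof i) * cnj (orbifold_cells k eps (\<alpha>2) (Into i) (Outof i))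
        * orbifold_cells k eps (\<alpha>3) (Into i) (Outof i) * cnj (orbifold_cells k eps (\<alpha>4) (Into i) (Outof i))) = 0"
proof -
  let ?v = "\<lambda>\<xi> i. if \<xi> = gamma_arc k then eps i else cnj (eps i)"
  let ?r = "\<lambda>\<xi>. if \<xi> = gamma_arc k then tri_cell k (k - 1) k (k - 1) / sqrt 3 else tri_cell k k (k - 1) k / sqrt 3"
  let ?R = "complex_of_real (?r (\<alpha>1) * ?r (\<alpha>2) * ?r (\<alpha>3) * ?r (\<alpha>4))"
  have W: "orbifold_cells k eps \<xi> (Into i) (Outof i) = ?v \<xi> i * of_real (?r \<xi>)" if "\<xi> \<in> {gamma_arc k, gamma'_arc k}" for \<xi> i
    using that orbifold_cells_gamma_split [of k eps i] by (auto simp del: orbifold_cells.simps split_cell_gamma)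
  have rules: "eps i * eps i = cnj (eps i)" "cnj (eps i) * cnj (eps i) = eps i" "eps i * cnj (eps i) = 1" "cnj (eps i) * eps i = 1"
    if "i \<in> {1, 2, 3}" for i
  proof -
    show "eps i * eps i = cnj (eps i)"
      using eps_square [OF that] by (simp add: power2_eq_square)
    then show "cnj (eps i) * cnj (eps i) = eps i"
      by (metis complex_cnj_cnj complex_cnj_mult)
    show "eps i * cnj (eps i) = 1" "cnj (eps i) * eps i = 1"
      using eps_unimodular [OF that] by (simp_all add: mult.commute)
  qed
  have pattern: "(\<forall>i \<in> {1, 2, 3}. ?v (\<alpha>1) i * cnj (?v (\<alpha>2) i) * ?v (\<alpha>3) i * cnj (?v (\<alpha>4) i) = eps i)
     \<or> (\<forall>i \<in> {1, 2, 3}. ?v (\<alpha>1) i * cnj (?v (\<alpha>2) i) * ?v (\<alpha>3) i * cnj (?v (\<alpha>4) i) = cnj (eps i))"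
    using m pat rules by (elim insertE emptyE) simp_all
  have zero: "(\<Sum>i \<in> {1, 2, 3}. eps i) = 0" "(\<Sum>i \<in> {1, 2, 3}. cnj (eps i)) = 0"
    using eps_sum unfolding sum_one_two_three by (simp_all flip: complex_cnj_add)
  have "(\<Sum>i \<in> {1, 2, 3}. orbifold_cells k eps (\<alpha>1) (Into i) (Outof i) * cnj (orbifold_cells k eps (\<alpha>2) (Into i) (Outof i))
        * orbifold_cells k eps (\<alpha>3) (Into i) (Outof i) * cnj (orbifold_cells k eps (\<alpha>4) (Into i) (Outof i)))
    = (\<Sum>i \<in> {1, 2, 3}. (?v (\<alpha>1) i * cnj (?v (\<alpha>2) i) * ?v (\<alpha>3) i * cnj (?v (\<alpha>4) i)) * ?R)"
  proof (intro sum.cong refl)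
    show "orbifold_cells k eps (\<alpha>1) (Into i) (Outof i) * cnj (orbifold_cells k eps (\<alpha>2) (Into i) (Outof i))
        * orbifold_cells k eps (\<alpha>3) (Into i) (Outof i) * cnj (orbifold_cells k eps (\<alpha>4) (Into i) (Outof i))
        = (?v (\<alpha>1) i * cnj (?v (\<alpha>2) i) * ?v (\<alpha>3) i * cnj (?v (\<alpha>4) i)) * ?R" for i
      unfolding W [OF m(1)] W [OF m(2)] W [OF m(3)] W [OF m(4)] complex_cnj_mult complex_cnj_complex_of_real of_real_mult
      by (simp only: mult_ac)
  qed
  also have "\<dots> = 0"
    unfolding sum_distrib_right [symmetric]
  proof -
    have "(\<Sum>i \<in> {1, 2, 3}. ?v (\<alpha>1) i * cnj (?v (\<alpha>2) i) * ?v (\<alpha>3) i * cnj (?v (\<alpha>4) i)) = 0"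
      using pattern
    proof
      assume "\<forall>i \<in> {1, 2, 3}. ?v (\<alpha>1) i * cnj (?v (\<alpha>2) i) * ?v (\<alpha>3) i * cnj (?v (\<alpha>4) i) = eps i"
      then show ?thesis
        using zero(1) by (metis (no_types, lifting) sum.cong)
    next
      assume "\<forall>i \<in> {1, 2, 3}. ?v (\<alpha>1) i * cnj (?v (\<alpha>2) i) * ?v (\<alpha>3) i * cnj (?v (\<alpha>4) i) = cnj (eps i)"
      then show ?thesis
        using zero(2) by (metis (no_types, lifting) sum.cong)
    qed
    then show "(\<Sum>i \<in> {1, 2, 3}. ?v (\<alpha>1) i * cnj (?v (\<alpha>2) i) * ?v (\<alpha>3) i * cnj (?v (\<alpha>4) i)) * ?R = 0"
      by simp
  qed
  finally show ?thesis .
qed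

lemma completions_kind:
  assumes "(\<beta>, \<delta>) \<in> completions k a b c"
  shows "(\<exists>x y z. \<beta> = edge x y z) \<and> (\<exists>x y z. \<delta> = edge x y z)
    \<or> (\<exists>i \<in> {1, 2, 3}. \<beta> = Into i \<and> \<delta> = Outof i) \<and> edge a b c \<in> {gamma_arc k, gamma'_arc k}"
  using assms by (cases rule: completionsE) auto

lemma square_relation_same_sides_head:
  assumes k: "k \<ge> 1" and ok: "edge_ok k a b c" "edge_ok k a' b' c'"
    and head: "orb (a' + 1) b' c' = orb (a + 1) b c"
  shows "square_relation (D_graph k) (D_weight k) (orbifold_cells k eps)
    (edge a b c) (edge a' b' c') (edge a' b' c') (edge a b c)"
proof -
  have s: "(a' + 1) + b' + c' = (a + 1) + b + c"
    using ok by (simp add: edge_ok_def)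
  have path: "square_path (D_graph k) (edge a b c) (edge a' b' c') (edge a' b' c') (edge a b c)"
    using ok head by (simp add: square_path_def)
  from head consider "a = a'" "b = b'" "c = c'" | "a' = c - 1" "b' = a + 1" "c' = b" | "a = c' - 1" "b = a' + 1" "c = b'"
    unfolding orb_eq_iff [OF s] by linarith
  then show ?thesis
  proof cases
    case 1
    then show ?thesis
      using square_relation_equal [OF k ok(1)] by simp
  next
    case 2
    then show ?thesis
      using square_relation_common_head [OF k ok(1)] ok(2) by simp
  next
    case 3
    then have "square_relation (D_graph k) (D_weight k) (orbifold_cells k eps)
      (edge a' b' c') (edge a b c) (edge a b c) (edge a' b' c')"
      using square_relation_common_head [OF k ok(2)] ok(1) by simp
    then show ?thesis
      by (rule square_relation_flip_tail [OF path])
  qed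
qed

lemma square_relation_same_sides_tail:
  assumes k: "k \<ge> 1" and ok: "edge_ok k a b c" "edge_ok k a' b' c'"
    and tail: "orb a' b' (c' + 1) = orb a b (c + 1)"
  shows "square_relation (D_graph k) (D_weight k) (orbifold_cells k eps)
    (edge a b c) (edge a b c) (edge a' b' c') (edge a' b' c')"
proof -
  have s: "a' + b' + (c' + 1) = a + b + (c + 1)"
    using ok by (simp add: edge_ok_def)
  have path: "square_path (D_graph k) (edge a b c) (edge a b c) (edge a' b' c') (edge a' b' c')"
    using ok tail by (simp add: square_path_def)
  from tail consider "a = a'" "b = b'" "c = c'" | "a' = b" "b' = c + 1" "c' = a - 1" | "a = b'" "b = c' + 1" "c = a' - 1"
    unfolding orb_eq_iff [OF s] by linarith
  then show ?thesis
  proof cases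
    case 1
    then show ?thesis
      using square_relation_equal [OF k ok(1)] by simp
  next
    case 2
    then show ?thesis
      using square_relation_common_tail [OF k ok(1)] ok(2) by simp
  next
    case 3
    then have "square_relation (D_graph k) (D_weight k) (orbifold_cells k eps)
      (edge a' b' c') (edge a' b' c') (edge a b c) (edge a b c)"
      using square_relation_common_tail [OF k ok(2)] ok(1) by simp
    then show ?thesis
      by (rule square_relation_flip_head [OF path])
  qed
qed

text \<open>If the square is folded, one of the previous lemmas applies. Otherwise only the split vertices
  can contribute, they do so only if all four arcs are \<open>\<gamma>\<close> or \<open>\<gamma>'\<close>, and then the phases cancel.\<close>

lemma square_relation_edges:
  assumes k: "k \<ge> 1" and path: "square_path (D_graph k) \<alpha>1 \<alpha>2 \<alpha>3 \<alpha>4"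
    and e1: "\<alpha>1 = edge a1 b1 c1" and e2: "\<alpha>2 = edge a2 b2 c2" and e3: "\<alpha>3 = edge a3 b3 c3" and e4: "\<alpha>4 = edge a4 b4 c4"
  shows "square_relation (D_graph k) (D_weight k) (orbifold_cells k eps) \<alpha>1 \<alpha>2 \<alpha>3 \<alpha>4"
proof -
  let ?G = "D_graph k" and ?W = "orbifold_cells k eps"
  let ?Q = "quad_term ?G (D_weight k) ?W \<alpha>1 \<alpha>2 \<alpha>3 \<alpha>4"
  have ok: "edge_ok k a1 b1 c1" "edge_ok k a2 b2 c2" "edge_ok k a3 b3 c3" "edge_ok k a4 b4 c4"
    using path by (simp_all add: square_path_def e1 e2 e3 e4)
  consider (A) "\<alpha>1 = \<alpha>4" "\<alpha>2 = \<alpha>3" | (B) "\<alpha>1 = \<alpha>2" "\<alpha>3 = \<alpha>4"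
    | (C) "\<not> (\<alpha>1 = \<alpha>4 \<and> \<alpha>2 = \<alpha>3)" "\<not> (\<alpha>1 = \<alpha>2 \<and> \<alpha>3 = \<alpha>4)"
    by blast
  then show ?thesis
  proof cases
    case A
    have "orb (a2 + 1) b2 c2 = orb (a1 + 1) b1 c1"
      using path by (simp only: square_path_def head_D e1 e2 D_head_edge)
    from square_relation_same_sides_head [OF k ok(1,2) this] show ?thesis
      unfolding A(1) [symmetric] A(2) [symmetric] e1 e2 .
  next
    case B
    have "orb a3 b3 (c3 + 1) = orb a1 b1 (c1 + 1)"
    proof -
      have "D_tail k \<alpha>2 = D_tail k \<alpha>3"
        using path unfolding square_path_def tail_D by blast
      then have "D_tail k \<alpha>3 = D_tail k \<alpha>1"
        using B(1) by simp
      then show ?thesis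
        unfolding e1 e3 by simp
    qed
    from square_relation_same_sides_tail [OF k ok(1,3) this] show ?thesis
      unfolding B(1) [symmetric] B(2) [symmetric] e1 e3 .
  next
    case C
    have support: "{\<alpha>1, \<alpha>2, \<alpha>3, \<alpha>4} \<subseteq> {gamma_arc k, gamma'_arc k}
        \<and> (\<exists>i \<in> {1, 2, 3}. \<beta>1 = Into i \<and> \<beta>2 = Outof i \<and> \<beta>3 = Outof i \<and> \<beta>4 = Into i)"
      if q: "(\<beta>1, \<beta>2, \<beta>3, \<beta>4) \<in> closed_quads ?G \<alpha>1 \<alpha>2 \<alpha>3 \<alpha>4"
        "?W \<alpha>1 \<beta>1 \<beta>2 \<noteq> 0" "?W \<alpha>2 \<beta>1 \<beta>3 \<noteq> 0" "?W \<alpha>3 \<beta>4 \<beta>3 \<noteq> 0" "?W \<alpha>4 \<beta>4 \<beta>2 \<noteq> 0" for \<beta>1 \<beta>2 \<beta>3 \<beta>4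
    proof -
      note c = closed_quadsD [OF q(1)]
      note n = nonzero_completion [OF ok(1) c(1,2) q(2) [unfolded e1]] nonzero_completion [OF ok(2) c(1,3) q(3) [unfolded e2]]
        nonzero_completion [OF ok(3) c(4,3) q(4) [unfolded e3]] nonzero_completion [OF ok(4) c(4,2) q(5) [unfolded e4]]
      show ?thesis
      proof (cases "\<exists>x y z. \<beta>1 = edge x y z")
        case True
        then obtain x y z where \<beta>1: "\<beta>1 = edge x y z"
          by blast
        with completions_kind [OF n(1)] obtain u v w where "\<beta>2 = edge u v w"
          by auto
        with completions_kind [OF n(4)] obtain x' y' z' where \<beta>4: "\<beta>4 = edge x' y' z'"
          by auto
        have "edge_ok k x y z" "edge_ok k x' y' z'"
          using c(1,4) by (simp_all add: \<beta>1 \<beta>4)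
        from regular_square [OF this n(1,2) [unfolded \<beta>1] n(3,4) [unfolded \<beta>4]] C show ?thesis
          unfolding e1 e2 e3 e4 by argo
      next
        case False
        with completions_kind [OF n(1)] obtain i where i: "i \<in> {1, 2, 3}" "\<beta>1 = Into i" "\<beta>2 = Outof i"
          and 1: "\<alpha>1 \<in> {gamma_arc k, gamma'_arc k}"
          unfolding e1 by blast
        from completions_kind [OF n(2)] i(2) have \<beta>3: "\<beta>3 = Outof i" and 2: "\<alpha>2 \<in> {gamma_arc k, gamma'_arc k}"
          unfolding e2 by auto
        from completions_kind [OF n(3)] \<beta>3 have \<beta>4: "\<beta>4 = Into i" and 3: "\<alpha>3 \<in> {gamma_arc k, gamma'_arc k}"
          unfolding e3 by auto
        from completions_kind [OF n(4)] \<beta>4 have 4: "\<alpha>4 \<in> {gamma_arc k, gamma'_arc k}"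
          unfolding e4 by auto
        show ?thesis
          using i \<beta>3 \<beta>4 1 2 3 4 by blast
      qed
    qed
    have "sum ?Q (closed_quads ?G \<alpha>1 \<alpha>2 \<alpha>3 \<alpha>4) = 0"
    proof (cases "{\<alpha>1, \<alpha>2, \<alpha>3, \<alpha>4} \<subseteq> {gamma_arc k, gamma'_arc k}")
      case False
      have "sum ?Q (closed_quads ?G \<alpha>1 \<alpha>2 \<alpha>3 \<alpha>4) = sum ?Q {}"
        by (rule quad_sum_support [OF fin_digraph_D [OF k]]) (use support False in blast)+
      then show ?thesis
        by simp
    next
      case True
      have ends: "D_tail k \<alpha> = orb k (k - 1) (k + 1)" "D_head k \<alpha> = orb (k - 1) k (k + 1)"
        if "\<alpha> \<in> {\<alpha>1, \<alpha>2, \<alpha>3, \<alpha>4}" for \<alpha>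
        using that True gamma_ends [of k] by blast+
      have "sum ?Q (closed_quads ?G \<alpha>1 \<alpha>2 \<alpha>3 \<alpha>4) = sum ?Q ((\<lambda>i. (Into i, Outof i, Outof i, Into i)) ` {1, 2, 3})"
      proof (rule quad_sum_support [OF fin_digraph_D [OF k]])
        show "(\<lambda>i. (Into i, Outof i, Outof i, Into i)) ` {1, 2, 3} \<subseteq> closed_quads ?G \<alpha>1 \<alpha>2 \<alpha>3 \<alpha>4"
          using ends by (intro image_subsetI) (simp add: closed_quads_def)
      qed (use support in blast)
      also have "\<dots> = 0"
        unfolding quad_sum_split [OF k]
        by (subst eps_alternating_sum [OF _ _ _ _ C]) (use True in \<open>simp_all only: insert_subset mult_zero_right\<close>)
      finally show ?thesis .
    qed
    then show ?thesis
      unfolding square_relation_def if_not_P [OF C(1)] if_not_P [OF C(2)] by simp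
  qed
qed

section \<open>Squares through a split vertex\<close>

text \<open>The relation between the arcs at \<open>(k, k)\<^sub>i\<close> and \<open>(k, k)\<^sub>j\<close>. For \<open>i = j\<close> it is the type I relation
  squared. For \<open>i \<noteq> j\<close> the quotient \<open>s\<close> of the phases satisfies \<open>s\<^sup>2 + 1/s\<^sup>2 = -1\<close>, which produces
  the factor \<open>[k]\<^sup>2 + [k + 2]\<^sup>2 - [k][k + 2] = [k + 1]\<^sup>2\<close>; this is where the cube roots of unity are needed.\<close>

lemma spoke_gram:
  assumes k: "k \<ge> 1" and ij: "i \<in> {1, 2, 3}" "j \<in> {1, 2, 3}"
  defines "g \<equiv> split_cell k eps i (gamma_arc k) * cnj (split_cell k eps j (gamma_arc k))
      + split_cell k eps i (gamma'_arc k) * cnj (split_cell k eps j (gamma'_arc k))"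
    and "P \<equiv> orb_weight k k (k - 1) (k + 1)" and "C \<equiv> orb_weight k k k k / 3"
  shows "of_real (inverse P) * (g * cnj g) = of_real (P * C * (C + (if i = j then P else 0)))"
proof -
  have Ppos: "P > 0"
    unfolding P_def using k by (intro orb_weight_pos) auto
  define t where "t = qint (3 * k + 3) 2"
  have t: "t > 0"
    using q2_pos [OF k] by (simp add: t_def)
  show ?thesis
  proof (cases "i = j")
    case True
    have "g = of_real (t * P * C)"
      unfolding g_def True [symmetric] type_I_Into [OF k ij(1)] P_def C_def t_def split_weights(4,5) [OF k] ..
    then have "of_real (inverse P) * (g * cnj g) = of_real (inverse P * (t * P * C * (t * P * C)))"
      by simp
    also have "inverse P * (t * P * C * (t * P * C)) = P * C * (t\<^sup>2 * C)"
      using Ppos by (simp add: field_simps power2_eq_square)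
    also have "t\<^sup>2 * C = C + P"
    proof -
      have "t\<^sup>2 = qint (3 * k + 3) 3 + 1"
        using q_step [OF k, of 2] qint_1 [of "3 * k + 3"] k by (simp add: t_def power2_eq_square)
      moreover have "P = qint (3 * k + 3) 3 * C"
        using weight_eigen [OF k, of k k k] orb_weight_rotate [of k k "k - 1" "k + 1"] by (simp add: P_def C_def)
      ultimately show ?thesis
        by (simp add: distrib_right)
    qed
    finally show ?thesis
      using True by simp
  next
    case False
    define x y where "x = (tri_cell k (k - 1) k (k - 1))\<^sup>2 / 3" and "y = (tri_cell k k (k - 1) k)\<^sup>2 / 3"
    \<comment> \<open>The quotient of two different cube roots of unity, a primitive one.\<close>
    define s where "s = eps i * cnj (eps j)"
    have s: "s * cnj s = 1" "s * s + cnj s * cnj s = -1"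
      using ij False by (auto simp: s_def eps_values complex_eq_iff simp del: One_nat_def)
    have g: "g = s * of_real x + cnj s * of_real y"
      unfolding g_def s_def x_def y_def by (simp add: power2_eq_square algebra_simps flip: of_real_mult)
    have "g * cnj g = (s * cnj s) * (of_real x * of_real x + of_real y * of_real y) + (s * s + cnj s * cnj s) * (of_real x * of_real y)"
      unfolding g by (simp add: algebra_simps)
    also have "\<dots> = of_real (x * x + y * y - x * y)"
      unfolding s by simp
    finally have "of_real (inverse P) * (g * cnj g) = of_real (inverse P * (x * x + y * y - x * y))"
      by simp
    also have "inverse P * (x * x + y * y - x * y) = P * C * C"
    proof -
      define A B D where "A = qint (3 * k + 3) k" and "B = qint (3 * k + 3) (k + 1)" and "D = qint (3 * k + 3) (k + 2)"
      have pos: "A > 0" "B > 0" "D > 0"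
        unfolding A_def B_def D_def using k by (auto intro!: qint_pos)
      have e: "A\<^sup>2 + D\<^sup>2 - A * D = B\<^sup>2"
        using centre_identities(3) [OF k] by (simp add: A_def B_def D_def)
      have "x * x + y * y - x * y = A\<^sup>2 * B ^ 6 * D\<^sup>2 * (A\<^sup>2 + D\<^sup>2 - A * D) / (9 * t ^ 4)"
        unfolding x_def y_def split_weights [OF k] A_def [symmetric] B_def [symmetric] D_def [symmetric] t_def [symmetric]
        using t by (simp add: field_simps eval_nat_numeral)
      also have "\<dots> = P * (P * C * C)"
        unfolding e P_def C_def split_weights [OF k] A_def [symmetric] B_def [symmetric] D_def [symmetric] t_def [symmetric]
        using t by (simp add: field_simps eval_nat_numeral)
      finally show ?thesis
        using Ppos by (simp add: field_simps)
    qed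
    finally show ?thesis
      using False by simp
  qed
qed

lemma low_identity:
  assumes k: "k \<ge> 1"
  defines "P \<equiv> orb_weight k k (k - 1) (k + 1)"
  shows "inverse P * ((tri_cell k (k - 1) k (k - 1))\<^sup>2 / 3) * (tri_cell k (k - 1) (k - 1) (k + 1))\<^sup>2
    = P * (orb_weight k k k k / 3) * orb_weight k (k - 1) (k - 1) (k + 2)"
proof -
  have P: "P > 0"
    unfolding P_def using k by (intro orb_weight_pos) auto
  have "orb_weight k (k - 1) (k + 1) k = P" "orb_weight k k (k + 1) (k - 1) = P"
    by (simp_all add: P_def orb_weight_def mult_ac)
  moreover have "orb_weight k (k + 2) (k - 1) (k - 1) = orb_weight k (k - 1) (k - 1) (k + 2)"
    by (simp add: orb_weight_def mult_ac)
  moreover have "tri_cell k (k + 1) (k - 1) (k - 1) = tri_cell k (k - 1) (k - 1) (k + 1)" "tri_cell k k (k - 1) (k - 1) = tri_cell k (k - 1) k (k - 1)"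
    using tri_cell_rotate [of k "k + 1" "k - 1" "k - 1"] tri_cell_rotate [of k "k - 1" "k - 1" "k + 1"]
      tri_cell_rotate [of k k "k - 1" "k - 1"] by simp_all
  ultimately have "(tri_cell k (k - 1) (k - 1) (k + 1))\<^sup>2 * (tri_cell k (k - 1) k (k - 1))\<^sup>2
    = P * P * orb_weight k (k - 1) (k - 1) (k + 2) * orb_weight k k k k"
    using cell_pair_identity [OF k, of "k + 1" "k - 1" "k - 1"] k by (simp add: add.commute)
  then show ?thesis
    using P by (simp add: field_simps)
qed

lemma side_identity:
  assumes k: "k \<ge> 2"
  defines "P \<equiv> orb_weight k k (k - 1) (k + 1)"
  shows "inverse P * ((tri_cell k k (k - 1) k)\<^sup>2 / 3) * (tri_cell k (k - 2) k k)\<^sup>2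
    = P * (orb_weight k k k k / 3) * orb_weight k (k - 2) (k + 1) (k + 1)"
proof -
  have P: "P > 0"
    unfolding P_def using k by (intro orb_weight_pos) auto
  have "orb_weight k (k + 1) (k - 1) k = P"
    by (simp add: P_def orb_weight_def mult_ac)
  moreover have "orb_weight k (k + 1) (k + 1) (k - 2) = orb_weight k (k - 2) (k + 1) (k + 1)"
    by (simp add: orb_weight_def mult_ac)
  moreover have "tri_cell k (k - 1) k k = tri_cell k k (k - 1) k"
    using tri_cell_rotate [of k "k - 1" k k] tri_cell_rotate [of k k k "k - 1"] by simp
  ultimately have "(tri_cell k (k - 2) k k)\<^sup>2 * (tri_cell k k (k - 1) k)\<^sup>2
    = P * P * orb_weight k (k - 2) (k + 1) (k + 1) * orb_weight k k k k"
    using cell_pair_identity [of k "k - 1" k k] k P_def by (simp add: mult_ac)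
  then show ?thesis
    using P by (simp add: field_simps)
qed

lemma sum_four:
  fixes f :: "'a \<Rightarrow> complex"
  assumes "distinct [w, x, y, z]"
  shows "sum f {w, x, y, z} = f w + f x + f y + f z"
  using assms by (simp add: add.assoc)

lemma edges_from_inner:
  assumes k: "k \<ge> 1" and ok: "edge_ok k a b c" and tail: "orb a b (c + 1) = orb (k - 1) k (k + 1)"
  obtains "a = k" "b = k + 1" "c = k - 2" "k \<ge> 2" | "a = k + 1" "b = k - 1" "c = k - 1"
proof -
  have "edge a b c \<in> {edge (k - 1) k (k + 1 - 1), edge k (k + 1) (k - 1 - 1), edge (k + 1) (k - 1) (k - 1)}"
    using orb_eq_target [of "k - 1" k "k + 1" k a b c] ok tail by (simp add: edge_ok_def)
  then have "a = k \<and> b = k + 1 \<and> c = k - 2 \<or> a = k + 1 \<and> b = k - 1 \<and> c = k - 1"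
    using ok by (auto simp: edge_ok_def)
  moreover have "c \<ge> 0"
    using ok by (simp add: edge_ok_def)
  ultimately show thesis
    using that by auto
qed

lemma edges_into_inner:
  assumes k: "k \<ge> 1" and ok: "edge_ok k a b c" and head: "orb (a + 1) b c = orb k (k - 1) (k + 1)"
  obtains "a = k - 2" "b = k + 1" "c = k" "k \<ge> 2" | "a = k - 1" "b = k - 1" "c = k + 1"
proof -
  have "(a + 1) + b + c = k + (k - 1) + (k + 1)"
    using ok by (simp add: edge_ok_def)
  from head [unfolded orb_eq_iff [OF this]]
  have "a = k - 2 \<and> b = k + 1 \<and> c = k \<or> a = k - 1 \<and> b = k - 1 \<and> c = k + 1"
    using ok unfolding edge_ok_def by linarith
  moreover have "a \<ge> 0"
    using ok by (simp add: edge_ok_def)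
  ultimately show thesis
    using that by auto
qed

text \<open>The square starts with the arc into \<open>(k, k)\<^sub>i\<close> twice and continues with another arc \<open>\<delta>\<close> from
  \<open>(k - 1, k)\<close>. The common vertex is \<open>(k, k - 1)\<close>, and \<open>\<beta>2, \<beta>3\<close> range over \<open>\<gamma>, \<gamma>'\<close>. If \<open>\<delta>\<close> goes to a
  split vertex all four choices contribute, otherwise one.\<close>

lemma square_relation_Into:
  assumes k: "k \<ge> 1" and i: "i \<in> {1, 2, 3}" and \<delta>: "\<delta> \<in> arcs (D_graph k)" "D_tail k \<delta> = orb (k - 1) k (k + 1)"
  shows "square_relation (D_graph k) (D_weight k) (orbifold_cells k eps) (Into i) (Into i) \<delta> \<delta>"
proof -
  let ?G = "D_graph k" and ?W = "orbifold_cells k eps" and ?g = "gamma_arc k" and ?g' = "gamma'_arc k"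
  let ?Q = "quad_term ?G (D_weight k) ?W (Into i) (Into i) \<delta> \<delta>"
  define P C where "P = orb_weight k k (k - 1) (k + 1)" and "C = orb_weight k k k k / 3"
  have w: "D_weight k (orb k (k - 1) (k + 1)) = P" "D_weight k (orb (k - 1) k (k + 1)) = P" "\<And>l. D_weight k (Split l) = C"
    using k D_weight_orb [of k k "k - 1" "k + 1"] D_weight_orb [of k "k - 1" k "k + 1"] split_weights(4,5) [OF k] D_weight_Split [of k]
    by (simp_all add: P_def C_def del: eq_divide_eq_numeral1)
  have first: "\<beta>1 = Outof i" "\<beta>2 \<in> {?g, ?g'}" "\<beta>3 \<in> {?g, ?g'}" if "?W (Into i) \<beta>1 \<beta>2 \<noteq> 0" "?W (Into i) \<beta>1 \<beta>3 \<noteq> 0" for \<beta>1 \<beta>2 \<beta>3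
    using orbifold_cells_from_Into [OF that(1)] orbifold_cells_from_Into [OF that(2)] by blast+
  from \<delta>(1) show ?thesis
  proof (cases rule: arcs_D_cases)
    case (Into j)
    let ?v = "\<lambda>l. split_cell k eps l"
    let ?S = "{(Outof i, ?g, ?g, Outof j), (Outof i, ?g, ?g', Outof j), (Outof i, ?g', ?g, Outof j), (Outof i, ?g', ?g', Outof j)}"
    have "sum ?Q (closed_quads ?G (Into i) (Into i) \<delta> \<delta>) = sum ?Q ?S"
    proof (rule quad_sum_support [OF fin_digraph_D [OF k]])
      show "?S \<subseteq> closed_quads ?G (Into i) (Into i) \<delta> \<delta>"
        using i Into gamma_in_arcs [OF k] gamma_ends [of k] by (auto simp: closed_quads_def)
      fix \<beta>1 \<beta>2 \<beta>3 \<beta>4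
      assume "?W (Into i) \<beta>1 \<beta>2 \<noteq> 0" "?W (Into i) \<beta>1 \<beta>3 \<noteq> 0" "?W \<delta> \<beta>4 \<beta>3 \<noteq> 0"
      with first orbifold_cells_from_Into [of k eps j \<beta>4 \<beta>3] Into show "(\<beta>1, \<beta>2, \<beta>3, \<beta>4) \<in> ?S"
        by blast
    qed
    also have "\<dots> = of_real (inverse P) * ((?v i ?g * cnj (?v j ?g) + ?v i ?g' * cnj (?v j ?g')) * cnj (?v i ?g * cnj (?v j ?g) + ?v i ?g' * cnj (?v j ?g')))"
    proof -
      have "?Q (Outof i, \<xi>, \<xi>', Outof j) = of_real (inverse P) * (?v i \<xi> * cnj (?v i \<xi>') * ?v j \<xi>' * cnj (?v j \<xi>))" for \<xi> \<xi>'
        by (simp add: quad_term_def Into w mult.assoc)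
      then show ?thesis
        by (subst sum_four) (simp_all add: algebra_simps del: split_cell_gamma)
    qed
    also have "\<dots> = of_real (P * C * (C + (if i = j then P else 0)))"
      unfolding P_def C_def by (rule spoke_gram [OF k i Into(2)])
    finally show ?thesis
      unfolding square_relation_def Into(1) tail_D head_D D_tail_Into D_head.simps w
      by (cases "i = j") (simp_all add: algebra_simps)
  next
    case (edge a b c)
    have tail: "orb a b (c + 1) = orb (k - 1) k (k + 1)"
      using \<delta>(2) edge(1) by simp
    show ?thesis
    proof (cases rule: edges_from_inner [OF k edge(2) tail])
      case 1
      have e: "edge (k - 2) (k + 1) k = edge c (a + 1) (b - 1)" "?g' = edge (b - 1) (c + 1) a"
        using 1 by (simp_all add: gamma'_arc_edge)
      have out: "?g' \<noteq> edge c a b" "\<delta> \<noteq> ?g" "\<delta> \<noteq> ?g'" "?g \<noteq> edge c a b" "?g \<noteq> edge (b - 1) (c + 1) a"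
        using 1 by (simp_all add: edge(1) gamma_arc_edge gamma'_arc_edge)
      have n: "(edge (k - 2) (k + 1) k, ?g') \<in> completions k a b c"
        unfolding e completions_def using 1 out(2) edge(1) by (simp del: edge_eq_iff)
      have val: "?W \<delta> (edge (k - 2) (k + 1) k) ?g' = of_real (tri_cell k (k - 2) k k)"
        unfolding edge(1) e orbifold_cells_down using 1 tri_cell_rotate [of k k k "k - 2"] tri_cell_rotate [of k k "k - 2" k] by simp
      have "sum ?Q (closed_quads ?G (Into i) (Into i) \<delta> \<delta>) = sum ?Q {(Outof i, ?g', ?g', edge (k - 2) (k + 1) k)}"
      proof (rule quad_sum_support [OF fin_digraph_D [OF k]])
        show "{(Outof i, ?g', ?g', edge (k - 2) (k + 1) k)} \<subseteq> closed_quads ?G (Into i) (Into i) \<delta> \<delta>"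
          using i gamma_in_arcs [OF k] gamma_ends [of k] completions_closed [OF k edge(2) n] edge(1)
          by (simp add: closed_quads_def)
        fix \<beta>1 \<beta>2 \<beta>3 \<beta>4
        assume q: "(\<beta>1, \<beta>2, \<beta>3, \<beta>4) \<in> closed_quads ?G (Into i) (Into i) \<delta> \<delta>"
          "?W (Into i) \<beta>1 \<beta>2 \<noteq> 0" "?W (Into i) \<beta>1 \<beta>3 \<noteq> 0" "?W \<delta> \<beta>4 \<beta>3 \<noteq> 0" "?W \<delta> \<beta>4 \<beta>2 \<noteq> 0"
        note c = closed_quadsD [OF q(1)]
        have *: "\<beta>4 = edge (k - 2) (k + 1) k \<and> \<beta> = ?g'" if "(\<beta>4, \<beta>) \<in> completions k a b c" "\<beta> \<in> {?g, ?g'}" for \<beta>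
          using that(1)
          by (cases rule: completionsE) (use that(2) out edge(1) e gamma_ends in \<open>auto simp del: edge_eq_iff\<close>)
        show "(\<beta>1, \<beta>2, \<beta>3, \<beta>4) \<in> {(Outof i, ?g', ?g', edge (k - 2) (k + 1) k)}"
          using first [OF q(2,3)] * [OF nonzero_completion [OF edge(2) c(4,3) q(4) [unfolded edge(1)]]]
            * [OF nonzero_completion [OF edge(2) c(4,2) q(5) [unfolded edge(1)]]] by blast
      qed
      also have "\<dots> = of_real (inverse P) * (split_cell k eps i ?g' * cnj (split_cell k eps i ?g')) * of_real ((tri_cell k (k - 2) k k)\<^sup>2)"
        by (simp add: quad_term_def w val power2_eq_square del: split_cell_gamma)
      also have "\<dots> = of_real (inverse P * ((tri_cell k k (k - 1) k)\<^sup>2 / 3) * (tri_cell k (k - 2) k k)\<^sup>2)"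
        unfolding split_cell_gamma eps_norms [OF i] by (simp add: power_divide)
      also have "\<dots> = of_real (P * C * orb_weight k (k - 2) (k + 1) (k + 1))"
        unfolding P_def C_def side_identity [OF 1(4)] ..
      also have "orb_weight k (k - 2) (k + 1) (k + 1) = D_weight k (D_head k \<delta>)"
        using 1 edge(1) k D_weight_orb [of k "k + 1" "k + 1" "k - 2"] by (simp add: orb_weight_def mult_ac)
      finally show ?thesis
        unfolding square_relation_def using edge(1) by (simp add: w)
    next
      case 2
      have e: "edge (k - 1) (k - 1) (k + 1) = edge b c a" "?g = edge c a b"
        using 2 by (simp_all add: gamma_arc_edge)
      have out: "?g \<noteq> edge (b - 1) (c + 1) a" "\<delta> \<noteq> ?g" "\<delta> \<noteq> ?g'" "?g' \<noteq> edge c a b" "?g' \<noteq> edge (b - 1) (c + 1) a"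
        using 2 by (simp_all add: edge(1) gamma_arc_edge gamma'_arc_edge)
      have n: "(edge (k - 1) (k - 1) (k + 1), ?g) \<in> completions k a b c"
        unfolding e completions_def using out(3) edge(1) by (simp del: edge_eq_iff)
      have val: "?W \<delta> (edge (k - 1) (k - 1) (k + 1)) ?g = of_real (tri_cell k (k - 1) (k - 1) (k + 1))"
        unfolding edge(1) e orbifold_cells_up using 2 tri_cell_rotate [of k "k + 1" "k - 1" "k - 1"] tri_cell_rotate [of k "k - 1" "k - 1" "k + 1"] by simp
      have "sum ?Q (closed_quads ?G (Into i) (Into i) \<delta> \<delta>) = sum ?Q {(Outof i, ?g, ?g, edge (k - 1) (k - 1) (k + 1))}"
      proof (rule quad_sum_support [OF fin_digraph_D [OF k]])
        show "{(Outof i, ?g, ?g, edge (k - 1) (k - 1) (k + 1))} \<subseteq> closed_quads ?G (Into i) (Into i) \<delta> \<delta>"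
          using i gamma_in_arcs [OF k] gamma_ends [of k] completions_closed [OF k edge(2) n] edge(1)
          by (simp add: closed_quads_def)
        fix \<beta>1 \<beta>2 \<beta>3 \<beta>4
        assume q: "(\<beta>1, \<beta>2, \<beta>3, \<beta>4) \<in> closed_quads ?G (Into i) (Into i) \<delta> \<delta>"
          "?W (Into i) \<beta>1 \<beta>2 \<noteq> 0" "?W (Into i) \<beta>1 \<beta>3 \<noteq> 0" "?W \<delta> \<beta>4 \<beta>3 \<noteq> 0" "?W \<delta> \<beta>4 \<beta>2 \<noteq> 0"
        note c = closed_quadsD [OF q(1)]
        have *: "\<beta>4 = edge (k - 1) (k - 1) (k + 1) \<and> \<beta> = ?g" if "(\<beta>4, \<beta>) \<in> completions k a b c" "\<beta> \<in> {?g, ?g'}" for \<beta>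
          using that(1)
          by (cases rule: completionsE) (use that(2) out edge(1) e gamma_ends in \<open>auto simp del: edge_eq_iff\<close>)
        show "(\<beta>1, \<beta>2, \<beta>3, \<beta>4) \<in> {(Outof i, ?g, ?g, edge (k - 1) (k - 1) (k + 1))}"
          using first [OF q(2,3)] * [OF nonzero_completion [OF edge(2) c(4,3) q(4) [unfolded edge(1)]]]
            * [OF nonzero_completion [OF edge(2) c(4,2) q(5) [unfolded edge(1)]]] by blast
      qed
      also have "\<dots> = of_real (inverse P) * (split_cell k eps i ?g * cnj (split_cell k eps i ?g)) * of_real ((tri_cell k (k - 1) (k - 1) (k + 1))\<^sup>2)"
        by (simp add: quad_term_def w val power2_eq_square del: split_cell_gamma)
      also have "\<dots> = of_real (inverse P * ((tri_cell k (k - 1) k (k - 1))\<^sup>2 / 3) * (tri_cell k (k - 1) (k - 1) (k + 1))\<^sup>2)"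
        unfolding split_cell_gamma eps_norms [OF i] by (simp add: power_divide)
      also have "\<dots> = of_real (P * C * orb_weight k (k - 1) (k - 1) (k + 2))"
        unfolding P_def C_def low_identity [OF k] ..
      also have "orb_weight k (k - 1) (k - 1) (k + 2) = D_weight k (D_head k \<delta>)"
      proof -
        have "D_head k \<delta> = orb (k + 2) (k - 1) (k - 1)"
          using 2 edge(1) by (simp add: add.commute)
        moreover have "orb_weight k (k - 1) (k - 1) (k + 2) = orb_weight k (k + 2) (k - 1) (k - 1)"
          by (simp add: orb_weight_def mult_ac)
        ultimately show ?thesis
          using k D_weight_orb [of k "k + 2" "k - 1" "k - 1"] by simp
      qed
      finally show ?thesis
        unfolding square_relation_def using edge(1) by (simp add: w)
    qed
  next
    case (Outof j)
    then show ?thesis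
      using \<delta>(2) by simp
  qed
qed

text \<open>The mirror image of \<open>square_relation_Into\<close>, with common vertex \<open>(k - 1, k)\<close>.\<close>

lemma square_relation_Outof:
  assumes k: "k \<ge> 1" and i: "i \<in> {1, 2, 3}" and \<delta>: "\<delta> \<in> arcs (D_graph k)" "D_head k \<delta> = orb k (k - 1) (k + 1)"
  shows "square_relation (D_graph k) (D_weight k) (orbifold_cells k eps) (Outof i) \<delta> \<delta> (Outof i)"
proof -
  let ?G = "D_graph k" and ?W = "orbifold_cells k eps" and ?g = "gamma_arc k" and ?g' = "gamma'_arc k"
  let ?Q = "quad_term ?G (D_weight k) ?W (Outof i) \<delta> \<delta> (Outof i)"
  define P C where "P = orb_weight k k (k - 1) (k + 1)" and "C = orb_weight k k k k / 3"
  have w: "D_weight k (orb k (k - 1) (k + 1)) = P" "D_weight k (orb (k - 1) k (k + 1)) = P" "\<And>l. D_weight k (Split l) = C"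
    using k D_weight_orb [of k k "k - 1" "k + 1"] D_weight_orb [of k "k - 1" k "k + 1"] split_weights(4,5) [OF k] D_weight_Split [of k]
    by (simp_all add: P_def C_def del: eq_divide_eq_numeral1)
  have Wv: "?W (Outof l) \<xi> (Into l) = split_cell k eps l \<xi>" for l \<xi>
    using orbifold_cells_rotate [of k eps "Into l" "Outof l" \<xi>] by simp
  have last: "\<beta>2 = Into i" "\<beta>1 \<in> {?g, ?g'}" "\<beta>4 \<in> {?g, ?g'}" if "?W (Outof i) \<beta>1 \<beta>2 \<noteq> 0" "?W (Outof i) \<beta>4 \<beta>2 \<noteq> 0" for \<beta>1 \<beta>2 \<beta>4
    using orbifold_cells_from_Outof [OF that(1)] orbifold_cells_from_Outof [OF that(2)] by blast+
  from \<delta>(1) show ?thesis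
  proof (cases rule: arcs_D_cases)
    case (Outof j)
    let ?v = "\<lambda>l. split_cell k eps l"
    let ?S = "{(?g, Into i, Into j, ?g), (?g, Into i, Into j, ?g'), (?g', Into i, Into j, ?g), (?g', Into i, Into j, ?g')}"
    have "sum ?Q (closed_quads ?G (Outof i) \<delta> \<delta> (Outof i)) = sum ?Q ?S"
    proof (rule quad_sum_support [OF fin_digraph_D [OF k]])
      show "?S \<subseteq> closed_quads ?G (Outof i) \<delta> \<delta> (Outof i)"
        using i Outof gamma_in_arcs [OF k] gamma_ends [of k] by (auto simp: closed_quads_def)
      fix \<beta>1 \<beta>2 \<beta>3 \<beta>4
      assume "?W (Outof i) \<beta>1 \<beta>2 \<noteq> 0" "?W \<delta> \<beta>1 \<beta>3 \<noteq> 0" "?W (Outof i) \<beta>4 \<beta>2 \<noteq> 0"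
      with last orbifold_cells_from_Outof [of k eps j \<beta>1 \<beta>3] Outof show "(\<beta>1, \<beta>2, \<beta>3, \<beta>4) \<in> ?S"
        by blast
    qed
    also have "\<dots> = of_real (inverse P) * ((?v i ?g * cnj (?v j ?g) + ?v i ?g' * cnj (?v j ?g')) * cnj (?v i ?g * cnj (?v j ?g) + ?v i ?g' * cnj (?v j ?g')))"
    proof -
      have "?Q (\<xi>, Into i, Into j, \<xi>') = of_real (inverse P) * (?v i \<xi> * cnj (?v j \<xi>) * ?v j \<xi>' * cnj (?v i \<xi>'))" if "\<xi> \<in> {?g, ?g'}" for \<xi> \<xi>'
        using that gamma_ends [of k] by (auto simp: quad_term_def Outof w Wv mult.assoc)
      then show ?thesis
        by (subst sum_four) (simp_all add: algebra_simps del: split_cell_gamma)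
    qed
    also have "\<dots> = of_real (P * C * (C + (if i = j then P else 0)))"
      unfolding P_def C_def by (rule spoke_gram [OF k i Outof(2)])
    finally show ?thesis
      unfolding square_relation_def Outof(1) tail_D head_D D_head_Outof D_tail.simps w
      by (cases "i = j") (simp_all add: algebra_simps)
  next
    case (edge a b c)
    have head: "orb (a + 1) b c = orb k (k - 1) (k + 1)"
      using \<delta>(2) edge(1) by simp
    show ?thesis
    proof (cases rule: edges_into_inner [OF k edge(2) head])
      case 1
      have e: "edge k (k + 1) (k - 2) = edge (b - 1) (c + 1) a" "?g' = edge c (a + 1) (b - 1)"
        using 1 by (simp_all add: gamma_arc_edge gamma'_arc_edge)
      have out: "?g' \<noteq> edge b c a" "\<delta> \<noteq> ?g" "\<delta> \<noteq> ?g'" "?g \<noteq> edge b c a" "?g \<noteq> edge c (a + 1) (b - 1)"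
        using 1 by (simp_all add: edge(1) gamma_arc_edge gamma'_arc_edge)
      have n: "(?g', edge k (k + 1) (k - 2)) \<in> completions k a b c"
        unfolding e completions_def using 1 out(2) edge(1) by (simp del: edge_eq_iff)
      have val: "?W \<delta> ?g' (edge k (k + 1) (k - 2)) = of_real (tri_cell k (k - 2) k k)"
        unfolding edge(1) e orbifold_cells_down using 1 by simp
      have "sum ?Q (closed_quads ?G (Outof i) \<delta> \<delta> (Outof i)) = sum ?Q {(?g', Into i, edge k (k + 1) (k - 2), ?g')}"
      proof (rule quad_sum_support [OF fin_digraph_D [OF k]])
        show "{(?g', Into i, edge k (k + 1) (k - 2), ?g')} \<subseteq> closed_quads ?G (Outof i) \<delta> \<delta> (Outof i)"
          using i gamma_in_arcs [OF k] gamma_ends [of k] completions_closed [OF k edge(2) n] edge(1)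
          by (simp add: closed_quads_def)
        fix \<beta>1 \<beta>2 \<beta>3 \<beta>4
        assume q: "(\<beta>1, \<beta>2, \<beta>3, \<beta>4) \<in> closed_quads ?G (Outof i) \<delta> \<delta> (Outof i)"
          "?W (Outof i) \<beta>1 \<beta>2 \<noteq> 0" "?W \<delta> \<beta>1 \<beta>3 \<noteq> 0" "?W \<delta> \<beta>4 \<beta>3 \<noteq> 0" "?W (Outof i) \<beta>4 \<beta>2 \<noteq> 0"
        note c = closed_quadsD [OF q(1)]
        have *: "\<beta>3 = edge k (k + 1) (k - 2) \<and> \<beta> = ?g'" if "(\<beta>, \<beta>3) \<in> completions k a b c" "\<beta> \<in> {?g, ?g'}" for \<beta>
          using that(1)
          by (cases rule: completionsE) (use that(2) out edge(1) e in \<open>auto simp del: edge_eq_iff\<close>)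
        show "(\<beta>1, \<beta>2, \<beta>3, \<beta>4) \<in> {(?g', Into i, edge k (k + 1) (k - 2), ?g')}"
          using last [OF q(2,5)] * [OF nonzero_completion [OF edge(2) c(1,3) q(3) [unfolded edge(1)]]]
            * [OF nonzero_completion [OF edge(2) c(4,3) q(4) [unfolded edge(1)]]] by blast
      qed
      also have "\<dots> = of_real (inverse P) * (split_cell k eps i ?g' * cnj (split_cell k eps i ?g')) * of_real ((tri_cell k (k - 2) k k)\<^sup>2)"
        by (simp add: quad_term_def gamma_ends w Wv val power2_eq_square mult_ac del: split_cell_gamma)
      also have "\<dots> = of_real (inverse P * ((tri_cell k k (k - 1) k)\<^sup>2 / 3) * (tri_cell k (k - 2) k k)\<^sup>2)"
        unfolding split_cell_gamma eps_norms [OF i] by (simp add: power_divide)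
      also have "\<dots> = of_real (P * C * orb_weight k (k - 2) (k + 1) (k + 1))"
        unfolding P_def C_def side_identity [OF 1(4)] ..
      also have "orb_weight k (k - 2) (k + 1) (k + 1) = D_weight k (D_tail k \<delta>)"
        using 1 edge(1) k D_weight_orb [of k a b "c + 1"] by (simp add: add.commute)
      finally show ?thesis
        unfolding square_relation_def using edge(1) by (simp add: w mult_ac)
    next
      case 2
      have e: "edge (k + 1) (k - 1) (k - 1) = edge c a b" "?g = edge b c a"
        using 2 by (simp_all add: gamma_arc_edge gamma'_arc_edge)
      have out: "?g \<noteq> edge c (a + 1) (b - 1)" "\<delta> \<noteq> ?g" "\<delta> \<noteq> ?g'" "?g' \<noteq> edge b c a" "?g' \<noteq> edge c (a + 1) (b - 1)"
        using 2 by (simp_all add: edge(1) gamma_arc_edge gamma'_arc_edge)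
      have n: "(?g, edge (k + 1) (k - 1) (k - 1)) \<in> completions k a b c"
        unfolding e completions_def using out(3) edge(1) by (simp del: edge_eq_iff)
      have val: "?W \<delta> ?g (edge (k + 1) (k - 1) (k - 1)) = of_real (tri_cell k (k - 1) (k - 1) (k + 1))"
        unfolding edge(1) e orbifold_cells_up using 2 by simp
      have "sum ?Q (closed_quads ?G (Outof i) \<delta> \<delta> (Outof i)) = sum ?Q {(?g, Into i, edge (k + 1) (k - 1) (k - 1), ?g)}"
      proof (rule quad_sum_support [OF fin_digraph_D [OF k]])
        show "{(?g, Into i, edge (k + 1) (k - 1) (k - 1), ?g)} \<subseteq> closed_quads ?G (Outof i) \<delta> \<delta> (Outof i)"
          using i gamma_in_arcs [OF k] gamma_ends [of k] completions_closed [OF k edge(2) n] edge(1)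
          by (simp add: closed_quads_def)
        fix \<beta>1 \<beta>2 \<beta>3 \<beta>4
        assume q: "(\<beta>1, \<beta>2, \<beta>3, \<beta>4) \<in> closed_quads ?G (Outof i) \<delta> \<delta> (Outof i)"
          "?W (Outof i) \<beta>1 \<beta>2 \<noteq> 0" "?W \<delta> \<beta>1 \<beta>3 \<noteq> 0" "?W \<delta> \<beta>4 \<beta>3 \<noteq> 0" "?W (Outof i) \<beta>4 \<beta>2 \<noteq> 0"
        note c = closed_quadsD [OF q(1)]
        have *: "\<beta>3 = edge (k + 1) (k - 1) (k - 1) \<and> \<beta> = ?g" if "(\<beta>, \<beta>3) \<in> completions k a b c" "\<beta> \<in> {?g, ?g'}" for \<beta>
          using that(1)
          by (cases rule: completionsE) (use that(2) out edge(1) e in \<open>auto simp del: edge_eq_iff\<close>)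
        show "(\<beta>1, \<beta>2, \<beta>3, \<beta>4) \<in> {(?g, Into i, edge (k + 1) (k - 1) (k - 1), ?g)}"
          using last [OF q(2,5)] * [OF nonzero_completion [OF edge(2) c(1,3) q(3) [unfolded edge(1)]]]
            * [OF nonzero_completion [OF edge(2) c(4,3) q(4) [unfolded edge(1)]]] by blast
      qed
      also have "\<dots> = of_real (inverse P) * (split_cell k eps i ?g * cnj (split_cell k eps i ?g)) * of_real ((tri_cell k (k - 1) (k - 1) (k + 1))\<^sup>2)"
        by (simp add: quad_term_def gamma_ends w Wv val power2_eq_square mult_ac del: split_cell_gamma)
      also have "\<dots> = of_real (inverse P * ((tri_cell k (k - 1) k (k - 1))\<^sup>2 / 3) * (tri_cell k (k - 1) (k - 1) (k + 1))\<^sup>2)"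
        unfolding split_cell_gamma eps_norms [OF i] by (simp add: power_divide)
      also have "\<dots> = of_real (P * C * orb_weight k (k - 1) (k - 1) (k + 2))"
        unfolding P_def C_def low_identity [OF k] ..
      also have "orb_weight k (k - 1) (k - 1) (k + 2) = D_weight k (D_tail k \<delta>)"
        using 2 edge(1) k D_weight_orb [of k a b "c + 1"] by (simp add: add.commute)
      finally show ?thesis
        unfolding square_relation_def using edge(1) by (simp add: w mult_ac)
    qed
  next
    case (Into j)
    then show ?thesis
      using \<delta>(2) by simp
  qed
qed

lemma square_relation_split:
  assumes k: "k \<ge> 1" and path: "square_path (D_graph k) \<alpha>1 \<alpha>2 \<alpha>3 \<alpha>4" and "\<alpha>1 = Into i \<or> \<alpha>1 = Outof i"
  shows "square_relation (D_graph k) (D_weight k) (orbifold_cells k eps) \<alpha>1 \<alpha>2 \<alpha>3 \<alpha>4"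
proof -
  have a: "\<alpha>1 \<in> arcs (D_graph k)" "\<alpha>2 \<in> arcs (D_graph k)" "\<alpha>3 \<in> arcs (D_graph k)" "\<alpha>4 \<in> arcs (D_graph k)"
    and ends: "D_head k \<alpha>1 = D_head k \<alpha>2" "D_tail k \<alpha>2 = D_tail k \<alpha>3" "D_head k \<alpha>3 = D_head k \<alpha>4" "D_tail k \<alpha>4 = D_tail k \<alpha>1"
    using path unfolding square_path_def tail_D head_D by blast+
  have ne: "orb k (k - 1) (k + 1) \<noteq> orb (k - 1) k (k + 1)"
    by (subst orb_eq_iff) auto
  from assms(3) show ?thesis
  proof
    assume 1: "\<alpha>1 = Into i"
    from a(2) have 2: "\<alpha>2 = Into i"
      by (cases rule: arcs_D_cases) (use 1 ends(1) in auto)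
    have t: "D_tail k \<alpha>3 = orb (k - 1) k (k + 1)" "D_tail k \<alpha>4 = orb (k - 1) k (k + 1)"
      using ends(2,4) 1 2 by simp_all
    then have "\<alpha>3 = \<alpha>4"
      using parallel_arcs [OF a(3,4) _ ends(3)] gamma_ends [of k] ne by metis
    then show ?thesis
      using square_relation_Into [OF k _ a(3) t(1), of i] a(1) 1 2 by simp
  next
    assume 1: "\<alpha>1 = Outof i"
    from a(4) have 4: "\<alpha>4 = Outof i"
      by (cases rule: arcs_D_cases) (use 1 ends(4) in auto)
    have h: "D_head k \<alpha>2 = orb k (k - 1) (k + 1)" "D_head k \<alpha>3 = orb k (k - 1) (k + 1)"
      using ends(1,3) 1 4 by simp_all
    then have "\<alpha>2 = \<alpha>3"
      using parallel_arcs [OF a(2,3) ends(2)] gamma_ends [of k] ne by metis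
    then show ?thesis
      using square_relation_Outof [OF k _ a(2) h(1), of i] a(1) 1 4 by simp
  qed
qed

lemma cell_type_II_orbifold:
  assumes k: "k \<ge> 1"
  shows "cell_type_II (D_graph k) (D_weight k) (orbifold_cells k eps)"
proof (rule cell_type_II_intro [OF fin_digraph_D [OF k]])
  fix \<alpha>1 \<alpha>2 \<alpha>3 \<alpha>4
  assume path: "square_path (D_graph k) \<alpha>1 \<alpha>2 \<alpha>3 \<alpha>4"
  have kind: "(\<exists>a b c. \<alpha> = edge a b c) \<or> (\<exists>i. \<alpha> = Into i \<or> \<alpha> = Outof i)" if "\<alpha> \<in> arcs (D_graph k)" for \<alpha>
    using that by (cases rule: arcs_D_cases) blast+
  have a: "\<alpha>1 \<in> arcs (D_graph k)" "\<alpha>2 \<in> arcs (D_graph k)" "\<alpha>3 \<in> arcs (D_graph k)" "\<alpha>4 \<in> arcs (D_graph k)"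
    using path unfolding square_path_def by blast+
  note flip = square_path_flip [OF path]
  consider i where "\<alpha>1 = Into i \<or> \<alpha>1 = Outof i" | i where "\<alpha>2 = Into i \<or> \<alpha>2 = Outof i"
    | i where "\<alpha>3 = Into i \<or> \<alpha>3 = Outof i" | i where "\<alpha>4 = Into i \<or> \<alpha>4 = Outof i"
    | (edges) "\<exists>a b c. \<alpha>1 = edge a b c" "\<exists>a b c. \<alpha>2 = edge a b c" "\<exists>a b c. \<alpha>3 = edge a b c" "\<exists>a b c. \<alpha>4 = edge a b c"
    using kind [OF a(1)] kind [OF a(2)] kind [OF a(3)] kind [OF a(4)] by metis
  then show "square_relation (D_graph k) (D_weight k) (orbifold_cells k eps) \<alpha>1 \<alpha>2 \<alpha>3 \<alpha>4"
  proof cases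
    case 1
    then show ?thesis
      by (rule square_relation_split [OF k path])
  next
    case 2
    then show ?thesis
      by (rule square_relation_flip_tail [OF path square_relation_split [OF k flip(2)]])
  next
    case 3
    then show ?thesis
      by (rule square_relation_flip_head [OF path square_relation_flip_tail [OF flip(1)
            square_relation_split [OF k square_path_flip(2) [OF flip(1)]]]])
  next
    case 4
    then show ?thesis
      by (rule square_relation_flip_head [OF path square_relation_split [OF k flip(1)]])
  next
    case edges
    then show ?thesis
      using square_relation_edges [OF k path] by blast
  qed
qed

theorem cell_system_orbifold:
  assumes k: "k \<ge> 1"
  shows "cell_system (3 * k + 3) (D_graph k) (D_weight k) (orbifold_cells k eps)"
  unfolding cell_system_def
  using fin_digraph_D [OF k] perron_frobenius_D [OF k] cell_type_I_orbifold [OF k] cell_type_II_orbifold [OF k]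
    orbifold_cells_rotate by blast

section \<open>The standard cells form an orbifold solution\<close>

lemma D_cell_up:
  assumes "a + b + c = 3 * k - 1"
  shows "D_cell k W (a, b) (a + 1, b) (a, b + 1) = W (edge a b c) (edge b c a) (edge c a b)"
  using D_arc_east [of a b "c + 1" k] D_arc_northwest [of "a + 1" b c k] D_arc_south [of a "b + 1" c k] assms
  by (simp add: D_cell_def)

lemma D_cell_down:
  assumes "a + b + c = 3 * k - 2"
  shows "D_cell k W (a + 1, b) (a, b + 1) (a + 1, b + 1) = W (edge b (c + 1) a) (edge a (b + 1) c) (edge c (a + 1) b)"
  using D_arc_northwest [of "a + 1" b "c + 1" k] D_arc_east [of a "b + 1" "c + 1" k] D_arc_south [of "a + 1" "b + 1" c k] assms
  by (simp add: D_cell_def)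

lemma cell_low_eq: "cell_low k W \<xi> = W (edge (k - 1) (k - 1) (k + 1)) \<xi> (edge (k + 1) (k - 1) (k - 1))"
  using D_arc_east [of "k - 1" "k - 1" "k + 2" k] D_arc_south [of "k - 1" k "k + 1" k]
  by (simp add: cell_low_def add.commute)

lemma cell_side_eq: "cell_side k W \<xi> = W (edge (k - 2) (k + 1) k) \<xi> (edge k (k + 1) (k - 2))"
  using D_arc_northwest [of "k + 1" "k - 2" "k + 1" k] D_arc_south [of "k + 1" "k - 1" k k]
  by (simp add: cell_side_def add.commute)

lemma A_cell_up_eq:
  assumes "k \<ge> 1" "a + b + c = 3 * k - 1"
  shows "A_cell_up (3 * k + 3) a b = tri_cell k a b c"
proof -
  have refl: "qint (3 * k + 3) ((3 * k + 3) - m) = qint (3 * k + 3) m" for m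
    using assms(1) by (intro qint_reflect) simp
  have "a + b + 2 = (3 * k + 3) - (c + 2)" "a + b + 3 = (3 * k + 3) - (c + 1)"
    using assms(2) by linarith+
  then have "qint (3 * k + 3) (a + b + 2) = qint (3 * k + 3) (c + 2)" "qint (3 * k + 3) (a + b + 3) = qint (3 * k + 3) (c + 1)"
    by (simp_all only: refl)
  then show ?thesis
    unfolding A_cell_up_def tri_cell_def by (simp add: mult_ac)
qed

lemma A_cell_down_eq:
  assumes "k \<ge> 1" "a + b + c = 3 * k - 2"
  shows "A_cell_down (3 * k + 3) a b = tri_cell k a b c"
proof -
  have refl: "qint (3 * k + 3) ((3 * k + 3) - m) = qint (3 * k + 3) m" for m
    using assms(1) by (intro qint_reflect) simp
  have "a + b + 3 = (3 * k + 3) - (c + 2)" "a + b + 4 = (3 * k + 3) - (c + 1)"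
    using assms(2) by linarith+
  then have "qint (3 * k + 3) (a + b + 3) = qint (3 * k + 3) (c + 2)" "qint (3 * k + 3) (a + b + 4) = qint (3 * k + 3) (c + 1)"
    by (simp_all only: refl)
  then show ?thesis
    unfolding A_cell_down_def tri_cell_def by (simp add: mult_ac)
qed

lemma off_centre_up_iff:
  assumes "a + b + c = 3 * k - 1"
  shows "off_centre k {(a, b), (a + 1, b), (a, b + 1)} \<longleftrightarrow> edge_ok k a b c \<and> edge_ok k b c a \<and> edge_ok k c a b"
proof -
  have eqs: "(b = k \<and> c = k) = (a = k - 1 \<and> b = k)" "(b = k - 1 \<and> c = k) = (a = k \<and> b = k - 1)"
    "(c = k \<and> a = k) = (a = k \<and> b = k - 1)" "(c = k - 1 \<and> a = k) = (a = k \<and> b = k)"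
    "(c \<ge> 0) = (a + b \<le> 3 * k - 1)" "(k = a + 1 \<and> k = b) = (a = k - 1 \<and> b = k)" "(k = a \<and> k = b + 1) = (a = k \<and> b = k - 1)"
    "(k = a \<and> k = b) = (a = k \<and> b = k)"
    using assms by linarith+
  have sums: "b + c + a = 3 * k - 1" "c + a + b = 3 * k - 1" "a + b + c = 3 * k - 1"
    using assms by linarith+
  have "off_centre k {(a, b), (a + 1, b), (a, b + 1)} \<longleftrightarrow> a \<ge> 0 \<and> b \<ge> 0 \<and> a + b \<le> 3 * k - 1
      \<and> \<not> (k = a \<and> k = b) \<and> \<not> (k = a + 1 \<and> k = b) \<and> \<not> (k = a \<and> k = b + 1)"
    unfolding off_centre_def A_graph_def A_verts_def by (simp, linarith)
  then show ?thesis
    unfolding edge_ok_def eqs using sums by blast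
qed

lemma off_centre_down_iff:
  assumes "a + b + c = 3 * k - 2"
  shows "off_centre k {(a + 1, b), (a, b + 1), (a + 1, b + 1)}
    \<longleftrightarrow> edge_ok k b (c + 1) a \<and> edge_ok k a (b + 1) c \<and> edge_ok k c (a + 1) b"
proof -
  have eqs: "(b = k \<and> c + 1 = k) = (a = k - 1 \<and> b = k)" "(b = k - 1 \<and> c + 1 = k) = (a = k \<and> b = k - 1)"
    "(a = k \<and> b + 1 = k) = (a = k \<and> b = k - 1)" "(a = k - 1 \<and> b + 1 = k) = (a = k - 1 \<and> b = k - 1)"
    "(c = k \<and> a + 1 = k) = (a = k - 1 \<and> b = k - 1)" "(c = k - 1 \<and> a + 1 = k) = (a = k - 1 \<and> b = k)"
    "(k = a + 1 \<and> k = b) = (a = k - 1 \<and> b = k)" "(k = a \<and> k = b + 1) = (a = k \<and> b = k - 1)"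
    "(k = a + 1 \<and> k = b + 1) = (a = k - 1 \<and> b = k - 1)"
    using assms by linarith+
  have sums: "b + (c + 1) + a = 3 * k - 1" "c + (a + 1) + b = 3 * k - 1" "a + (b + 1) + c = 3 * k - 1"
    using assms by linarith+
  have ineq: "b \<ge> 0 \<and> c + 1 \<ge> 0 \<and> a \<ge> 0 \<and> a \<ge> 0 \<and> b + 1 \<ge> 0 \<and> c \<ge> 0 \<and> c \<ge> 0 \<and> a + 1 \<ge> 0 \<and> b \<ge> 0
      \<longleftrightarrow> a \<ge> 0 \<and> b \<ge> 0 \<and> a + b \<le> 3 * k - 2"
    using assms by linarith
  have "off_centre k {(a + 1, b), (a, b + 1), (a + 1, b + 1)} \<longleftrightarrow> (a \<ge> 0 \<and> b \<ge> 0 \<and> a + b \<le> 3 * k - 2)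
      \<and> \<not> (k = a + 1 \<and> k = b) \<and> \<not> (k = a \<and> k = b + 1) \<and> \<not> (k = a + 1 \<and> k = b + 1)"
    unfolding off_centre_def A_graph_def A_verts_def by (simp, linarith)
  then show ?thesis
    unfolding edge_ok_def eqs ineq [symmetric] using sums by blast
qed

lemma orbifold_cells_down':
  "orbifold_cells k e (edge b (c + 1) a) (edge a (b + 1) c) (edge c (a + 1) b) = of_real (tri_cell k a b c)"
  using orbifold_cells_down [of k e b "c + 1" a] tri_cell_rotate [of k b c a] by simp

lemma tri_cell_eqI:
  assumes "k \<ge> 1" "a \<ge> 0" "b \<ge> 0" "c \<ge> 0" "a \<le> 3 * k" "b \<le> 3 * k" "c \<le> 3 * k" "r \<ge> 0" "(tri_cell k a b c)\<^sup>2 = r\<^sup>2"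
  shows "tri_cell k a b c = r"
  by (rule power2_eq_imp_eq [OF assms(9) _ assms(8)]) (rule less_imp_le [OF tri_cell_pos [OF assms(1-7)]])

lemma square_times_sqrt: "X \<ge> 0 \<Longrightarrow> (y * sqrt X / z)\<^sup>2 = y\<^sup>2 * X / (z :: real)\<^sup>2"
  by (simp add: power_mult_distrib power_divide)

text \<open>The product form of the cells next to the centre. Both sides are nonnegative, so it suffices to
  compare squares.\<close>

lemma special_cells:
  assumes k: "k \<ge> 1"
  defines "Q \<equiv> qint (3 * k + 3)"
  shows "tri_cell k (k - 1) k (k - 1) = Q k * sqrt (Q (k + 1) ^ 3 * Q (k + 2)) / Q 2"
    "tri_cell k k (k - 1) k = Q (k + 2) * sqrt (Q k * Q (k + 1) ^ 3) / Q 2"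
    "tri_cell k (k - 1) (k - 1) (k + 1) = Q k * Q (k + 1) * sqrt (Q (k + 2) * Q (k + 3)) / Q 2"
    "k \<noteq> 1 \<Longrightarrow> tri_cell k (k - 2) k k = Q (k + 1) * Q (k + 2) * sqrt (Q (k - 1) * Q k) / Q 2"
proof -
  have pos: "Q k \<ge> 0" "Q (k + 1) \<ge> 0" "Q (k + 2) \<ge> 0" "Q (k + 3) \<ge> 0" "Q 2 \<ge> 0" "Q (k - 1) \<ge> 0"
    unfolding Q_def using k by (intro q_nonneg; linarith)+
  note nonneg = divide_nonneg_nonneg mult_nonneg_nonneg real_sqrt_ge_zero zero_le_power pos
  show "tri_cell k (k - 1) k (k - 1) = Q k * sqrt (Q (k + 1) ^ 3 * Q (k + 2)) / Q 2"
  proof (rule tri_cell_eqI [OF k])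
    show "(tri_cell k (k - 1) k (k - 1))\<^sup>2 = (Q k * sqrt (Q (k + 1) ^ 3 * Q (k + 2)) / Q 2)\<^sup>2"
      unfolding split_weights(1) [OF k, folded Q_def] using pos by (subst square_times_sqrt) simp_all
  qed ((use k in linarith)+, intro nonneg)
  show "tri_cell k k (k - 1) k = Q (k + 2) * sqrt (Q k * Q (k + 1) ^ 3) / Q 2"
  proof (rule tri_cell_eqI [OF k])
    show "(tri_cell k k (k - 1) k)\<^sup>2 = (Q (k + 2) * sqrt (Q k * Q (k + 1) ^ 3) / Q 2)\<^sup>2"
      unfolding split_weights(2) [OF k, folded Q_def] using pos by (subst square_times_sqrt) simp_all
  qed ((use k in linarith)+, intro nonneg)
  show "tri_cell k (k - 1) (k - 1) (k + 1) = Q k * Q (k + 1) * sqrt (Q (k + 2) * Q (k + 3)) / Q 2"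
  proof (rule tri_cell_eqI [OF k])
    have "(tri_cell k (k - 1) (k - 1) (k + 1))\<^sup>2 = (Q k * Q (k + 1))\<^sup>2 * (Q (k + 2) * Q (k + 3)) / (Q 2)\<^sup>2"
      using tri_cell_square [OF k, of "k - 1" "k - 1" "k + 1"] k
      by (simp add: Q_def power2_eq_square add.commute mult_ac)
    then show "(tri_cell k (k - 1) (k - 1) (k + 1))\<^sup>2 = (Q k * Q (k + 1) * sqrt (Q (k + 2) * Q (k + 3)) / Q 2)\<^sup>2"
      using pos by (subst square_times_sqrt) simp_all
  qed ((use k in linarith)+, intro nonneg)
  assume "k \<noteq> 1"
  then have k2: "k \<ge> 2"
    using k by simp
  show "tri_cell k (k - 2) k k = Q (k + 1) * Q (k + 2) * sqrt (Q (k - 1) * Q k) / Q 2"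
  proof (rule tri_cell_eqI [OF k])
    have "(tri_cell k (k - 2) k k)\<^sup>2 = (Q (k + 1) * Q (k + 2))\<^sup>2 * (Q (k - 1) * Q k) / (Q 2)\<^sup>2"
      using tri_cell_square [OF k, of "k - 2" k k] k2
      by (simp add: Q_def power2_eq_square mult_ac)
    then show "(tri_cell k (k - 2) k k)\<^sup>2 = (Q (k + 1) * Q (k + 2) * sqrt (Q (k - 1) * Q k) / Q 2)\<^sup>2"
      using pos by (subst square_times_sqrt) simp_all
  qed ((use k2 in linarith)+, intro nonneg)
qed

lemma orbifold_cells_zero:
  "cell_low k (orbifold_cells k e) (gamma'_arc k) = 0" "cell_side k (orbifold_cells k e) (gamma_arc k) = 0"
  unfolding cell_low_eq cell_side_eq gamma_arc_edge gamma'_arc_edge orbifold_cells_edges by simp_all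

lemma orbifold_cells_low: "cell_low k (orbifold_cells k e) (gamma_arc k) = of_real (tri_cell k (k - 1) (k - 1) (k + 1))"
  unfolding cell_low_eq gamma_arc_edge by (rule orbifold_cells_up)

lemma orbifold_cells_side: "cell_side k (orbifold_cells k e) (gamma'_arc k) = of_real (tri_cell k (k - 2) k k)"
  using orbifold_cells_down [of k e "k - 2" "k + 1" k] unfolding cell_side_eq gamma'_arc_edge by simp

lemma orbifold_cells_A:
  assumes k: "k \<ge> 1"
  shows "D_cell k (orbifold_cells k e) (a, b) (a + 1, b) (a, b + 1) = of_real (A_cell_up (3 * k + 3) a b)"
    "D_cell k (orbifold_cells k e) (a + 1, b) (a, b + 1) (a + 1, b + 1) = of_real (A_cell_down (3 * k + 3) a b)"
proof -
  have up: "a + b + (3 * k - 1 - a - b) = 3 * k - 1" and down: "a + b + (3 * k - 2 - a - b) = 3 * k - 2"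
    by simp_all
  show "D_cell k (orbifold_cells k e) (a, b) (a + 1, b) (a, b + 1) = of_real (A_cell_up (3 * k + 3) a b)"
    unfolding D_cell_up [OF up] A_cell_up_eq [OF k up] by (rule orbifold_cells_up)
  show "D_cell k (orbifold_cells k e) (a + 1, b) (a, b + 1) (a + 1, b + 1) = of_real (A_cell_down (3 * k + 3) a b)"
    unfolding D_cell_down [OF down] A_cell_down_eq [OF k down] by (rule orbifold_cells_down')
qed

lemma standard_orbifold_cells:
  assumes k: "k \<ge> 1"
  shows "standard_cells k (orbifold_cells k eps)"
  unfolding standard_cells_def Let_def cell_split_def orbifold_cells_zero orbifold_cells_low orbifold_cells_side
    orbifold_cells_A [OF k] orbifold_cells.simps(2) split_cell_gamma
  using special_cells [OF k] by (simp add: mult_ac)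

lemma orbifold_solution_orbifold_cells:
  assumes k: "k \<ge> 1"
  shows "orbifold_solution k (orbifold_cells k eps)"
proof -
  have u: "cmod (eps i) = 1" if "i \<in> {1, 2, 3}" for i
  proof -
    have "(cmod (eps i))\<^sup>2 = 1"
      using eps_unimodular [OF that] by (metis complex_norm_square of_real_eq_1_iff)
    then show ?thesis
      by (simp add: power2_eq_1_iff) (smt (verit) norm_ge_zero)
  qed
  have "(cmod (cell_split k (orbifold_cells k eps) (gamma_arc k) i))\<^sup>2 = (tri_cell k (k - 1) k (k - 1))\<^sup>2 / 3"
    "(cmod (cell_split k (orbifold_cells k eps) (gamma'_arc k) i))\<^sup>2 = (tri_cell k k (k - 1) k)\<^sup>2 / 3" if "i \<in> {1, 2, 3}" for i
    using u [OF that] by (simp_all add: cell_split_def norm_mult norm_divide power_divide)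
  then show ?thesis
    unfolding orbifold_solution_def Let_def orbifold_cells_zero orbifold_cells_A [OF k]
    using cell_system_orbifold [OF k] split_weights [OF k] by (simp add: mult_ac)
qed

text \<open>The right-hand sides of the relations are real.\<close>

lemma cell_system_conj:
  assumes "cell_system n G \<phi> W"
  shows "cell_system n G \<phi> (conj_cells W)"
proof -
  have cnj_if: "cnj (if b then of_real x else 0) = (if b then of_real x else 0)" for b x
    by simp
  have I: "cell_type_I n G \<phi> (conj_cells W)"
    unfolding cell_type_I_def
  proof (intro ballI)
    fix i j \<alpha> \<alpha>'
    assume "i \<in> verts G" "j \<in> verts G" "\<alpha> \<in> arcs_between G i j" "\<alpha>' \<in> arcs_between G i j"
    then have e: "(\<Sum>k \<in> verts G. \<Sum>\<beta> \<in> arcs_between G j k. \<Sum>\<gamma> \<in> arcs_between G k i. W \<alpha> \<beta> \<gamma> * cnj (W \<alpha>' \<beta> \<gamma>))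
      = (if \<alpha> = \<alpha>' then of_real (qint n 2 * \<phi> i * \<phi> j) else 0)"
      using assms unfolding cell_system_def cell_type_I_def by blast
    have "(\<Sum>k \<in> verts G. \<Sum>\<beta> \<in> arcs_between G j k. \<Sum>\<gamma> \<in> arcs_between G k i. conj_cells W \<alpha> \<beta> \<gamma> * cnj (conj_cells W \<alpha>' \<beta> \<gamma>))
      = cnj (\<Sum>k \<in> verts G. \<Sum>\<beta> \<in> arcs_between G j k. \<Sum>\<gamma> \<in> arcs_between G k i. W \<alpha> \<beta> \<gamma> * cnj (W \<alpha>' \<beta> \<gamma>))"
      by (simp add: conj_cells_def)
    then show "(\<Sum>k \<in> verts G. \<Sum>\<beta> \<in> arcs_between G j k. \<Sum>\<gamma> \<in> arcs_between G k i. conj_cells W \<alpha> \<beta> \<gamma> * cnj (conj_cells W \<alpha>' \<beta> \<gamma>))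
      = (if \<alpha> = \<alpha>' then of_real (qint n 2 * \<phi> i * \<phi> j) else 0)"
      unfolding e cnj_if .
  qed
  have II: "cell_type_II G \<phi> (conj_cells W)"
    unfolding cell_type_II_def
  proof (intro ballI)
    fix i1 i2 i3 i4 \<alpha>1 \<alpha>2 \<alpha>3 \<alpha>4
    assume "i1 \<in> verts G" "i2 \<in> verts G" "i3 \<in> verts G" "i4 \<in> verts G" "\<alpha>1 \<in> arcs_between G i1 i2"
      "\<alpha>2 \<in> arcs_between G i3 i2" "\<alpha>3 \<in> arcs_between G i3 i4" "\<alpha>4 \<in> arcs_between G i1 i4"
    then have e: "(\<Sum>k \<in> verts G. \<Sum>\<beta>1 \<in> arcs_between G i2 k. \<Sum>\<beta>2 \<in> arcs_between G k i1.
         \<Sum>\<beta>3 \<in> arcs_between G k i3. \<Sum>\<beta>4 \<in> arcs_between G i4 k.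
            of_real (inverse (\<phi> k)) * W \<alpha>1 \<beta>1 \<beta>2 * cnj (W \<alpha>2 \<beta>1 \<beta>3)
              * W \<alpha>3 \<beta>4 \<beta>3 * cnj (W \<alpha>4 \<beta>4 \<beta>2))
        = (if \<alpha>1 = \<alpha>4 \<and> \<alpha>2 = \<alpha>3 then of_real (\<phi> i1 * \<phi> i2 * \<phi> i3) else 0)
        + (if \<alpha>1 = \<alpha>2 \<and> \<alpha>3 = \<alpha>4 then of_real (\<phi> i1 * \<phi> i2 * \<phi> i4) else 0)"
      using assms unfolding cell_system_def cell_type_II_def by blast
    have "(\<Sum>k \<in> verts G. \<Sum>\<beta>1 \<in> arcs_between G i2 k. \<Sum>\<beta>2 \<in> arcs_between G k i1.
         \<Sum>\<beta>3 \<in> arcs_between G k i3. \<Sum>\<beta>4 \<in> arcs_between G i4 k.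
            of_real (inverse (\<phi> k)) * conj_cells W \<alpha>1 \<beta>1 \<beta>2 * cnj (conj_cells W \<alpha>2 \<beta>1 \<beta>3)
              * conj_cells W \<alpha>3 \<beta>4 \<beta>3 * cnj (conj_cells W \<alpha>4 \<beta>4 \<beta>2))
      = cnj (\<Sum>k \<in> verts G. \<Sum>\<beta>1 \<in> arcs_between G i2 k. \<Sum>\<beta>2 \<in> arcs_between G k i1.
         \<Sum>\<beta>3 \<in> arcs_between G k i3. \<Sum>\<beta>4 \<in> arcs_between G i4 k.
            of_real (inverse (\<phi> k)) * W \<alpha>1 \<beta>1 \<beta>2 * cnj (W \<alpha>2 \<beta>1 \<beta>3)
              * W \<alpha>3 \<beta>4 \<beta>3 * cnj (W \<alpha>4 \<beta>4 \<beta>2))"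
      by (simp add: conj_cells_def)
    then show "(\<Sum>k \<in> verts G. \<Sum>\<beta>1 \<in> arcs_between G i2 k. \<Sum>\<beta>2 \<in> arcs_between G k i1.
         \<Sum>\<beta>3 \<in> arcs_between G k i3. \<Sum>\<beta>4 \<in> arcs_between G i4 k.
            of_real (inverse (\<phi> k)) * conj_cells W \<alpha>1 \<beta>1 \<beta>2 * cnj (conj_cells W \<alpha>2 \<beta>1 \<beta>3)
              * conj_cells W \<alpha>3 \<beta>4 \<beta>3 * cnj (conj_cells W \<alpha>4 \<beta>4 \<beta>2))
      = (if \<alpha>1 = \<alpha>4 \<and> \<alpha>2 = \<alpha>3 then of_real (\<phi> i1 * \<phi> i2 * \<phi> i3) else 0)
        + (if \<alpha>1 = \<alpha>2 \<and> \<alpha>3 = \<alpha>4 then of_real (\<phi> i1 * \<phi> i2 * \<phi> i4) else 0)"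
      unfolding e complex_cnj_add cnj_if .
  qed
  have "\<forall>\<alpha> \<beta> \<gamma>. is_triangle G \<alpha> \<beta> \<gamma> \<longrightarrow> conj_cells W \<alpha> \<beta> \<gamma> = conj_cells W \<beta> \<gamma> \<alpha>"
    using assms unfolding cell_system_def conj_cells_def by metis
  with I II assms show ?thesis
    unfolding cell_system_def by blast
qed

lemma orbifold_solution_conj:
  assumes "orbifold_solution k W"
  shows "orbifold_solution k (conj_cells W)"
  using assms cell_system_conj [of "3 * k + 3" "D_graph k" "D_weight k" W]
  unfolding orbifold_solution_def Let_def cell_split_def cell_low_def cell_side_def D_cell_def conj_cells_def
  by simp

section \<open>The two solutions are inequivalent\<close>

lemma arcs_between_D:
  assumes "\<alpha> \<in> arcs (D_graph k)"
  shows "arcs_between (D_graph k) (D_tail k \<alpha>) (D_head k \<alpha>)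
    = (if \<alpha> \<in> {gamma_arc k, gamma'_arc k} then {gamma_arc k, gamma'_arc k} \<inter> arcs (D_graph k) else {\<alpha>})"
proof -
  have "\<beta> \<in> arcs_between (D_graph k) (D_tail k \<alpha>) (D_head k \<alpha>) \<longleftrightarrow>
    \<beta> \<in> (if \<alpha> \<in> {gamma_arc k, gamma'_arc k} then {gamma_arc k, gamma'_arc k} \<inter> arcs (D_graph k) else {\<alpha>})" for \<beta>
  proof
    assume "\<beta> \<in> arcs_between (D_graph k) (D_tail k \<alpha>) (D_head k \<alpha>)"
    then have \<beta>: "\<beta> \<in> arcs (D_graph k)" "D_tail k \<alpha> = D_tail k \<beta>" "D_head k \<alpha> = D_head k \<beta>"
      by (simp_all add: arcs_between_def)
    from parallel_arcs [OF assms this] show "\<beta> \<in> (if \<alpha> \<in> {gamma_arc k, gamma'_arc k} then {gamma_arc k, gamma'_arc k} \<inter> arcs (D_graph k) else {\<alpha>})"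
      using \<beta>(1) by auto
  next
    assume "\<beta> \<in> (if \<alpha> \<in> {gamma_arc k, gamma'_arc k} then {gamma_arc k, gamma'_arc k} \<inter> arcs (D_graph k) else {\<alpha>})"
    then show "\<beta> \<in> arcs_between (D_graph k) (D_tail k \<alpha>) (D_head k \<alpha>)"
      using assms gamma_ends [of k] by (auto simp: arcs_between_def split: if_splits)
  qed
  then show ?thesis
    by blast
qed

lemma equivalence_equations:
  assumes "fin_digraph G" "cells_equivalent G W1 W2"
  obtains u where "\<And>\<alpha>. \<alpha> \<in> arcs G \<Longrightarrow> unitary_on (arcs_between G (tail G \<alpha>) (head G \<alpha>)) u"
    "\<And>\<alpha> \<beta> \<delta>. is_triangle G \<alpha> \<beta> \<delta> \<Longrightarrow> W1 \<alpha> \<beta> \<delta> =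
       (\<Sum>\<alpha>' \<in> arcs_between G (tail G \<alpha>) (head G \<alpha>). \<Sum>\<beta>' \<in> arcs_between G (tail G \<beta>) (head G \<beta>).
        \<Sum>\<delta>' \<in> arcs_between G (tail G \<delta>) (head G \<delta>). u \<alpha> \<alpha>' * u \<beta> \<beta>' * u \<delta> \<delta>' * W2 \<alpha>' \<beta>' \<delta>')"
proof -
  interpret fin_digraph G by (rule assms)
  obtain u where u: "\<forall>i \<in> verts G. \<forall>j \<in> verts G. unitary_on (arcs_between G i j) u"
    "\<forall>i \<in> verts G. \<forall>j \<in> verts G. \<forall>k \<in> verts G.
        \<forall>\<sigma> \<in> arcs_between G i j. \<forall>\<rho> \<in> arcs_between G j k. \<forall>\<gamma> \<in> arcs_between G k i.
          W1 \<sigma> \<rho> \<gamma> =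
            (\<Sum>\<sigma>' \<in> arcs_between G i j. \<Sum>\<rho>' \<in> arcs_between G j k. \<Sum>\<gamma>' \<in> arcs_between G k i.
               u \<sigma> \<sigma>' * u \<rho> \<rho>' * u \<gamma> \<gamma>' * W2 \<sigma>' \<rho>' \<gamma>')"
    using assms(2) unfolding cells_equivalent_def by blast
  show thesis
  proof
    show "unitary_on (arcs_between G (tail G \<alpha>) (head G \<alpha>)) u" if "\<alpha> \<in> arcs G" for \<alpha>
      using u(1) that by simp
    fix \<alpha> \<beta> \<delta>
    assume t: "is_triangle G \<alpha> \<beta> \<delta>"
    then have v: "tail G \<alpha> \<in> verts G" "tail G \<beta> \<in> verts G" "tail G \<delta> \<in> verts G"
      "\<alpha> \<in> arcs_between G (tail G \<alpha>) (tail G \<beta>)" "\<beta> \<in> arcs_between G (tail G \<beta>) (tail G \<delta>)"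
      "\<delta> \<in> arcs_between G (tail G \<delta>) (tail G \<alpha>)"
      by (simp_all add: is_triangle_def arcs_between_def)
    have h: "head G \<alpha> = tail G \<beta>" "head G \<beta> = tail G \<delta>" "head G \<delta> = tail G \<alpha>"
      using t by (simp_all add: is_triangle_def)
    show "W1 \<alpha> \<beta> \<delta> =
       (\<Sum>\<alpha>' \<in> arcs_between G (tail G \<alpha>) (head G \<alpha>). \<Sum>\<beta>' \<in> arcs_between G (tail G \<beta>) (head G \<beta>).
        \<Sum>\<delta>' \<in> arcs_between G (tail G \<delta>) (head G \<delta>). u \<alpha> \<alpha>' * u \<beta> \<beta>' * u \<delta> \<delta>' * W2 \<alpha>' \<beta>' \<delta>')"
      unfolding h by (rule u(2) [rule_format, OF v])
  qed
qed

lemma triangle_split: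
  assumes k: "k \<ge> 1" and "i \<in> {1, 2, 3}" "\<xi> \<in> {gamma_arc k, gamma'_arc k}"
  shows "is_triangle (D_graph k) (Into i) (Outof i) \<xi>"
  using assms gamma_in_arcs [OF k] gamma_ends [of k] by (auto simp: is_triangle_def)

lemma triangle_low:
  assumes k: "k \<ge> 1" and \<xi>: "\<xi> \<in> {gamma_arc k, gamma'_arc k}"
  shows "is_triangle (D_graph k) (edge (k - 1) (k - 1) (k + 1)) \<xi> (edge (k + 1) (k - 1) (k - 1))"
proof -
  have "orb k (k - 1) (k + 1) = orb (k - 1 + 1) (k - 1) (k + 1)" "orb (k + 1) (k - 1) (k - 1 + 1) = orb (k - 1) k (k + 1)"
    "orb (k + 1 + 1) (k - 1) (k - 1) = orb (k - 1) (k - 1) (k + 1 + 1)"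
    using orb_rotate [of k "k + 1" "k - 1"] orb_rotate [of "k + 1" "k - 1" k] orb_rotate [of "k - 1" "k - 1" "k + 2"] by (simp_all add: add.commute)
  moreover have "edge_ok k (k - 1) (k - 1) (k + 1)" "edge_ok k (k + 1) (k - 1) (k - 1)"
    using k by (simp_all add: edge_ok_def)
  moreover have "\<xi> \<in> arcs (D_graph k)" "D_tail k \<xi> = orb k (k - 1) (k + 1)" "D_head k \<xi> = orb (k - 1) k (k + 1)"
    using \<xi> gamma_in_arcs [OF k] gamma_ends [of k] by auto
  ultimately show ?thesis
    unfolding is_triangle_def tail_D head_D edge_in_arcs D_tail_edge D_head_edge by metis
qed

text \<open>The triangle through \<open>(k - 1, k - 1)\<close> has a nonzero cell for \<open>\<gamma>\<close> and cell zero for \<open>\<gamma>'\<close>, which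
  forces the unitary matrix on \<open>{\<gamma>, \<gamma>'}\<close> to be diagonal. The cells at \<open>(k, k)\<^sub>i\<close> then give
  \<open>\<epsilon>\<^sub>i\<^sup>2 = c \<cdot> cnj (\<epsilon>\<^sub>i\<^sup>2)\<close> with \<open>c\<close> independent of \<open>i\<close>. The case \<open>i = 1\<close> yields \<open>c = 1\<close>, and \<open>i = 2\<close> contradicts it.\<close>

theorem not_equivalent_conj:
  assumes k: "k \<ge> 1"
  shows "\<not> cells_equivalent (D_graph k) (orbifold_cells k eps) (orbifold_cells k (cnj \<circ> eps))"
proof
  let ?G = "D_graph k" and ?g = "gamma_arc k" and ?g' = "gamma'_arc k"
  let ?l = "edge (k - 1) (k - 1) (k + 1)" and ?m = "edge (k + 1) (k - 1) (k - 1)"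
  assume "cells_equivalent ?G (orbifold_cells k eps) (orbifold_cells k (cnj \<circ> eps))"
  from equivalence_equations [OF fin_digraph_D [OF k] this, unfolded tail_D head_D]
  obtain u where uni: "\<And>\<alpha>. \<alpha> \<in> arcs ?G \<Longrightarrow> unitary_on (arcs_between ?G (D_tail k \<alpha>) (D_head k \<alpha>)) u"
    and eq: "\<And>\<alpha> \<beta> \<delta>. is_triangle ?G \<alpha> \<beta> \<delta> \<Longrightarrow> orbifold_cells k eps \<alpha> \<beta> \<delta> =
       (\<Sum>\<alpha>' \<in> arcs_between ?G (D_tail k \<alpha>) (D_head k \<alpha>). \<Sum>\<beta>' \<in> arcs_between ?G (D_tail k \<beta>) (D_head k \<beta>).
        \<Sum>\<delta>' \<in> arcs_between ?G (D_tail k \<delta>) (D_head k \<delta>). u \<alpha> \<alpha>' * u \<beta> \<beta>' * u \<delta> \<delta>' * orbifold_cells k (cnj \<circ> eps) \<alpha>' \<beta>' \<delta>')"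
    by blast
  have single: "arcs_between ?G (D_tail k \<alpha>) (D_head k \<alpha>) = {\<alpha>}" if "\<alpha> \<in> arcs ?G" "\<alpha> \<notin> {?g, ?g'}" for \<alpha>
    using arcs_between_D [OF that(1)] that(2) by simp
  have double: "arcs_between ?G (D_tail k \<alpha>) (D_head k \<alpha>) = {?g, ?g'}" if "\<alpha> \<in> {?g, ?g'}" for \<alpha>
    using arcs_between_D [of \<alpha> k] that gamma_in_arcs [OF k] by auto
  have unit: "u \<alpha> \<alpha> * cnj (u \<alpha> \<alpha>) = 1" if "\<alpha> \<in> arcs ?G" "\<alpha> \<notin> {?g, ?g'}" for \<alpha>
    using uni [OF that(1)] unfolding single [OF that] by (simp add: unitary_on_def)
  have lm: "?l \<in> arcs ?G" "?l \<notin> {?g, ?g'}" "?m \<in> arcs ?G" "?m \<notin> {?g, ?g'}"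
    using k by (auto simp: edge_ok_def gamma_arc_edge gamma'_arc_edge)
  have T: "tri_cell k (k - 1) (k - 1) (k + 1) > 0" "tri_cell k (k - 1) k (k - 1) > 0" "tri_cell k k (k - 1) k > 0"
    using k by (intro tri_cell_pos; linarith)+
  have low: "orbifold_cells k e ?l ?g ?m = of_real (tri_cell k (k - 1) (k - 1) (k + 1))" "orbifold_cells k e ?l ?g' ?m = 0" for e
    using orbifold_cells_low [of k e] orbifold_cells_zero(1) [of k e] unfolding cell_low_eq by simp_all
  have "0 = u ?l ?l * u ?g' ?g * u ?m ?m * of_real (tri_cell k (k - 1) (k - 1) (k + 1))"
    using eq [OF triangle_low [OF k, of ?g']] unfolding single [OF lm(1,2)] single [OF lm(3,4)] double [of ?g', simplified]
    by (simp add: low del: orbifold_cells.simps)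
  \<comment> \<open>One off-diagonal entry vanishes by the low triangle; unitarity removes the other.\<close>
  then have z: "u ?g' ?g = 0"
    using T(1) unit [OF lm(1,2)] unit [OF lm(3,4)] by auto
  have U: "unitary_on {?g, ?g'} u"
    using uni [of ?g] double [of ?g] gamma_in_arcs [OF k] by simp
  then have "cnj (u ?g ?g) * u ?g ?g + cnj (u ?g' ?g) * u ?g' ?g = 1" "cnj (u ?g ?g) * u ?g ?g' + cnj (u ?g' ?g) * u ?g' ?g' = 0"
    "u ?g' ?g * cnj (u ?g' ?g) + u ?g' ?g' * cnj (u ?g' ?g') = 1"
    unfolding unitary_on_def by simp_all
  with z have d: "u ?g ?g * cnj (u ?g ?g) = 1" "u ?g ?g' = 0" "u ?g' ?g' * cnj (u ?g' ?g') = 1"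
    by (auto simp: mult.commute)
  have rel: "(eps i)\<^sup>2 = (u ?g ?g * cnj (u ?g' ?g')) * (cnj (eps i))\<^sup>2" if i: "i \<in> {1, 2, 3}" for i
  proof -
    have io: "Into i \<in> arcs ?G" "Into i \<notin> {?g, ?g'}" "Outof i \<in> arcs ?G" "Outof i \<notin> {?g, ?g'}"
      using i by (auto simp: gamma_arc_edge gamma'_arc_edge)
    define s where "s = u (Into i) (Into i) * u (Outof i) (Outof i)"
    have s: "s * cnj s = 1"
    proof -
      have "s * cnj s = (u (Into i) (Into i) * cnj (u (Into i) (Into i))) * (u (Outof i) (Outof i) * cnj (u (Outof i) (Outof i)))"
        by (simp add: s_def mult_ac)
      then show ?thesis
        unfolding unit [OF io(1,2)] unit [OF io(3,4)] by simp
    qed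
    have *: "split_cell k eps i \<xi> = s * (\<Sum>\<xi>' \<in> {?g, ?g'}. u \<xi> \<xi>' * split_cell k (cnj \<circ> eps) i \<xi>')" if "\<xi> \<in> {?g, ?g'}" for \<xi>
      using eq [OF triangle_split [OF k i that]] unfolding single [OF io(1,2)] single [OF io(3,4)] double [OF that]
      by (simp add: s_def distrib_left mult_ac del: split_cell_gamma)
    have "eps i = s * u ?g ?g * cnj (eps i)"
      using * [of ?g] T(2) d(2) by (simp add: mult_ac)
    moreover have "cnj (eps i) = s * u ?g' ?g' * eps i"
      using * [of ?g'] T(3) z by (simp add: mult_ac)
    then have "eps i = cnj s * cnj (u ?g' ?g') * cnj (eps i)"
      by (metis complex_cnj_cnj complex_cnj_mult)
    ultimately have "(eps i)\<^sup>2 = (s * u ?g ?g * cnj (eps i)) * (cnj s * cnj (u ?g' ?g') * cnj (eps i))"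
      by (metis power2_eq_square)
    also have "\<dots> = (s * cnj s) * (u ?g ?g * cnj (u ?g' ?g')) * (cnj (eps i))\<^sup>2"
      by (simp add: power2_eq_square mult_ac)
    finally show ?thesis
      unfolding s by simp
  qed
  have "u ?g ?g * cnj (u ?g' ?g') = 1"
    using rel [of 1] eps_values(1) by simp
  with rel [of 2] have "(eps 2)\<^sup>2 = (cnj (eps 2))\<^sup>2"
    by simp
  then show False
    unfolding eps_values by (simp add: complex_eq_iff power2_eq_square)
qed

section \<open>Triangles of the orbifold graph\<close>

text \<open>A path continues straight on, or it turns to the left or to the right into a triangle.\<close>

lemma next_edge:
  assumes "edge_ok k a b c" "edge_ok k a' b' c'" "orb (a + 1) b c = orb a' b' (c' + 1)"
  obtains (straight) "a' = a + 1" "b' = b" "c' = c - 1" | (up) "a' = b" "b' = c" "c' = a" | (down) "a' = c" "b' = a + 1" "c' = b - 1"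
proof -
  have "edge a' b' c' \<in> {edge (a + 1) b (c - 1), edge b c (a + 1 - 1), edge c (a + 1) (b - 1)}"
    using orb_eq_target [of "a + 1" b c k a' b' c'] assms by (simp add: edge_ok_def)
  then show thesis
    using that by auto
qed

text \<open>A closed path of three steps with a straight step cannot lie in the lattice; it winds around the
  centre, and this happens only for the two triangles whose cells vanish.\<close>

lemma straight_triangle:
  assumes ok: "edge_ok k a b c" "edge_ok k (a + 1) b (c - 1)" "edge_ok k x y z"
    and n: "orb (a + 1 + 1) b (c - 1) = orb x y (z + 1)" "orb (x + 1) y z = orb a b (c + 1)"
  shows "(a, b, c, x, y, z) \<in> {(k - 1, k - 1, k + 1, k + 1, k - 1, k - 1), (k, k - 1, k, k - 1, k - 1, k + 1),
     (k - 2, k + 1, k, k, k + 1, k - 2), (k - 1, k + 1, k - 1, k - 2, k + 1, k)}"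
proof -
  have sum: "a + b + c = 3 * k - 1" and ne: "\<not> (a = k - 1 \<and> b = k)"
    using ok(1) by (simp_all add: edge_ok_def)
  from ok(2,3) n(1) show ?thesis
  proof (cases rule: next_edge)
    case 1: straight
    from ok(3,1) n(2) show ?thesis
    proof (cases rule: next_edge)
      case 2: straight
      with 1 show ?thesis
        by linarith
    next
      case 2: up
      then have "a = k - 1" "b = k - 1" "c = k + 1"
        using 1 sum by linarith+
      then show ?thesis
        using 1 by simp
    next
      case 2: down
      then have "a = k - 2" "b = k + 1" "c = k"
        using 1 sum by linarith+
      then show ?thesis
        using 1 by simp
    qed
  next
    case 1: up
    from ok(3,1) n(2) show ?thesis
    proof (cases rule: next_edge)
      case 2: straight
      then have "a = k" "b = k - 1" "c = k"
        using 1 sum by linarith+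
      then show ?thesis
        using 1 by simp
    next
      case 2: up
      with 1 sum ne show ?thesis
        by linarith
    next
      case 2: down
      with 1 show ?thesis
        by linarith
    qed
  next
    case 1: down
    from ok(3,1) n(2) show ?thesis
    proof (cases rule: next_edge)
      case 2: straight
      then have "a = k - 1" "b = k + 1" "c = k - 1"
        using 1 sum by linarith+
      then show ?thesis
        using 1 by simp
    next
      case 2: up
      with 1 show ?thesis
        by linarith
    next
      case 2: down
      with 1 sum ne show ?thesis
        by linarith
    qed
  qed
qed

lemma three_choices:
  assumes "P1 \<or> Q1" "P2 \<or> Q2" "P3 \<or> Q3"
    and "\<not> (P1 \<and> P2 \<and> Q3)" "\<not> (P1 \<and> Q2 \<and> P3)" "\<not> (P1 \<and> Q2 \<and> Q3)"
    "\<not> (Q1 \<and> P2 \<and> P3)" "\<not> (Q1 \<and> P2 \<and> Q3)" "\<not> (Q1 \<and> Q2 \<and> P3)"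
  shows "P1 \<and> P2 \<or> Q1 \<and> Q2"
  using assms by blast

text \<open>Mixing the two kinds of turns would lead to an arc at the centre.\<close>

lemma bent_triangle:
  assumes ok: "edge_ok k a b c" "edge_ok k a' b' c'" "edge_ok k x y z"
    and n12: "a' = b \<and> b' = c \<and> c' = a \<or> a' = c \<and> b' = a + 1 \<and> c' = b - 1"
    and n23: "x = b' \<and> y = c' \<and> z = a' \<or> x = c' \<and> y = a' + 1 \<and> z = b' - 1"
    and n31: "a = y \<and> b = z \<and> c = x \<or> a = z \<and> b = x + 1 \<and> c = y - 1"
  shows "a' = b \<and> b' = c \<and> c' = a \<and> x = c \<and> y = a \<and> z = b
    \<or> a' = c \<and> b' = a + 1 \<and> c' = b - 1 \<and> x = b - 1 \<and> y = c + 1 \<and> z = a"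
proof -
  have centre: "\<not> (a = k \<and> b = k)" "\<not> (a = k - 1 \<and> b = k)" "\<not> (a' = k - 1 \<and> b' = k)" and sum: "a + b + c = 3 * k - 1"
    using ok by (simp_all add: edge_ok_def)
  have "(a' = b \<and> b' = c \<and> c' = a) \<and> (x = b' \<and> y = c' \<and> z = a')
      \<or> (a' = c \<and> b' = a + 1 \<and> c' = b - 1) \<and> (x = c' \<and> y = a' + 1 \<and> z = b' - 1)"
    by (rule three_choices [OF n12 n23 n31]; use centre sum in linarith)
  then show ?thesis
    by (elim disjE) (rule disjI1, simp, rule disjI2, simp)
qed

text \<open>The list of all triangles of the orbifold graph up to rotation, as a proof rule.\<close>

lemma triangle_induct:
  assumes k: "k \<ge> 1" and tri: "is_triangle (D_graph k) \<alpha> \<beta> \<delta>"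
    and rotate: "\<And>\<alpha> \<beta> \<delta>. is_triangle (D_graph k) \<alpha> \<beta> \<delta> \<Longrightarrow> P \<beta> \<delta> \<alpha> \<Longrightarrow> P \<alpha> \<beta> \<delta>"
    and up: "\<And>a b c. edge_ok k a b c \<Longrightarrow> edge_ok k b c a \<Longrightarrow> edge_ok k c a b \<Longrightarrow> P (edge a b c) (edge b c a) (edge c a b)"
    and down: "\<And>a b c. edge_ok k b (c + 1) a \<Longrightarrow> edge_ok k a (b + 1) c \<Longrightarrow> edge_ok k c (a + 1) b
      \<Longrightarrow> P (edge b (c + 1) a) (edge a (b + 1) c) (edge c (a + 1) b)"
    and split: "\<And>i \<xi>. i \<in> {1, 2, 3} \<Longrightarrow> \<xi> \<in> {gamma_arc k, gamma'_arc k} \<Longrightarrow> P (Into i) (Outof i) \<xi>"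
    and low: "P (edge (k - 1) (k - 1) (k + 1)) (gamma'_arc k) (edge (k + 1) (k - 1) (k - 1))"
    and side: "k \<noteq> 1 \<Longrightarrow> P (edge (k - 2) (k + 1) k) (gamma_arc k) (edge k (k + 1) (k - 2))"
  shows "P \<alpha> \<beta> \<delta>"
proof -
  let ?T = "is_triangle (D_graph k)"
  have turn: "?T \<beta> \<delta> \<alpha>" if "?T \<alpha> \<beta> \<delta>" for \<alpha> \<beta> \<delta>
    using that unfolding is_triangle_def by blast
  have double: "\<xi> \<in> {gamma_arc k, gamma'_arc k}"
    if "\<xi> \<in> arcs (D_graph k)" "D_tail k \<xi> = orb k (k - 1) (k + 1)" "D_head k \<xi> = orb (k - 1) k (k + 1)" for \<xi>
    using parallel_arcs [OF that(1) gamma_in_arcs(1) [OF k]] that(2,3) gamma_ends [of k] by auto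
  have straight: "P (edge a b c) (edge (a + 1) b (c - 1)) (edge x y z)"
    if t: "?T (edge a b c) (edge (a + 1) b (c - 1)) (edge x y z)" for a b c x y z
  proof -
    have ok: "edge_ok k a b c" "edge_ok k (a + 1) b (c - 1)" "edge_ok k x y z"
      "orb (a + 1 + 1) b (c - 1) = orb x y (z + 1)" "orb (x + 1) y z = orb a b (c + 1)"
      using t unfolding is_triangle_def by simp_all
    from straight_triangle [OF ok] consider
      (1) "a = k - 1" "b = k - 1" "c = k + 1" "x = k + 1" "y = k - 1" "z = k - 1"
      | (2) "a = k" "b = k - 1" "c = k" "x = k - 1" "y = k - 1" "z = k + 1"
      | (3) "a = k - 2" "b = k + 1" "c = k" "x = k" "y = k + 1" "z = k - 2"
      | (4) "a = k - 1" "b = k + 1" "c = k - 1" "x = k - 2" "y = k + 1" "z = k"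
      by blast
    then show ?thesis
    proof cases
      case 1
      then show ?thesis
        using low by (simp add: gamma'_arc_edge)
    next
      case 2
      have "P (edge x y z) (edge a b c) (edge (a + 1) b (c - 1))"
        using low 2 by (simp add: gamma'_arc_edge)
      from rotate [OF turn [OF t] this] show ?thesis
        by (rule rotate [OF t])
    next
      case 3
      then have "k \<noteq> 1"
        using ok(1) by (auto simp: edge_ok_def)
      then show ?thesis
        using side 3 by (simp add: gamma_arc_edge)
    next
      case 4
      then have "k \<noteq> 1"
        using ok(3) by (auto simp: edge_ok_def)
      then have "P (edge x y z) (edge a b c) (edge (a + 1) b (c - 1))"
        using side 4 by (simp add: gamma_arc_edge)
      from rotate [OF turn [OF t] this] show ?thesis
        by (rule rotate [OF t])
    qed
  qed
  have edges: "P (edge a b c) (edge a' b' c') (edge x y z)"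
    if t: "?T (edge a b c) (edge a' b' c') (edge x y z)" for a b c a' b' c' x y z
  proof -
    have ok: "edge_ok k a b c" "edge_ok k a' b' c'" "edge_ok k x y z"
      and n: "orb (a + 1) b c = orb a' b' (c' + 1)" "orb (a' + 1) b' c' = orb x y (z + 1)" "orb (x + 1) y z = orb a b (c + 1)"
      using t unfolding is_triangle_def by simp_all
    have t2: "?T (edge a' b' c') (edge x y z) (edge a b c)" and t3: "?T (edge x y z) (edge a b c) (edge a' b' c')"
      using turn [OF t] turn [OF turn [OF t]] .
    have n12: "a' = a + 1 \<and> b' = b \<and> c' = c - 1 \<or> (a' = b \<and> b' = c \<and> c' = a \<or> a' = c \<and> b' = a + 1 \<and> c' = b - 1)"
      by (rule next_edge [OF ok(1,2) n(1)]) simp_all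
    have n23: "x = a' + 1 \<and> y = b' \<and> z = c' - 1 \<or> (x = b' \<and> y = c' \<and> z = a' \<or> x = c' \<and> y = a' + 1 \<and> z = b' - 1)"
      by (rule next_edge [OF ok(2,3) n(2)]) simp_all
    have n31: "a = x + 1 \<and> b = y \<and> c = z - 1 \<or> (a = y \<and> b = z \<and> c = x \<or> a = z \<and> b = x + 1 \<and> c = y - 1)"
      by (rule next_edge [OF ok(3,1) n(3)]) simp_all
    consider (1) "a' = a + 1 \<and> b' = b \<and> c' = c - 1" | (2) "x = a' + 1 \<and> y = b' \<and> z = c' - 1" | (3) "a = x + 1 \<and> b = y \<and> c = z - 1"
      | (4) "a' = b \<and> b' = c \<and> c' = a \<or> a' = c \<and> b' = a + 1 \<and> c' = b - 1"
        "x = b' \<and> y = c' \<and> z = a' \<or> x = c' \<and> y = a' + 1 \<and> z = b' - 1"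
        "a = y \<and> b = z \<and> c = x \<or> a = z \<and> b = x + 1 \<and> c = y - 1"
      using n12 n23 n31 by blast
    then show ?thesis
    proof cases
      case 1
      then show ?thesis
        using straight t by simp
    next
      case 2
      have "P (edge a' b' c') (edge x y z) (edge a b c)"
        using straight [of a' b' c' a b c] t2 2 by simp
      then show ?thesis
        by (rule rotate [OF t])
    next
      case 3
      have "P (edge x y z) (edge a b c) (edge a' b' c')"
        using straight [of x y z a' b' c'] t3 3 by simp
      from rotate [OF t2 this] show ?thesis
        by (rule rotate [OF t])
    next
      case 4
      from bent_triangle [OF ok 4] consider "a' = b" "b' = c" "c' = a" "x = c" "y = a" "z = b"
        | "a' = c" "b' = a + 1" "c' = b - 1" "x = b - 1" "y = c + 1" "z = a"
        by blast
      then show ?thesis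
      proof cases
        case 1
        have "P (edge a b c) (edge b c a) (edge c a b)"
          by (rule up) (use ok 1 in simp_all)
        then show ?thesis
          using 1 by simp
      next
        case 2
        have "P (edge a (b - 1 + 1) c) (edge c (a + 1) (b - 1)) (edge (b - 1) (c + 1) a)"
          by (rule down) (use ok 2 in simp_all)
        then show ?thesis
          using 2 by simp
      qed
    qed
  qed
  have a: "\<alpha> \<in> arcs (D_graph k)" "\<beta> \<in> arcs (D_graph k)" "\<delta> \<in> arcs (D_graph k)"
    and h: "D_head k \<alpha> = D_tail k \<beta>" "D_head k \<beta> = D_tail k \<delta>" "D_head k \<delta> = D_tail k \<alpha>"
    using tri unfolding is_triangle_def by simp_all
  from a(1) show ?thesis
  proof (cases rule: arcs_D_cases)
    case \<alpha>: (edge a b c)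
    from a(2) show ?thesis
    proof (cases rule: arcs_D_cases)
      case \<beta>: (edge a' b' c')
      from a(3) show ?thesis
      proof (cases rule: arcs_D_cases)
        case (edge x y z)
        then show ?thesis
          using edges tri \<alpha>(1) \<beta>(1) by simp
      qed (use h \<alpha> \<beta> in simp_all)
    next
      case \<beta>: (Into i)
      from a(3) have \<delta>: "\<delta> = Outof i"
        by (cases rule: arcs_D_cases) (use h(2) \<beta> in simp_all)
      have "\<alpha> \<in> {gamma_arc k, gamma'_arc k}"
        by (rule double [OF a(1)]) (use h \<beta> \<delta> in simp_all)
      from split [OF \<beta>(2) this] show ?thesis
        unfolding \<beta>(1) \<delta> by (rule rotate [OF tri [unfolded \<beta>(1) \<delta>]])
    next
      case (Outof i)
      then show ?thesis
        using h \<alpha> by simp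
    qed
  next
    case \<alpha>: (Into i)
    from a(2) have \<beta>: "\<beta> = Outof i"
      by (cases rule: arcs_D_cases) (use h(1) \<alpha> in simp_all)
    have "\<delta> \<in> {gamma_arc k, gamma'_arc k}"
      by (rule double [OF a(3)]) (use h \<alpha> \<beta> in simp_all)
    from split [OF \<alpha>(2) this] show ?thesis
      unfolding \<alpha>(1) \<beta> .
  next
    case \<alpha>: (Outof i)
    from a(3) have \<delta>: "\<delta> = Into i"
      by (cases rule: arcs_D_cases) (use h(3) \<alpha> in simp_all)
    have "\<beta> \<in> {gamma_arc k, gamma'_arc k}"
      by (rule double [OF a(2)]) (use h \<alpha> \<delta> in simp_all)
    from split [OF \<alpha>(2) this] have "P \<delta> \<alpha> \<beta>"
      unfolding \<alpha>(1) \<delta> .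
    from rotate [OF turn [OF tri] this] show ?thesis
      by (rule rotate [OF tri])
  qed
qed

section \<open>Solving for the phases\<close>

text \<open>Each equation has an edge \<open>e3 i\<close> that lies outside \<open>B\<close> and occurs in no other equation of
  the same or smaller rank. Hence the equations can be solved one after the other in the order of increasing rank,
  each time by choosing the phase of \<open>e3 i\<close>.\<close>

lemma phase_extension:
  fixes r :: "'i \<Rightarrow> int" and e1 e2 e3 :: "'i \<Rightarrow> 'e" and z :: "'i \<Rightarrow> complex" and g :: "'e \<Rightarrow> complex"
  assumes "finite I" and g: "\<And>e. cmod (g e) = 1"
    and I: "\<And>i. i \<in> I \<Longrightarrow> e3 i \<noteq> e1 i \<and> e3 i \<noteq> e2 i \<and> e3 i \<notin> B \<and> cmod (z i) = 1"
    and free: "\<And>i j. i \<in> I \<Longrightarrow> j \<in> I \<Longrightarrow> e3 i \<in> {e1 j, e2 j, e3 j} \<Longrightarrow> i = j \<or> r i < r j"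
  shows "\<exists>u. (\<forall>e. cmod (u e) = 1) \<and> (\<forall>e \<in> B. u e = g e) \<and> (\<forall>i \<in> I. u (e1 i) * u (e2 i) * u (e3 i) = z i)"
proof -
  have "J \<subseteq> I \<longrightarrow> (\<exists>u. (\<forall>e. cmod (u e) = 1) \<and> (\<forall>e \<in> B. u e = g e) \<and> (\<forall>i \<in> J. u (e1 i) * u (e2 i) * u (e3 i) = z i))"
    if "finite J" for J
    using that
  proof (induction J rule: finite_ranking_induct [where f = r])
    case empty
    then show ?case
      using g by auto
  next
    case (insert j J)
    show ?case
    proof (cases "j \<in> J")
      case True
      then show ?thesis
        using insert by (simp add: insert_absorb)
    next
      case False
      show ?thesis
      proof
        assume sub: "insert j J \<subseteq> I"
        with insert obtain u where u: "\<And>e. cmod (u e) = 1" "\<And>e. e \<in> B \<Longrightarrow> u e = g e"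
          "\<And>i. i \<in> J \<Longrightarrow> u (e1 i) * u (e2 i) * u (e3 i) = z i"
          by blast
        \<comment> \<open>The pivot edge absorbs the defect of the equation with the largest rank.\<close>
        define w where "w = u(e3 j := z j * cnj (u (e1 j)) * cnj (u (e2 j)))"
        have j: "e3 j \<noteq> e1 j" "e3 j \<noteq> e2 j" "e3 j \<notin> B" "cmod (z j) = 1"
          using I sub by blast+
        have "cmod (w e) = 1" for e
          using u(1) j(4) by (simp add: w_def norm_mult)
        moreover have "w e = g e" if "e \<in> B" for e
          using u(2) that j(3) by (auto simp: w_def)
        moreover have "w (e1 i) * w (e2 i) * w (e3 i) = z i" if "i \<in> insert j J" for i
        proof (cases "i = j")
          case True
          have unit: "u e * cnj (u e) = 1" for e
            using u(1) [of e] by (metis complex_norm_square of_real_1 one_power2)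
          have "w (e1 j) * w (e2 j) * w (e3 j) = z j * (u (e1 j) * cnj (u (e1 j))) * (u (e2 j) * cnj (u (e2 j)))"
            using j by (simp add: w_def mult_ac)
          then show ?thesis
            unfolding True unit by simp
        next
          case False
          then have i: "i \<in> J"
            using that by simp
          then have "e3 j \<notin> {e1 i, e2 i, e3 i}"
            using free [of j i] sub insert(2) [OF i] False by fastforce
          then have "w (e1 i) = u (e1 i)" "w (e2 i) = u (e2 i)" "w (e3 i) = u (e3 i)"
            by (auto simp: w_def)
          then show ?thesis
            using u(3) [OF i] by simp
        qed
        ultimately show "\<exists>u. (\<forall>e. cmod (u e) = 1) \<and> (\<forall>e \<in> B. u e = g e) \<and> (\<forall>i \<in> insert j J. u (e1 i) * u (e2 i) * u (e3 i) = z i)"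
          by blast
      qed
    qed
  qed
  with \<open>finite I\<close> show ?thesis
    by blast
qed

lemma diagonal_equivalent:
  assumes "fin_digraph G" and u: "\<And>e. cmod (u e) = 1"
    and tri: "\<And>\<alpha> \<beta> \<delta>. is_triangle G \<alpha> \<beta> \<delta> \<Longrightarrow> X \<alpha> \<beta> \<delta> = u \<alpha> * u \<beta> * u \<delta> * W \<alpha> \<beta> \<delta>"
  shows "cells_equivalent G X W"
proof -
  interpret fin_digraph G by (rule assms)
  let ?U = "\<lambda>\<sigma> \<sigma>'. if \<sigma>' = \<sigma> then u \<sigma> else 0"
  have fin: "finite (arcs_between G i j)" for i j
    by (simp add: arcs_between_def)
  have unit: "u e * cnj (u e) = 1" for e
    using u [of e] by (metis complex_norm_square of_real_1 one_power2)
  have pick: "(\<Sum>x \<in> A. ?U y x * f x) = u y * f y" if "finite A" "y \<in> A" for A y and f :: "_ \<Rightarrow> complex"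
    using that by (simp add: if_distrib [of "\<lambda>t. t * _"] cong: if_cong)
  have "unitary_on E ?U" if "finite E" for E
    unfolding unitary_on_def
  proof (intro conjI ballI)
    fix \<sigma> \<tau> assume s: "\<sigma> \<in> E" "\<tau> \<in> E"
    show "(\<Sum>\<rho> \<in> E. ?U \<sigma> \<rho> * cnj (?U \<tau> \<rho>)) = (if \<sigma> = \<tau> then 1 else 0)"
      unfolding pick [OF that s(1)] using unit by simp
    have "(\<Sum>\<rho> \<in> E. cnj (?U \<rho> \<sigma>) * ?U \<rho> \<tau>) = (\<Sum>\<rho> \<in> E. if \<rho> = \<sigma> then cnj (u \<sigma>) * ?U \<sigma> \<tau> else 0)"
      by (intro sum.cong refl) auto
    also have "\<dots> = (if \<sigma> = \<tau> then 1 else 0)"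
      using that s unit [of \<sigma>] by (auto simp: mult.commute)
    finally show "(\<Sum>\<rho> \<in> E. cnj (?U \<rho> \<sigma>) * ?U \<rho> \<tau>) = (if \<sigma> = \<tau> then 1 else 0)" .
  qed
  moreover have "X \<sigma> \<rho> \<gamma> = (\<Sum>\<sigma>' \<in> arcs_between G i j. \<Sum>\<rho>' \<in> arcs_between G j k. \<Sum>\<gamma>' \<in> arcs_between G k i.
      ?U \<sigma> \<sigma>' * ?U \<rho> \<rho>' * ?U \<gamma> \<gamma>' * W \<sigma>' \<rho>' \<gamma>')"
    if m: "\<sigma> \<in> arcs_between G i j" "\<rho> \<in> arcs_between G j k" "\<gamma> \<in> arcs_between G k i" for i j k \<sigma> \<rho> \<gamma>
  proof -
    have "(\<Sum>\<sigma>' \<in> arcs_between G i j. \<Sum>\<rho>' \<in> arcs_between G j k. \<Sum>\<gamma>' \<in> arcs_between G k i.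
      ?U \<sigma> \<sigma>' * ?U \<rho> \<rho>' * ?U \<gamma> \<gamma>' * W \<sigma>' \<rho>' \<gamma>')
      = (\<Sum>\<sigma>' \<in> arcs_between G i j. ?U \<sigma> \<sigma>' * (\<Sum>\<rho>' \<in> arcs_between G j k. ?U \<rho> \<rho>' * (\<Sum>\<gamma>' \<in> arcs_between G k i.
      ?U \<gamma> \<gamma>' * W \<sigma>' \<rho>' \<gamma>')))"
      unfolding sum_distrib_left by (simp only: mult.assoc)
    also have "\<dots> = u \<sigma> * u \<rho> * u \<gamma> * W \<sigma> \<rho> \<gamma>"
      unfolding pick [OF fin m(1)] pick [OF fin m(2)] pick [OF fin m(3)] by (simp only: mult.assoc)
    also have "\<dots> = X \<sigma> \<rho> \<gamma>"
      using m by (intro tri [symmetric]) (auto simp: is_triangle_def arcs_between_def)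
    finally show ?thesis ..
  qed
  ultimately show ?thesis
    unfolding cells_equivalent_def using fin by (intro exI [of _ ?U] conjI ballI) simp_all
qed

text \<open>Three unit vectors with sum zero form an equilateral triangle.\<close>

lemma three_unit_numbers:
  assumes "p 1 + p 2 + p 3 = 0" and unit: "\<And>i. i \<in> {1, 2, 3 :: nat} \<Longrightarrow> cmod (p i) = 1"
  shows "(\<forall>i \<in> {1, 2, 3}. p i = p 1 * cnj (eps i)) \<or> (\<forall>i \<in> {1, 2, 3}. p i = p 1 * eps i)"
proof -
  define r s where "r = p 2 * cnj (p 1)" and "s = p 3 * cnj (p 1)"
  have one: "p 1 * cnj (p 1) = 1"
    using unit [of 1] by (metis complex_norm_square insertI1 of_real_1 one_power2)
  have rs: "p 2 = p 1 * r" "p 3 = p 1 * s"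
    using one unfolding r_def s_def by (simp_all add: mult.left_commute)
  have "cmod r = 1" "cmod s = 1"
    using unit by (simp_all add: r_def s_def norm_mult del: One_nat_def)
  then have n: "(Re r)\<^sup>2 + (Im r)\<^sup>2 = 1" "(Re s)\<^sup>2 + (Im s)\<^sup>2 = 1"
    by (metis cmod_power2 one_power2)+
  have "(p 1 + p 2 + p 3) * cnj (p 1) = 1 + r + s"
    using one by (simp add: r_def s_def distrib_right)
  then have z: "1 + r + s = 0"
    using assms(1) by simp
  then have re: "Re s = - 1 - Re r" and im: "Im s = - Im r"
    by (simp_all add: complex_eq_iff)
  have "(Re s)\<^sup>2 = (Re r)\<^sup>2"
    using n im by simp
  then have half: "Re r = -1/2" "Re s = -1/2"
    unfolding re power2_eq_square by (simp_all add: algebra_simps re)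
  then have "(Im r)\<^sup>2 = (sqrt 3 / 2)\<^sup>2"
    using n(1) by (simp add: power2_eq_square)
  then have "Im r = sqrt 3 / 2 \<or> Im r = - (sqrt 3 / 2)"
    by (simp only: power2_eq_iff)
  then show ?thesis
  proof
    assume "Im r = sqrt 3 / 2"
    then have "r = eps 2" "s = eps 3"
      using half im by (simp_all add: eps_values complex_eq_iff)
    then show ?thesis
      using rs eps_values(1) by (auto simp del: One_nat_def)
  next
    assume "Im r = - (sqrt 3 / 2)"
    then have "r = cnj (eps 2)" "s = cnj (eps 3)"
      using half im by (simp_all add: eps_values complex_eq_iff)
    then show ?thesis
      using rs eps_values(1) by (auto simp del: One_nat_def)
  qed
qed

type_synonym cell_index = "int \<times> int \<times> int + int \<times> int \<times> int"

text \<open>The arcs of an upward (\<open>Inl\<close>) or downward (\<open>Inr\<close>) triangle. The last one is the edge whose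
  phase is used to adjust its cell.\<close>

fun index_arcs :: "cell_index \<Rightarrow> darc \<times> darc \<times> darc" where
  "index_arcs (Inl (a, b, c)) = (edge a b c, edge b c a, edge c a b)"
| "index_arcs (Inr (a, b, c)) = (edge b (c + 1) a, edge c (a + 1) b, edge a (b + 1) c)"

text \<open>The difference between the largest and the smallest coordinate measures the distance
  from the centre.\<close>

fun index_rank :: "cell_index \<Rightarrow> int" where
  "index_rank (Inl (a, b, c)) = max b c - a"
| "index_rank (Inr (a, b, c)) = b - min a c"

definition up_ok :: "int \<Rightarrow> int \<Rightarrow> int \<Rightarrow> int \<Rightarrow> bool" where
  "up_ok k a b c \<longleftrightarrow> edge_ok k a b c \<and> edge_ok k b c a \<and> edge_ok k c a b"

definition down_ok :: "int \<Rightarrow> int \<Rightarrow> int \<Rightarrow> int \<Rightarrow> bool" where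
  "down_ok k a b c \<longleftrightarrow> edge_ok k b (c + 1) a \<and> edge_ok k a (b + 1) c \<and> edge_ok k c (a + 1) b"

text \<open>One triangle from each orbit: in an upward triangle the first coordinate is the smallest, in a
  downward triangle the second is the largest, with ties broken in a way compatible with
  the rotation. A tie of all three coordinates is impossible because their sum is not divisible by three.\<close>

definition cell_indices :: "int \<Rightarrow> cell_index set" where
  "cell_indices k = Inl ` {(a, b, c). up_ok k a b c \<and> a \<le> b \<and> a < c} \<union> Inr ` {(a, b, c). down_ok k a b c \<and> a < b \<and> c \<le> b}"

lemma up_okD: "up_ok k a b c \<Longrightarrow> a \<ge> 0 \<and> b \<ge> 0 \<and> c \<ge> 0 \<and> a + b + c = 3 * k - 1 \<and> \<not> (a = k - 1 \<and> b = k)"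
  unfolding up_ok_def edge_ok_def by blast

lemma down_okD:
  assumes "down_ok k a b c"
  shows "a \<ge> 0 \<and> b \<ge> 0 \<and> c \<ge> 0 \<and> a + b + c = 3 * k - 2 \<and> \<not> (c = k - 1 \<and> a + 1 = k)"
proof -
  have "a \<ge> 0" "b \<ge> 0" "c \<ge> 0" "b + (c + 1) + a = 3 * k - 1" "\<not> (c = k - 1 \<and> a + 1 = k)"
    using assms unfolding down_ok_def edge_ok_def by blast+
  then show ?thesis
    by (simp add: add.commute add.left_commute)
qed

lemma cell_indices_cases:
  assumes "i \<in> cell_indices k"
  obtains (up) a b c where "i = Inl (a, b, c)" "up_ok k a b c" "a \<le> b" "a < c"
    | (down) a b c where "i = Inr (a, b, c)" "down_ok k a b c" "a < b" "c \<le> b"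
  using assms unfolding cell_indices_def by auto

lemma finite_cell_indices: "finite (cell_indices k)"
proof -
  let ?B = "{0..3 * k} \<times> {0..3 * k} \<times> {0..3 * k}"
  have "cell_indices k \<subseteq> Inl ` ?B \<union> Inr ` ?B"
  proof
    fix i assume "i \<in> cell_indices k"
    then show "i \<in> Inl ` ?B \<union> Inr ` ?B"
    proof (cases rule: cell_indices_cases)
      case (up a b c)
      then have "(a, b, c) \<in> ?B"
        using up_okD [OF up(2)] by simp
      then show ?thesis
        using up(1) by blast
    next
      case (down a b c)
      then have "(a, b, c) \<in> ?B"
        using down_okD [OF down(2)] by simp
      then show ?thesis
        using down(1) by blast
    qed
  qed
  then show ?thesis
    by (rule finite_subset) simp
qed

lemma index_free_edge:
  assumes "i \<in> cell_indices k"
  shows "snd (snd (index_arcs i)) \<noteq> fst (index_arcs i)" "snd (snd (index_arcs i)) \<noteq> fst (snd (index_arcs i))"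
    "snd (snd (index_arcs i)) \<notin> {gamma_arc k, gamma'_arc k} \<union> range Into \<union> range Outof"
proof -
  have "snd (snd (index_arcs i)) \<noteq> fst (index_arcs i) \<and> snd (snd (index_arcs i)) \<noteq> fst (snd (index_arcs i))
    \<and> snd (snd (index_arcs i)) \<notin> {gamma_arc k, gamma'_arc k} \<union> range Into \<union> range Outof"
    using assms
  proof (cases rule: cell_indices_cases)
    case (up a b c)
    then have "\<not> (c = k - 1 \<and> a = k + 1 \<and> b = k - 1)" "\<not> (c = k \<and> a = k - 1 \<and> b = k)"
      "\<not> (c = a \<and> a = b \<and> b = c)" "\<not> (c = b \<and> a = c \<and> b = a)"
      using up_okD [OF up(2)] by linarith+
    then show ?thesis
      unfolding up(1) gamma_arc_edge gamma'_arc_edge by auto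
  next
    case (down a b c)
    then have "\<not> (a = k - 1 \<and> b + 1 = k + 1 \<and> c = k - 1)" "\<not> (a = k \<and> b + 1 = k - 1 \<and> c = k)"
      "\<not> (a = b \<and> b + 1 = c + 1 \<and> c = a)" "\<not> (a = c \<and> b + 1 = a + 1 \<and> c = b)"
      using down_okD [OF down(2)] by linarith+
    then show ?thesis
      unfolding down(1) gamma_arc_edge gamma'_arc_edge index_arcs.simps fst_conv snd_conv edge_eq_iff Un_iff insert_iff by auto
  qed
  then show "snd (snd (index_arcs i)) \<noteq> fst (index_arcs i)" "snd (snd (index_arcs i)) \<noteq> fst (snd (index_arcs i))"
    "snd (snd (index_arcs i)) \<notin> {gamma_arc k, gamma'_arc k} \<union> range Into \<union> range Outof"
    by blast+
qed

text \<open>An upward triangle is left through the side across which its smallest coordinate decreases, a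
  downward triangle through the side across which its largest coordinate increases. Either way the
  next triangle is farther from the centre.\<close>

lemma index_rank_increases:
  assumes "i \<in> cell_indices k" "j \<in> cell_indices k"
    "snd (snd (index_arcs i)) \<in> {fst (index_arcs j), fst (snd (index_arcs j)), snd (snd (index_arcs j))}"
  shows "i = j \<or> index_rank i < index_rank j"
  using assms(1)
proof (cases rule: cell_indices_cases)
  case i: (up a b c)
  from assms(2) show ?thesis
  proof (cases rule: cell_indices_cases)
    case j: (up a' b' c')
    from assms(3) have "c = a' \<and> a = b' \<and> b = c' \<or> c = b' \<and> a = c' \<and> b = a' \<or> c = c' \<and> a = a' \<and> b = b'"
      unfolding i(1) j(1) by simp
    then have "a = a' \<and> b = b' \<and> c = c'"
      using i(3,4) j(3,4) by linarith
    then show ?thesis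
      using i(1) j(1) by simp
  next
    case j: (down a' b' c')
    from assms(3) have "c = b' \<and> a = c' + 1 \<and> b = a' \<or> c = c' \<and> a = a' + 1 \<and> b = b' \<or> c = a' \<and> a = b' + 1 \<and> b = c'"
      unfolding i(1) j(1) by simp
    then have "max b c - a < b' - min a' c'"
      using i(3,4) j(3,4) unfolding max_def min_def by (auto split: if_splits)
    then show ?thesis
      using i(1) j(1) by simp
  qed
next
  case i: (down a b c)
  from assms(2) show ?thesis
  proof (cases rule: cell_indices_cases)
    case j: (up a' b' c')
    from assms(3) have "a = a' \<and> b + 1 = b' \<and> c = c' \<or> a = b' \<and> b + 1 = c' \<and> c = a' \<or> a = c' \<and> b + 1 = a' \<and> c = b'"
      unfolding i(1) j(1) by simp
    then have "b - min a c < max b' c' - a'"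
      using i(3,4) j(3,4) unfolding max_def min_def by (auto split: if_splits)
    then show ?thesis
      using i(1) j(1) by simp
  next
    case j: (down a' b' c')
    from assms(3) have "a = b' \<and> b = c' \<and> c = a' \<or> a = c' \<and> b = a' \<and> c = b' \<or> a = a' \<and> b = b' \<and> c = c'"
      unfolding i(1) j(1) by auto
    then have "a = a' \<and> b = b' \<and> c = c'"
      using i(3,4) j(3,4) by linarith
    then show ?thesis
      using i(1) j(1) by simp
  qed
qed

lemma triangle_up: "up_ok k a b c \<Longrightarrow> is_triangle (D_graph k) (edge a b c) (edge b c a) (edge c a b)"
  using up_path [of k] unfolding is_triangle_def up_ok_def by (simp del: D_tail_edge D_head_edge)

lemma triangle_down:
  assumes "down_ok k a b c"
  shows "is_triangle (D_graph k) (edge b (c + 1) a) (edge a (b + 1) c) (edge c (a + 1) b)"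
  using orb_rotate [of "b + 1" "c + 1" a] orb_rotate [of "a + 1" "b + 1" c] orb_rotate [of "c + 1" "a + 1" b] assms
  unfolding is_triangle_def down_ok_def by simp

section \<open>Orbifold solutions\<close>

lemma orbifold_solutionD:
  assumes k: "k \<ge> 1" and X: "orbifold_solution k X"
  shows "cell_system (3 * k + 3) (D_graph k) (D_weight k) X"
    "\<And>i. i \<in> {1, 2, 3} \<Longrightarrow> cmod (X (Into i) (Outof i) (gamma_arc k)) = tri_cell k (k - 1) k (k - 1) / sqrt 3"
    "\<And>i. i \<in> {1, 2, 3} \<Longrightarrow> cmod (X (Into i) (Outof i) (gamma'_arc k)) = tri_cell k k (k - 1) k / sqrt 3"
    "X (edge (k - 1) (k - 1) (k + 1)) (gamma'_arc k) (edge (k + 1) (k - 1) (k - 1)) = 0"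
    "k \<noteq> 1 \<Longrightarrow> X (edge (k - 2) (k + 1) k) (gamma_arc k) (edge k (k + 1) (k - 2)) = 0"
    "\<And>a b c. up_ok k a b c \<Longrightarrow> cmod (X (edge a b c) (edge b c a) (edge c a b)) = tri_cell k a b c"
    "\<And>a b c. down_ok k a b c \<Longrightarrow> cmod (X (edge b (c + 1) a) (edge a (b + 1) c) (edge c (a + 1) b)) = tri_cell k a b c"
proof -
  note X' = X [unfolded orbifold_solution_def Let_def]
  show "cell_system (3 * k + 3) (D_graph k) (D_weight k) X"
    using X' by blast
  have T: "tri_cell k (k - 1) k (k - 1) \<ge> 0" "tri_cell k k (k - 1) k \<ge> 0"
    by (rule less_imp_le [OF tri_cell_pos [OF k]]; use k in linarith)+
  show "cmod (X (Into i) (Outof i) (gamma_arc k)) = tri_cell k (k - 1) k (k - 1) / sqrt 3" if "i \<in> {1, 2, 3}" for i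
  proof (rule power2_eq_imp_eq)
    have "(cmod (cell_split k X (gamma_arc k) i))\<^sup>2 = (qint (3 * k + 3) k)\<^sup>2 * qint (3 * k + 3) (k + 1) ^ 3 * qint (3 * k + 3) (k + 2) / (3 * (qint (3 * k + 3) 2)\<^sup>2)"
      using X' that by blast
    then show "(cmod (X (Into i) (Outof i) (gamma_arc k)))\<^sup>2 = (tri_cell k (k - 1) k (k - 1) / sqrt 3)\<^sup>2"
      unfolding power_divide split_weights [OF k] cell_split_def by (simp add: mult.commute)
  qed (use T in simp_all)
  show "cmod (X (Into i) (Outof i) (gamma'_arc k)) = tri_cell k k (k - 1) k / sqrt 3" if "i \<in> {1, 2, 3}" for i
  proof (rule power2_eq_imp_eq)
    have "(cmod (cell_split k X (gamma'_arc k) i))\<^sup>2 = qint (3 * k + 3) k * qint (3 * k + 3) (k + 1) ^ 3 * (qint (3 * k + 3) (k + 2))\<^sup>2 / (3 * (qint (3 * k + 3) 2)\<^sup>2)"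
      using X' that by blast
    then show "(cmod (X (Into i) (Outof i) (gamma'_arc k)))\<^sup>2 = (tri_cell k k (k - 1) k / sqrt 3)\<^sup>2"
      unfolding power_divide split_weights [OF k] cell_split_def by (simp add: mult.commute)
  qed (use T in simp_all)
  show "X (edge (k - 1) (k - 1) (k + 1)) (gamma'_arc k) (edge (k + 1) (k - 1) (k - 1)) = 0"
    using X' unfolding cell_low_eq by blast
  show "X (edge (k - 2) (k + 1) k) (gamma_arc k) (edge k (k + 1) (k - 2)) = 0" if "k \<noteq> 1"
    using X' that unfolding cell_side_eq by blast
  show "cmod (X (edge a b c) (edge b c a) (edge c a b)) = tri_cell k a b c" if ok: "up_ok k a b c" for a b c
  proof -
    have s: "a + b + c = 3 * k - 1" "a \<ge> 0" "b \<ge> 0" "c \<ge> 0"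
      using ok by (simp_all add: up_ok_def edge_ok_def)
    have "off_centre k {(a, b), (a + 1, b), (a, b + 1)}"
      using ok unfolding off_centre_up_iff [OF s(1)] up_ok_def .
    then have "cmod (D_cell k X (a, b) (a + 1, b) (a, b + 1)) = \<bar>A_cell_up (3 * k + 3) a b\<bar>"
      using X' by blast
    moreover have "tri_cell k a b c > 0"
      using k s by (intro tri_cell_pos) linarith+
    ultimately show ?thesis
      unfolding D_cell_up [OF s(1)] A_cell_up_eq [OF k s(1)] by simp
  qed
  show "cmod (X (edge b (c + 1) a) (edge a (b + 1) c) (edge c (a + 1) b)) = tri_cell k a b c" if ok: "down_ok k a b c" for a b c
  proof -
    have s: "a + b + c = 3 * k - 2" "a \<ge> 0" "b \<ge> 0" "c \<ge> 0"
      using ok by (simp_all add: down_ok_def edge_ok_def)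
    have "off_centre k {(a + 1, b), (a, b + 1), (a + 1, b + 1)}"
      using ok unfolding off_centre_down_iff [OF s(1)] down_ok_def .
    then have "cmod (D_cell k X (a + 1, b) (a, b + 1) (a + 1, b + 1)) = \<bar>A_cell_down (3 * k + 3) a b\<bar>"
      using X' by blast
    moreover have "tri_cell k a b c > 0"
      using k s by (intro tri_cell_pos) linarith+
    ultimately show ?thesis
      unfolding D_cell_down [OF s(1)] A_cell_down_eq [OF k s(1)] by simp
  qed
qed

text \<open>The type I relation for \<open>\<gamma>\<close> and \<open>\<gamma>'\<close>: the triangles through \<open>(k - 1, k - 1)\<close> and \<open>(k + 1, k - 2)\<close>
  drop out, since in each of them one of the two cells is zero.\<close>

lemma split_cells_orthogonal:
  assumes k: "k \<ge> 1" and X: "orbifold_solution k X"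
  shows "(\<Sum>i \<in> {1, 2, 3}. X (Into i) (Outof i) (gamma_arc k) * cnj (X (Into i) (Outof i) (gamma'_arc k))) = 0"
proof -
  let ?G = "D_graph k" and ?g = "gamma_arc k" and ?g' = "gamma'_arc k"
  let ?S = "(\<lambda>i. (Into i, Outof i)) ` {1, 2, 3}"
  have sys: "cell_system (3 * k + 3) ?G (D_weight k) X"
    by (rule orbifold_solutionD [OF k X])
  have rot: "X \<alpha> \<beta> \<delta> = X \<beta> \<delta> \<alpha>" if "is_triangle ?G \<alpha> \<beta> \<delta>" for \<alpha> \<beta> \<delta>
    using sys that unfolding cell_system_def by blast
  have turn: "is_triangle ?G \<beta> \<delta> \<alpha>" if "is_triangle ?G \<alpha> \<beta> \<delta>" for \<alpha> \<beta> \<delta>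
    using that unfolding is_triangle_def by blast
  have rot2: "X \<alpha> \<beta> \<delta> = X \<delta> \<alpha> \<beta>" if "is_triangle ?G \<alpha> \<beta> \<delta>" for \<alpha> \<beta> \<delta>
    using rot [OF that] rot [OF turn [OF that]] by simp
  let ?i = "orb k (k - 1) (k + 1)" and ?j = "orb (k - 1) k (k + 1)"
  have v: "?i \<in> verts ?G" "?j \<in> verts ?G"
    using k by (intro orb_in_verts; simp)+
  have m: "?g \<in> arcs_between ?G ?i ?j" "?g' \<in> arcs_between ?G ?i ?j"
    using gamma_in_arcs [OF k] gamma_ends [of k] by (simp_all add: arcs_between_def)
  have "(\<Sum>v \<in> verts ?G. \<Sum>\<beta> \<in> arcs_between ?G ?j v. \<Sum>\<delta> \<in> arcs_between ?G v ?i. X ?g \<beta> \<delta> * cnj (X ?g' \<beta> \<delta>)) = 0"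
  proof -
    have "cell_type_I (3 * k + 3) ?G (D_weight k) X"
      using sys unfolding cell_system_def by blast
    from this [unfolded cell_type_I_def, rule_format, OF v m] show ?thesis
      unfolding if_not_P [OF gamma_neq(1)] .
  qed
  also have "(\<Sum>v \<in> verts ?G. \<Sum>\<beta> \<in> arcs_between ?G ?j v. \<Sum>\<delta> \<in> arcs_between ?G v ?i. X ?g \<beta> \<delta> * cnj (X ?g' \<beta> \<delta>))
    = (\<Sum>(\<beta>, \<delta>) \<in> ?S. X ?g \<beta> \<delta> * cnj (X ?g' \<beta> \<delta>))"
  proof (rule sum_closed_pairs [OF fin_digraph_D [OF k], where F = "\<lambda>v \<beta> \<delta>. X ?g \<beta> \<delta> * cnj (X ?g' \<beta> \<delta>)"])
    show "\<beta> \<in> arcs ?G \<and> \<delta> \<in> arcs ?G \<and> tail ?G \<beta> = ?j \<and> head ?G \<beta> = tail ?G \<delta> \<and> head ?G \<delta> = ?i"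
      if "(\<beta>, \<delta>) \<in> ?S" for \<beta> \<delta>
      using that by auto
    fix \<beta> \<delta>
    assume \<beta>: "\<beta> \<in> arcs ?G" and \<delta>: "\<delta> \<in> arcs ?G" and ends: "tail ?G \<beta> = ?j" "head ?G \<beta> = tail ?G \<delta>" "head ?G \<delta> = ?i"
      and notin: "(\<beta>, \<delta>) \<notin> ?S"
    have tri: "is_triangle ?G ?g \<beta> \<delta>" "is_triangle ?G ?g' \<beta> \<delta>"
      using \<beta> \<delta> ends gamma_in_arcs [OF k] gamma_ends [of k] unfolding is_triangle_def by simp_all
    from \<beta> show "X ?g \<beta> \<delta> * cnj (X ?g' \<beta> \<delta>) = 0"
    proof (cases rule: arcs_D_cases)
      case (Into i)
      from \<delta> have "\<delta> = Outof i"
        by (cases rule: arcs_D_cases) (use Into ends in simp_all)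
      then show ?thesis
        using Into notin by blast
    next
      case (Outof i)
      then show ?thesis
        using ends by simp
    next
      case b: (edge a b c)
      have tb: "orb a b (c + 1) = ?j"
        using ends b by simp
      from \<delta> show ?thesis
      proof (cases rule: arcs_D_cases)
        case (Into i)
        then show ?thesis
          using ends by simp
      next
        case (Outof i)
        then show ?thesis
          using ends b by simp
      next
        case d: (edge x y z)
        have hd: "orb (x + 1) y z = ?i" and mid: "orb (a + 1) b c = orb x y (z + 1)"
          using ends b d by simp_all
        have "(a + 1) + b + c = x + y + (z + 1)"
          using b(2) d(2) by (simp add: edge_ok_def)
        note mid' = mid [unfolded orb_eq_iff [OF this]]
        show ?thesis
        proof (cases rule: edges_from_inner [OF k b(2) tb])
          case 1
          show ?thesis
          proof (cases rule: edges_into_inner [OF k d(2) hd])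
            case 2
            with 1 mid' show ?thesis
              by linarith
          next
            case x: 1
            have "X ?g \<beta> \<delta> = 0"
              unfolding rot2 [OF tri(1)] using orbifold_solutionD(5) [OF k X] 1 x b(1) d(1) by simp
            then show ?thesis
              by simp
          qed
        next
          case 2
          show ?thesis
          proof (cases rule: edges_into_inner [OF k d(2) hd])
            case 1
            with 2 mid' show ?thesis
              by linarith
          next
            case x: 2
            have "X ?g' \<beta> \<delta> = 0"
              unfolding rot2 [OF tri(2)] using orbifold_solutionD(4) [OF k X] 2 x b(1) d(1) by simp
            then show ?thesis
              by simp
          qed
        qed
      qed
    qed
  qed
  also have "\<dots> = (\<Sum>i \<in> {1, 2, 3}. X ?g (Into i) (Outof i) * cnj (X ?g' (Into i) (Outof i)))"
    by (subst sum.reindex) (auto simp: inj_on_def)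
  also have "\<dots> = (\<Sum>i \<in> {1, 2, 3}. X (Into i) (Outof i) ?g * cnj (X (Into i) (Outof i) ?g'))"
  proof (intro sum.cong refl)
    fix i :: nat assume i: "i \<in> {1, 2, 3}"
    show "X ?g (Into i) (Outof i) * cnj (X ?g' (Into i) (Outof i)) = X (Into i) (Outof i) ?g * cnj (X (Into i) (Outof i) ?g')"
      using rot2 [OF triangle_split [OF k i, of ?g]] rot2 [OF triangle_split [OF k i, of ?g']] by simp
  qed
  finally show ?thesis .
qed

text \<open>Let \<open>x\<^sub>i\<close> and \<open>y\<^sub>i\<close> be the cells at \<open>(k, k)\<^sub>i\<close> through \<open>\<gamma>\<close> and \<open>\<gamma>'\<close>. The products \<open>x\<^sub>i \<cdot> cnj y\<^sub>i\<close> have the same absolute value and sum zero, so up to a common factor they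
  are the cube roots of unity in one of two orders. The order decides between \<open>W\<close> and its conjugate.\<close>

lemma split_phases:
  assumes k: "k \<ge> 1" and X: "orbifold_solution k X"
  obtains e t where "e = eps \<or> e = cnj \<circ> eps" "cmod t = 1"
    "\<And>i. i \<in> {1, 2, 3} \<Longrightarrow> X (Into i) (Outof i) (gamma'_arc k) * of_real (tri_cell k (k - 1) k (k - 1))
       = t * (X (Into i) (Outof i) (gamma_arc k) * cnj (e i)) * cnj (e i) * of_real (tri_cell k k (k - 1) k)"
proof -
  define x y where "x = tri_cell k (k - 1) k (k - 1) / sqrt 3" and "y = tri_cell k k (k - 1) k / sqrt 3"
  have pos: "x > 0" "y > 0"
    unfolding x_def y_def by (rule divide_pos_pos [OF tri_cell_pos [OF k]]; use k in simp)+
  define a b where "a = (\<lambda>i. X (Into i) (Outof i) (gamma_arc k))" and "b = (\<lambda>i. X (Into i) (Outof i) (gamma'_arc k))"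
  have mod: "cmod (a i) = x" "cmod (b i) = y" if "i \<in> {1, 2, 3}" for i
    using orbifold_solutionD(2,3) [OF k X that] by (simp_all add: a_def b_def x_def y_def)
  \<comment> \<open>These are the three unit numbers with sum zero.\<close>
  define p where "p = (\<lambda>i. a i * cnj (b i) / of_real (x * y))"
  have "a 1 * cnj (b 1) + a 2 * cnj (b 2) + a 3 * cnj (b 3) = 0"
    using split_cells_orthogonal [OF k X] unfolding sum_one_two_three a_def b_def .
  then have "p 1 + p 2 + p 3 = 0"
    unfolding p_def add_divide_distrib [symmetric] by simp
  moreover have punit: "cmod (p i) = 1" if "i \<in> {1, 2, 3}" for i
    using mod [OF that] pos unfolding p_def by (simp add: norm_divide norm_mult)
  ultimately have "(\<forall>i \<in> {1, 2, 3}. p i = p 1 * cnj (eps i)) \<or> (\<forall>i \<in> {1, 2, 3}. p i = p 1 * eps i)"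
    by (rule three_unit_numbers)
  then obtain e where e: "e = eps \<or> e = cnj \<circ> eps" and p: "\<And>i. i \<in> {1, 2, 3} \<Longrightarrow> p i = p 1 * cnj (e i)"
  proof
    assume "\<forall>i \<in> {1, 2, 3}. p i = p 1 * cnj (eps i)"
    then show thesis
      using that [of eps] by blast
  next
    assume "\<forall>i \<in> {1, 2, 3}. p i = p 1 * eps i"
    then show thesis
      using that [of "cnj \<circ> eps"] by (metis comp_apply complex_cnj_cnj)
  qed
  have square: "cnj (e i) * cnj (e i) = e i" if "i \<in> {1, 2, 3}" for i
  proof -
    have "eps i * eps i = cnj (eps i)"
      using eps_square [OF that] by (simp add: power2_eq_square)
    then show ?thesis
      using e by (metis comp_apply complex_cnj_cnj complex_cnj_mult)
  qed
  have "b i * of_real (tri_cell k (k - 1) k (k - 1)) = cnj (p 1) * (a i * cnj (e i)) * cnj (e i) * of_real (tri_cell k k (k - 1) k)"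
    if i: "i \<in> {1, 2, 3}" for i
  proof -
    have "a i * cnj (b i) = p i * of_real (x * y)"
      using pos by (simp add: p_def)
    then have "cnj (a i) * b i = cnj (p i) * of_real (x * y)"
      by (metis complex_cnj_cnj complex_cnj_complex_of_real complex_cnj_mult)
    then have "(a i * cnj (a i)) * b i = a i * cnj (p i) * of_real (x * y)"
      by (simp add: mult.assoc)
    moreover have "a i * cnj (a i) = of_real (x * x)"
      using mod(1) [OF i] by (metis complex_norm_square power2_eq_square)
    ultimately have "of_real x * (of_real x * b i) = of_real x * (a i * cnj (p i) * of_real y)"
      by (simp add: mult_ac)
    then have "of_real x * b i = a i * cnj (p i) * of_real y"
      using pos by simp
    also have "cnj (p i) = cnj (p 1) * (cnj (e i) * cnj (e i))"
      unfolding square [OF i] using p [OF i] by simp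
    finally have "of_real (sqrt 3) * (of_real x * b i) = of_real (sqrt 3) * (a i * (cnj (p 1) * (cnj (e i) * cnj (e i))) * of_real y)"
      by (rule arg_cong)
    moreover have "of_real (sqrt 3) * of_real x = complex_of_real (tri_cell k (k - 1) k (k - 1))"
      "of_real (sqrt 3) * of_real y = complex_of_real (tri_cell k k (k - 1) k)"
      unfolding of_real_mult [symmetric] by (simp_all add: x_def y_def)
    ultimately show ?thesis
      by (metis (no_types, lifting) mult.assoc mult.commute mult.left_commute)
  qed
  moreover have "cmod (cnj (p 1)) = 1"
    using punit [of 1] by simp
  ultimately show thesis
    using that [OF e, of "cnj (p 1)"] unfolding a_def b_def by blast
qed

text \<open>The phases of \<open>\<gamma>, \<gamma>'\<close> and of the arcs at the split vertices are chosen to fit the split cells.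
  What remains of the graph is an annulus around the centre, in which the phases are
  fixed triangle by triangle from the inside outwards.\<close>

theorem orbifold_solution_unique:
  assumes k: "k \<ge> 1" and X: "orbifold_solution k X"
  shows "cells_equivalent (D_graph k) X (orbifold_cells k eps) \<or> cells_equivalent (D_graph k) X (orbifold_cells k (cnj \<circ> eps))"
proof -
  let ?G = "D_graph k" and ?g = "gamma_arc k" and ?g' = "gamma'_arc k"
  obtain e t where e: "e = eps \<or> e = cnj \<circ> eps" and t: "cmod t = 1"
    and split': "\<And>i. i \<in> {1, 2, 3} \<Longrightarrow> X (Into i) (Outof i) ?g' * of_real (tri_cell k (k - 1) k (k - 1))
       = t * (X (Into i) (Outof i) ?g * cnj (e i)) * cnj (e i) * of_real (tri_cell k k (k - 1) k)"
    using split_phases [OF k X] by blast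
  let ?W = "orbifold_cells k e"
  define x y where "x = tri_cell k (k - 1) k (k - 1)" and "y = tri_cell k k (k - 1) k"
  have pos: "x > 0" "y > 0"
    unfolding x_def y_def by (rule tri_cell_pos [OF k]; use k in simp)+
  have eunit: "e i * cnj (e i) = 1" if "i \<in> {1, 2, 3}" for i
    using e eps_unimodular [OF that] by (auto simp: mult.commute)
  have emod: "cmod (e i) = 1" if "i \<in> {1, 2, 3}" for i
  proof -
    have "cmod (e i) * cmod (e i) = 1"
      using eunit [OF that] by (metis complex_mod_cnj norm_mult norm_one)
    then have "(cmod (e i))\<^sup>2 = 1\<^sup>2"
      by (simp add: power2_eq_square)
    then show ?thesis
      by (rule power2_eq_imp_eq) simp_all
  qed
  have sys: "cell_system (3 * k + 3) ?G (D_weight k) X"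
    by (rule orbifold_solutionD [OF k X])
  have rot: "X \<alpha> \<beta> \<delta> = X \<beta> \<delta> \<alpha>" if "is_triangle ?G \<alpha> \<beta> \<delta>" for \<alpha> \<beta> \<delta>
    using sys that unfolding cell_system_def by blast
  have turn: "is_triangle ?G \<beta> \<delta> \<alpha>" if "is_triangle ?G \<alpha> \<beta> \<delta>" for \<alpha> \<beta> \<delta>
    using that unfolding is_triangle_def by blast
  \<comment> \<open>Arcs out of the split vertices and \<open>\<gamma>\<close> get phase one; the cell through \<open>\<gamma>\<close> then fixes the phase into \<open>(k, k)\<^sub>i\<close>.\<close>
  define g where "g = (\<lambda>\<xi>. if \<xi> = ?g' then t else case \<xi> of
      Into i \<Rightarrow> if i \<in> {1, 2, 3} then X (Into i) (Outof i) ?g * cnj (e i) * of_real (sqrt 3 / x) else 1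
    | _ \<Rightarrow> 1)"
  have orbit: "?g' \<noteq> Into i" "?g' \<noteq> Outof i" for i
    by (simp_all add: gamma'_arc_edge)
  have "g ?g = (case ?g of Into i \<Rightarrow> if i \<in> {1, 2, 3} then X (Into i) (Outof i) ?g * cnj (e i) * of_real (sqrt 3 / x) else 1 | _ \<Rightarrow> 1)"
    by (simp add: g_def)
  also have "\<dots> = 1"
    by (simp add: gamma_arc_def D_arc_def)
  finally have "g ?g = 1" .
  moreover have "g ?g' = t" "g (Outof i) = 1"
    "i \<in> {1, 2, 3} \<Longrightarrow> g (Into i) = X (Into i) (Outof i) ?g * cnj (e i) * of_real (sqrt 3 / x)" for i
    using orbit [symmetric] by (simp_all add: g_def)
  ultimately have g: "g ?g = 1" "g ?g' = t" "g (Outof i) = 1"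
    "i \<in> {1, 2, 3} \<Longrightarrow> g (Into i) = X (Into i) (Outof i) ?g * cnj (e i) * of_real (sqrt 3 / x)" for i
    by blast+
  have gunit: "cmod (g \<xi>) = 1" for \<xi>
  proof (cases \<xi>)
    case (Into i)
    show ?thesis
    proof (cases "i \<in> {1, 2, 3}")
      case True
      then show ?thesis
        unfolding Into g(4) [OF True] using orbifold_solutionD(2) [OF k X True] emod [OF True] pos
        by (simp add: norm_mult x_def norm_divide)
    qed (simp add: g_def Into t)
  qed (simp_all add: g_def t)
  define T where "T = (\<lambda>i :: cell_index. case i of Inl (a, b, c) \<Rightarrow> tri_cell k a b c | Inr (a, b, c) \<Rightarrow> tri_cell k a b c)"
  define Z where "Z = (\<lambda>i. (case i of Inl (a, b, c) \<Rightarrow> X (edge a b c) (edge b c a) (edge c a b)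
      | Inr (a, b, c) \<Rightarrow> X (edge b (c + 1) a) (edge a (b + 1) c) (edge c (a + 1) b)) / of_real (T i))"
  have upT: "tri_cell k a b c > 0" if "up_ok k a b c" for a b c
    using up_okD [OF that] k by (intro tri_cell_pos) linarith+
  have downT: "tri_cell k a b c > 0" if "down_ok k a b c" for a b c
    using down_okD [OF that] k by (intro tri_cell_pos) linarith+
  have Zunit: "cmod (Z i) = 1" if "i \<in> cell_indices k" for i
    using that
  proof (cases rule: cell_indices_cases)
    case (up a b c)
    then show ?thesis
      using orbifold_solutionD(6) [OF k X up(2)] upT [OF up(2)] by (simp add: Z_def T_def norm_divide)
  next
    case (down a b c)
    then show ?thesis
      using orbifold_solutionD(7) [OF k X down(2)] downT [OF down(2)] by (simp add: Z_def T_def norm_divide)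
  qed
  have "\<exists>u. (\<forall>\<xi>. cmod (u \<xi>) = 1) \<and> (\<forall>\<xi> \<in> {?g, ?g'} \<union> range Into \<union> range Outof. u \<xi> = g \<xi>)
    \<and> (\<forall>i \<in> cell_indices k. u (fst (index_arcs i)) * u (fst (snd (index_arcs i))) * u (snd (snd (index_arcs i))) = Z i)"
  proof (rule phase_extension [where r = index_rank, OF finite_cell_indices gunit])
    show "snd (snd (index_arcs i)) \<noteq> fst (index_arcs i) \<and> snd (snd (index_arcs i)) \<noteq> fst (snd (index_arcs i))
        \<and> snd (snd (index_arcs i)) \<notin> {?g, ?g'} \<union> range Into \<union> range Outof \<and> cmod (Z i) = 1"
      if "i \<in> cell_indices k" for i
      using index_free_edge [OF that] Zunit [OF that] by blast
  qed (rule index_rank_increases)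
  then obtain u where u: "\<And>\<xi>. cmod (u \<xi>) = 1" "\<And>\<xi>. \<xi> \<in> {?g, ?g'} \<union> range Into \<union> range Outof \<Longrightarrow> u \<xi> = g \<xi>"
    "\<And>i. i \<in> cell_indices k \<Longrightarrow> u (fst (index_arcs i)) * u (fst (snd (index_arcs i))) * u (snd (snd (index_arcs i))) = Z i"
    by blast
  let ?P = "\<lambda>\<alpha> \<beta> \<delta>. X \<alpha> \<beta> \<delta> = u \<alpha> * u \<beta> * u \<delta> * ?W \<alpha> \<beta> \<delta>"
  have rotP: "?P \<alpha> \<beta> \<delta>" if "is_triangle ?G \<alpha> \<beta> \<delta>" "?P \<beta> \<delta> \<alpha>" for \<alpha> \<beta> \<delta>
    using rot [OF that(1)] that(2) orbifold_cells_rotate [of k e \<alpha> \<beta> \<delta>] by (simp add: mult_ac)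
  have up: "?P (edge a b c) (edge b c a) (edge c a b)" if ok: "up_ok k a b c" "a \<le> b" "a < c" for a b c
  proof -
    have "Inl (a, b, c) \<in> cell_indices k"
      using that unfolding cell_indices_def by blast
    from u(3) [OF this] have "u (edge a b c) * u (edge b c a) * u (edge c a b) = X (edge a b c) (edge b c a) (edge c a b) / of_real (tri_cell k a b c)"
      by (simp add: Z_def T_def)
    then show ?thesis
      unfolding orbifold_cells_up using upT [OF ok(1)] by simp
  qed
  have down: "?P (edge b (c + 1) a) (edge a (b + 1) c) (edge c (a + 1) b)" if ok: "down_ok k a b c" "a < b" "c \<le> b" for a b c
  proof -
    have "Inr (a, b, c) \<in> cell_indices k"
      using that unfolding cell_indices_def by blast
    from u(3) [OF this] have "u (edge b (c + 1) a) * u (edge a (b + 1) c) * u (edge c (a + 1) b)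
      = X (edge b (c + 1) a) (edge a (b + 1) c) (edge c (a + 1) b) / of_real (tri_cell k a b c)"
      by (simp add: Z_def T_def mult_ac)
    then show ?thesis
      unfolding orbifold_cells_down' using downT [OF ok(1)] by simp
  qed
  have "?P \<alpha> \<beta> \<delta>" if tri: "is_triangle ?G \<alpha> \<beta> \<delta>" for \<alpha> \<beta> \<delta>
    using k tri
  proof (rule triangle_induct [where P = ?P])
    show "?P (edge a b c) (edge b c a) (edge c a b)" if "edge_ok k a b c" "edge_ok k b c a" "edge_ok k c a b" for a b c
    proof -
      have ok: "up_ok k a b c" "up_ok k b c a" "up_ok k c a b"
        using that by (simp_all add: up_ok_def)
      have "\<not> (a = b \<and> b = c)"
        using up_okD [OF ok(1)] by presburger
      then consider "a \<le> b" "a < c" | "b \<le> c" "b < a" | "c \<le> a" "c < b"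
        by linarith
      then show ?thesis
      proof cases
        case 1
        then show ?thesis
          using up ok(1) by blast
      next
        case 2
        show ?thesis
          by (rule rotP [OF triangle_up [OF ok(1)] up [OF ok(2) 2]])
      next
        case 3
        show ?thesis
          by (rule rotP [OF triangle_up [OF ok(1)] rotP [OF triangle_up [OF ok(2)] up [OF ok(3) 3]]])
      qed
    qed
    show "?P (edge b (c + 1) a) (edge a (b + 1) c) (edge c (a + 1) b)"
      if "edge_ok k b (c + 1) a" "edge_ok k a (b + 1) c" "edge_ok k c (a + 1) b" for a b c
    proof -
      have ok: "down_ok k a b c" "down_ok k b c a" "down_ok k c a b"
        using that by (simp_all add: down_ok_def)
      have "\<not> (a = b \<and> b = c)"
        using down_okD [OF ok(1)] by presburger
      then consider "a < b" "c \<le> b" | "b < c" "a \<le> c" | "c < a" "b \<le> a"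
        by linarith
      then show ?thesis
      proof cases
        case 1
        then show ?thesis
          using down ok(1) by blast
      next
        case 2
        show ?thesis
          by (rule rotP [OF triangle_down [OF ok(1)] rotP [OF turn [OF triangle_down [OF ok(1)]] down [OF ok(2) 2]]])
      next
        case 3
        show ?thesis
          by (rule rotP [OF triangle_down [OF ok(1)] down [OF ok(3) 3]])
      qed
    qed
    show "?P (Into i) (Outof i) \<xi>" if i: "i \<in> {1, 2, 3}" and \<xi>: "\<xi> \<in> {?g, ?g'}" for i \<xi>
    proof -
      have ui: "u (Into i) = X (Into i) (Outof i) ?g * cnj (e i) * of_real (sqrt 3 / x)" "u (Outof i) = 1" "u ?g = 1" "u ?g' = t"
        using u(2) g i by simp_all
      have gamma: "?P (Into i) (Outof i) ?g"
      proof -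
        have "u (Into i) * u (Outof i) * u ?g * ?W (Into i) (Outof i) ?g
          = X (Into i) (Outof i) ?g * (e i * cnj (e i)) * (of_real (sqrt 3 / x) * of_real (x / sqrt 3))"
          unfolding ui by (simp add: x_def mult_ac)
        also have "of_real (sqrt 3 / x) * of_real (x / sqrt 3) = (1 :: complex)"
          unfolding of_real_mult [symmetric] using pos by simp
        finally show ?thesis
          unfolding eunit [OF i] by simp
      qed
      have gamma': "?P (Into i) (Outof i) ?g'"
      proof -
        have "u (Into i) * u (Outof i) * u ?g' * ?W (Into i) (Outof i) ?g'
          = (t * (X (Into i) (Outof i) ?g * cnj (e i)) * cnj (e i) * of_real y) * (of_real (sqrt 3 / x) * of_real (1 / sqrt 3))"
          unfolding ui by (simp add: y_def mult_ac)
        also have "\<dots> = X (Into i) (Outof i) ?g' * (of_real x * (of_real (sqrt 3 / x) * of_real (1 / sqrt 3)))"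
          unfolding x_def y_def split' [OF i, symmetric] by (simp only: mult.assoc)
        also have "of_real x * (of_real (sqrt 3 / x) * of_real (1 / sqrt 3)) = (1 :: complex)"
          unfolding of_real_mult [symmetric] using pos by simp
        finally show ?thesis
          by simp
      qed
      show ?thesis
        using \<xi> gamma gamma' by blast
    qed
    show "?P (edge (k - 1) (k - 1) (k + 1)) ?g' (edge (k + 1) (k - 1) (k - 1))"
      using orbifold_solutionD(4) [OF k X] orbifold_cells_zero(1) [of k e] unfolding cell_low_eq by simp
    show "?P (edge (k - 2) (k + 1) k) ?g (edge k (k + 1) (k - 2))" if "k \<noteq> 1"
      using orbifold_solutionD(5) [OF k X that] orbifold_cells_zero(2) [of k e] unfolding cell_side_eq by simp
  qed (rule rotP)
  then have "cells_equivalent ?G X ?W"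
    using diagonal_equivalent [OF fin_digraph_D [OF k], of u X ?W] u(1) by blast
  then show ?thesis
    using e by blast
qed

theorem theorem6p2:
  fixes k :: int
  assumes "k \<ge> 1"
  shows "\<exists>W. standard_cells k W \<and>
           orbifold_solution k W \<and> orbifold_solution k (conj_cells W) \<and>
           \<not> cells_equivalent (D_graph k) W (conj_cells W) \<and>
           (\<forall>X. orbifold_solution k X \<longrightarrow>
              cells_equivalent (D_graph k) X W \<or> cells_equivalent (D_graph k) X (conj_cells W))"
  using standard_orbifold_cells [OF assms] orbifold_solution_orbifold_cells [OF assms]
    orbifold_solution_conj [OF orbifold_solution_orbifold_cells [OF assms]] not_equivalent_conj [OF assms]
    orbifold_solution_unique [OF assms]
  by (intro exI [of _ "orbifold_cells k eps"]) (simp add: conj_orbifold_cells)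

end
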